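(* Let $d\ge1$ be an integer and let $0<p<1$, $0<q<\infty$, $0<s<1/p$. Then $B_{p,q,1}^s(I^d)$ has no nontrivial bounded linear functionals, i.e. $B_{p,q,1}^s(I^d)'=\{0\}$, if and only if either $s<d(1/p-1)$ (with $0<q<\infty$ arbitrary), or $s=d(1/p-1)$ and $1<q<\infty$.
   Context: Notation: $I=[0,1]$, $I^d\subset\mathbb{R}^d$ is the unit cube with Lebesgue measure, functions are real-valued and identified when equal a.e., $L_p=L_p(I^d)$ with the usual (quasi-)norm. Besov spaces: for $y\in\mathbb{R}^d$ let $I^d_y=\{z\in I^d: z+y\in I^d\}$ and $\Delta_y f(x)=f(x+y)-f(x)$ for $x\in I^d_y$. The first-order $L_p$ modulus of smoothness is $\omega(t,f)_p=\sup_{0<|y|\le t}\|\Delta_y f\|_{L_p(I^d_y)}$, $t>0$. For $0<p,q<\infty$, the space $B_{p,q,1}^s(I^d)$ is the set of all $f\in L_p(I^d)$ with finite quasi-norm $$\|f\|_{B_{p,q,1}^s}=\Big(\|f\|_{L_p}^q+\int_0^1 \big(t^{-s}\omega(t,f)_p\big)^q\,\frac{dt}{t}\Big)^{1/q}.$$ It is a quasi-Banach space. $X'$ denotes the space of continuous (equivalently, bounded) linear functionals on the quasi-Banach space $X$. *)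

theory Defs
  imports "HOL-Analysis.Analysis"
begin

definition unit_cube :: "(real ^ 'n) set" where
  "unit_cube = cbox 0 1"

definition shift_cube :: "real ^ 'n \<Rightarrow> (real ^ 'n) set" where
  "shift_cube y = {z \<in> unit_cube. z + y \<in> unit_cube}"

definition diff_op :: "real ^ 'n \<Rightarrow> (real ^ 'n \<Rightarrow> real) \<Rightarrow> real ^ 'n \<Rightarrow> real" where
  "diff_op y f x = f (x + y) - f x"

text \<open>Functions are total on the ambient space, but everything below depends only on their
  values on the unit cube.\<close>

definition Lp_space :: "real \<Rightarrow> (real ^ 'n) set \<Rightarrow> (real ^ 'n \<Rightarrow> real) set" where
  "Lp_space p S = {f \<in> borel_measurable (lebesgue_on S).
     integrable (lebesgue_on S) (\<lambda>x. \<bar>f x\<bar> powr p)}"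

definition Lp_norm :: "real \<Rightarrow> (real ^ 'n) set \<Rightarrow> (real ^ 'n \<Rightarrow> real) \<Rightarrow> real" where
  "Lp_norm p S f = (LINT x|lebesgue_on S. \<bar>f x\<bar> powr p) powr (1 / p)"

text \<open>The real-valued supremum is only used for \<open>f \<in> Lp_space p unit_cube\<close> and \<open>t > 0\<close>. There
  it ranges over a nonempty set, which is bounded because the \<open>p\<close>-th power of the \<open>L\<^sub>p\<close>-norm of
  \<open>diff_op y f\<close> is at most a constant (2 if \<open>p \<le> 1\<close>) times that of \<open>f\<close>.\<close>

definition Lp_modulus :: "real \<Rightarrow> real \<Rightarrow> (real ^ 'n \<Rightarrow> real) \<Rightarrow> real" where
  "Lp_modulus p t f = (SUP y \<in> {y. 0 < norm y \<and> norm y \<le> t}. Lp_norm p (shift_cube y) (diff_op y f))"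

text \<open>In \<open>besov\<close>, integrability expresses finiteness of the quasi-norm: the integrand
  is nonnegative, and it is Borel measurable since the modulus is nondecreasing in \<open>t\<close>.\<close>

definition besov_integrand ::
    "real \<Rightarrow> real \<Rightarrow> real \<Rightarrow> (real ^ 'n \<Rightarrow> real) \<Rightarrow> real \<Rightarrow> real" where
  "besov_integrand p q s f t = (t powr (- s) * Lp_modulus p t f) powr q / t"

definition besov :: "real \<Rightarrow> real \<Rightarrow> real \<Rightarrow> (real ^ 'n \<Rightarrow> real) set" where
  "besov p q s = {f \<in> Lp_space p unit_cube. set_integrable lborel {0<..1} (besov_integrand p q s f)}"

definition besov_norm :: "real \<Rightarrow> real \<Rightarrow> real \<Rightarrow> (real ^ 'n \<Rightarrow> real) \<Rightarrow> real" where
  "besov_norm p q s f =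
     (Lp_norm p unit_cube f powr q + (LBINT t:{0<..1}. besov_integrand p q s f t)) powr (1 / q)"

text \<open>Elements of the space are classes of functions modulo equality almost everywhere. A
  functional on the space is represented as a functional on functions that is constant on these
  classes. Its value outside \<open>besov p q s\<close> is fixed to 0, so that distinct elements of
  \<open>besov_dual\<close> are distinct functionals on the space.\<close>

definition besov_dual :: "real \<Rightarrow> real \<Rightarrow> real \<Rightarrow> ((real ^ 'n \<Rightarrow> real) \<Rightarrow> real) set" where
  "besov_dual p q s = {F.
     (\<forall>f. f \<notin> besov p q s \<longrightarrow> F f = 0) \<and>
     (\<forall>f \<in> besov p q s. \<forall>g \<in> besov p q s.
        (AE x in lebesgue_on unit_cube. f x = g x) \<longrightarrow> F f = F g) \<and>
     (\<forall>f \<in> besov p q s. \<forall>g \<in> besov p q s. F (\<lambda>x. f x + g x) = F f + F g) \<and>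
     (\<forall>c. \<forall>f \<in> besov p q s. F (\<lambda>x. c * f x) = c * F f) \<and>
     (\<exists>C. \<forall>f \<in> besov p q s. \<bar>F f\<bar> \<le> C * besov_norm p q s f)}"

end

theory Submission
  imports Defs
begin

text \<open>
  Let \<open>d\<close> be the dimension. The threshold \<open>d (1 / p - 1)\<close> is the smoothness at which the function
  \<open>2\<^sup>k\<^sup>d\<close> times the indicator of a cube of side \<open>1 / 2\<^sup>k\<close>, whose integral is 1, has a quasi-norm of
  constant order in \<open>k\<close>: the difference of the indicator of a cube of side \<open>r\<close> under a shift by \<open>y\<close>
  has \<open>p\<close>-th power mass of order \<open>r\<^sup>d min 1 (\<bar>y\<bar> / r)\<close>.

  Triviality below the threshold. Let \<open>F\<close> be a bounded functional. The indicator of a cube is the sum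
  of the indicators of its \<open>2\<^sup>d\<close> halves, so one of them carries at least the average share of \<open>F\<close>.
  Repeating this, one finds for each \<open>k\<close> a cube of side \<open>r / 2\<^sup>k\<close> such that \<open>F\<close> at \<open>2\<^sup>k\<^sup>d\<close> times its
  indicator is at least the value of \<open>F\<close> at the indicator of the given cube of side \<open>r\<close>
  (\<open>dual_concentrates\<close>). Below the threshold these functions tend to 0 in norm, so \<open>F\<close> vanishes at
  the given indicator (\<open>dual_vanishes_on_cubes_subcritical\<close>). At the threshold they are merely bounded,
  but they live at different scales: the mean of the first \<open>K\<close> of them has a norm whose \<open>q\<close>-th power is
  of order \<open>K\<close> to the power \<open>1 - q\<close>, which tends to 0 for \<open>q > 1\<close>
  (\<open>dual_vanishes_on_cubes_critical\<close>).

  It remains to see that step functions are dense. For a mesh of width \<open>1 / n\<close> replace \<open>f\<close> on each cell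
  by its value at one point, taken at the same relative position \<open>a\<close> in every cell. Means over cells
  are not available as \<open>f\<close> need not be integrable, but averaging the error over \<open>a\<close> shows that a suitable
  \<open>a\<close> makes both the \<open>L\<^sub>p\<close> error and the jumps between neighbouring cells as small as the modulus of
  smoothness of \<open>f\<close> at scale \<open>d / n\<close> (\<open>sampling\<close>). The Besov norm of the error is then controlled by
  the part of the norm integral of \<open>f\<close> over \<open>{0<..2 d / n}\<close>, which tends to 0
  (\<open>sampling_approximates\<close>, \<open>dual_determined_by_cubes\<close>). The hypothesis \<open>s < 1 / p\<close> is what makes step
  functions elements of the space.

  Nontriviality otherwise. The samplings of \<open>f\<close> on dyadic meshes converge to \<open>f\<close>, and two
  consecutive ones differ by a function that is constant on cells of side \<open>1 / 2\<^sup>k\<close>; for such functions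
  the \<open>L\<^sub>1\<close> norm is at most \<open>2\<close> to the power \<open>k d (1 / p - 1)\<close> times the \<open>L\<^sub>p\<close> quasi-norm
  (\<open>cell_constant_pmass_1_le\<close>). Summing over \<open>k\<close> bounds the \<open>L\<^sub>1\<close> norm of \<open>f\<close> by its Besov norm above
  the threshold, and at the threshold if \<open>q \<le> 1\<close> (\<open>besov_embeds_L1\<close>). Hence the integral is a bounded
  functional, and it is not zero.
\<close>

section \<open>Powers of sums and half-open cubes\<close>

text \<open>The \<open>p\<close>-th power of the \<open>L\<^sub>p\<close> quasi-norm is subadditive for \<open>p \<le> 1\<close>; for this
  reason all estimates below are carried out for \<open>p\<close>-th powers.\<close>

lemma powr_add_le:
  fixes a b p :: real
  assumes "0 \<le> a" "0 \<le> b" "0 < p" "p \<le> 1"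
  shows "(a + b) powr p \<le> a powr p + b powr p"
proof (cases "a + b = 0")
  case True
  then show ?thesis using assms by simp
next
  case False
  define c where "c = a + b"
  have c: "c > 0" using False assms by (simp add: c_def)
  have *: "x / c * c powr p \<le> x powr p" if "0 \<le> x" "x \<le> c" for x
  proof -
    have "(x / c) powr 1 \<le> (x / c) powr p"
      using that c assms by (intro powr_mono') auto
    moreover have "(x / c) powr p * c powr p = x powr p"
      using that c by (simp add: powr_divide)
    moreover have "(x / c) powr 1 = x / c" using that c by (cases "x = 0") auto
    ultimately show ?thesis
      using mult_right_mono[of "x / c" "(x / c) powr p" "c powr p"] by simp
  qed
  have "c powr p = a / c * c powr p + b / c * c powr p"
    using c by (simp add: c_def flip: distrib_right add_divide_distrib)
  also have "\<dots> \<le> a powr p + b powr p"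
    using *[of a] *[of b] assms by (auto simp: c_def)
  finally show ?thesis by (simp add: c_def)
qed

lemma powr_add_le_two:
  fixes a b r :: real
  assumes "0 \<le> a" "0 \<le> b" "0 < r"
  shows "(a + b) powr r \<le> 2 powr r * (a powr r + b powr r)"
proof -
  have "(a + b) powr r \<le> (2 * max a b) powr r"
    using assms by (intro powr_mono2) auto
  also have "\<dots> = 2 powr r * max a b powr r"
    using assms by (simp add: powr_mult)
  also have "\<dots> \<le> 2 powr r * (a powr r + b powr r)"
    by (intro mult_left_mono) (auto simp: max_def)
  finally show ?thesis .
qed

text \<open>Half-open cubes, unlike closed ones, split into half-open cubes without overlap, so that the
  indicator of a cube is exactly the sum of the indicators of its \<open>2\<^sup>d\<close> halves.\<close>

definition hcube :: "real ^ 'n \<Rightarrow> real \<Rightarrow> (real ^ 'n) set" where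
  "hcube c r = {x. \<forall>i. c $ i \<le> x $ i \<and> x $ i < c $ i + r}"

lemma hcube_borel [measurable, simp]: "hcube c r \<in> sets borel"
  unfolding hcube_def by measurable

lemma emeasure_lborel_cbox_cart:
  fixes a b :: "real ^ 'n"
  assumes "\<And>i. a $ i \<le> b $ i"
  shows "emeasure lborel (cbox a b) = ennreal (\<Prod>i\<in>UNIV. b $ i - a $ i)"
proof -
  have "cbox a b \<noteq> {}" using assms by (auto simp: interval_ne_empty_cart)
  then have "measure lborel (cbox a b) = (\<Prod>i\<in>UNIV. b $ i - a $ i)"
    by (rule content_cbox_cart)
  moreover have "emeasure lborel (cbox a b) \<noteq> \<infinity>"
    using emeasure_lborel_cbox_finite[of a b] by simp
  ultimately show ?thesis
    using emeasure_eq_ennreal_measure[of lborel "cbox a b"] by simp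
qed

lemma cbox_hcube_null:
  fixes c :: "real ^ 'n"
  shows "cbox c (\<chi> i. c $ i + r) - hcube c r \<in> null_sets lborel"
proof -
  have "negligible (cbox c (\<chi> i. c $ i + r) - box c (\<chi> i. c $ i + r))"
    by (rule negligible_frontier_interval)
  moreover have "cbox c (\<chi> i. c $ i + r) - hcube c r \<subseteq>
      cbox c (\<chi> i. c $ i + r) - box c (\<chi> i. c $ i + r)"
    by (auto simp: hcube_def mem_box_cart less_imp_le)
  ultimately have "negligible (cbox c (\<chi> i. c $ i + r) - hcube c r)"
    by (rule negligible_subset)
  then have "cbox c (\<chi> i. c $ i + r) - hcube c r \<in> null_sets lebesgue"
    by (simp add: negligible_iff_null_sets)
  then show ?thesis by (simp add: null_sets_completion_iff)
qed

lemma hcube_subset_cbox: "hcube c r \<subseteq> cbox c (\<chi> i. c $ i + r)"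
  by (auto simp: hcube_def mem_box_cart less_imp_le)

lemma emeasure_hcube:
  fixes c :: "real ^ 'n"
  assumes "0 \<le> r"
  shows "emeasure lborel (hcube c r) = ennreal (r ^ CARD('n))"
proof -
  let ?B = "cbox c (\<chi> i. c $ i + r)"
  have "hcube c r = ?B - (?B - hcube c r)"
    using hcube_subset_cbox by blast
  then have "emeasure lborel (hcube c r) = emeasure lborel ?B"
    using emeasure_Diff_null_set[OF cbox_hcube_null[of c r], of ?B] by simp
  also have "\<dots> = ennreal (r ^ CARD('n))"
    using assms by (subst emeasure_lborel_cbox_cart) auto
  finally show ?thesis .
qed

abbreviation ucube :: "(real ^ 'n) set" where "ucube \<equiv> hcube 0 1"

lemma ucube_subset: "ucube \<subseteq> unit_cube"
  by (auto simp: unit_cube_def hcube_def mem_box_cart less_imp_le)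

lemma unit_cube_diff_null: "unit_cube - ucube \<in> null_sets lborel"
proof -
  have "(\<chi> i. (0::real^'n) $ i + 1) = 1" by (simp add: vec_eq_iff)
  then show ?thesis using cbox_hcube_null[of "0 :: real^'n" 1] unfolding unit_cube_def by metis
qed

lemma unit_cube_borel [measurable, simp]: "unit_cube \<in> sets borel"
  by (simp add: unit_cube_def)

lemma shift_cube_borel [measurable, simp]: "shift_cube y \<in> sets borel"
  unfolding shift_cube_def by measurable

text \<open>Up to a null set this is \<^const>\<open>shift_cube\<close>; being a condition on \<open>x\<close> and \<open>x + y\<close> in the
  half-open cube, it depends only on the grid cells of the two points.\<close>

definition jcube :: "real ^ 'n \<Rightarrow> (real ^ 'n) set" where
  "jcube y = {x \<in> ucube. x + y \<in> ucube}"

lemma jcube_borel [measurable, simp]: "jcube y \<in> sets borel"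
  unfolding jcube_def by measurable

lemma jcube_subset: "jcube y \<subseteq> shift_cube y"
  using ucube_subset by (auto simp: jcube_def shift_cube_def)

lemma nn_integral_lborel_shift:
  fixes g :: "real ^ 'n \<Rightarrow> ennreal"
  assumes [measurable]: "g \<in> borel_measurable borel"
  shows "(\<integral>\<^sup>+x. g (x + y) \<partial>lborel) = (\<integral>\<^sup>+x. g x \<partial>lborel)"
proof -
  have "(\<integral>\<^sup>+x. g x \<partial>lborel) = (\<integral>\<^sup>+x. g x \<partial>distr lborel borel ((+) y))"
    by (simp add: lborel_distr_plus)
  also have "\<dots> = (\<integral>\<^sup>+x. g (y + x) \<partial>lborel)"
    by (subst nn_integral_distr) auto
  finally show ?thesis by (simp add: add.commute)
qed

lemma emeasure_lborel_shift:
  fixes A :: "(real ^ 'n) set"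
  assumes [measurable]: "A \<in> sets borel"
  shows "emeasure lborel {x. x + y \<in> A} = emeasure lborel A"
proof -
  have "(\<integral>\<^sup>+x. indicator A (x + y) \<partial>lborel) = (\<integral>\<^sup>+x. indicator {x. x + y \<in> A} x \<partial>lborel)"
    by (intro nn_integral_cong) (auto simp: indicator_def)
  then have "emeasure lborel {x. x + y \<in> A} = (\<integral>\<^sup>+x. indicator A (x + y) \<partial>lborel)"
    by simp
  also have "\<dots> = emeasure lborel A"
    by (subst nn_integral_lborel_shift) auto
  finally show ?thesis .
qed

lemma shift_cube_diff_null: "shift_cube y - jcube y \<in> null_sets lborel"
proof (rule null_sets_subset)
  let ?N = "unit_cube - ucube :: (real^'n) set"
  have [measurable]: "?N \<in> sets borel" by measurable
  have "emeasure lborel {x. x + y \<in> ?N} = 0"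
    using unit_cube_diff_null emeasure_lborel_shift[of ?N y] by (auto simp: null_sets_def)
  then have "{x. x + y \<in> ?N} \<in> null_sets lborel"
    by (intro null_setsI) auto
  then show "?N \<union> {x. x + y \<in> ?N} \<in> null_sets lborel"
    using unit_cube_diff_null by blast
  show "shift_cube y - jcube y \<in> sets lborel" by simp
  show "shift_cube y - jcube y \<subseteq> ?N \<union> {x. x + y \<in> ?N}"
    by (auto simp: shift_cube_def jcube_def)
qed

section \<open>Quasi-norms and moduli as integrals over the Borel measure\<close>

text \<open>The \<open>p\<close>-th power of the \<open>L\<^sub>p\<close> quasi-norm as an extended nonnegative Lebesgue integral over the
  Borel measure: this needs no integrability side conditions and admits Tonelli's theorem.\<close>

definition pmass :: "real \<Rightarrow> (real ^ 'n) set \<Rightarrow> (real ^ 'n \<Rightarrow> real) \<Rightarrow> ennreal" where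
  "pmass p S f = (\<integral>\<^sup>+x. ennreal (\<bar>f x\<bar> powr p) * indicator S x \<partial>lborel)"

definition diffp :: "real \<Rightarrow> (real ^ 'n \<Rightarrow> real) \<Rightarrow> real ^ 'n \<Rightarrow> ennreal" where
  "diffp p f y = pmass p (jcube y) (diff_op y f)"

lemma diff_op_borel [measurable]:
  fixes f :: "real ^ 'n \<Rightarrow> real"
  assumes [measurable]: "f \<in> borel_measurable borel"
  shows "diff_op y f \<in> borel_measurable borel"
  unfolding diff_op_def[abs_def] by measurable

lemma borel_imp_lebesgue_on:
  fixes f :: "real ^ 'n \<Rightarrow> 'b::topological_space"
  assumes "f \<in> borel_measurable borel"
  shows "f \<in> borel_measurable (lebesgue_on S)"
proof -
  have "f \<in> borel_measurable lborel" using assms by simp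
  then show ?thesis by (intro measurable_restrict_space1 measurable_completion)
qed

lemma nn_integral_lebesgue_on:
  fixes g :: "real ^ 'n \<Rightarrow> ennreal"
  assumes [measurable]: "g \<in> borel_measurable borel" "S \<in> sets borel" "T \<in> sets borel"
    and "T \<subseteq> S" "S - T \<in> null_sets lborel"
  shows "(\<integral>\<^sup>+x. g x \<partial>lebesgue_on S) = (\<integral>\<^sup>+x. g x * indicator T x \<partial>lborel)"
proof -
  have "S \<in> sets lebesgue" by (simp add: assms)
  then have "(\<integral>\<^sup>+x. g x \<partial>lebesgue_on S) = (\<integral>\<^sup>+x. g x * indicator S x \<partial>lebesgue)"
    by (subst nn_integral_restrict_space) auto
  also have "\<dots> = (\<integral>\<^sup>+x. g x * indicator S x \<partial>lborel)"
    by (simp add: nn_integral_completion)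
  also have "\<dots> = (\<integral>\<^sup>+x. g x * indicator T x \<partial>lborel)"
  proof (rule nn_integral_cong_AE)
    show "AE x in lborel. g x * indicator S x = g x * indicator T x"
      using AE_not_in[OF assms(5)] assms(4) by (auto elim!: eventually_mono simp: indicator_def)
  qed
  finally show ?thesis .
qed

lemma Lp_norm_eq:
  fixes f :: "real ^ 'n \<Rightarrow> real"
  assumes [measurable]: "f \<in> borel_measurable borel" "S \<in> sets borel" "T \<in> sets borel"
    and "T \<subseteq> S" "S - T \<in> null_sets lborel"
  shows "Lp_norm p S f = enn2real (pmass p T f) powr (1 / p)"
proof -
  have "(\<lambda>x. \<bar>f x\<bar> powr p) \<in> borel_measurable (lebesgue_on S)"
    by (rule borel_imp_lebesgue_on) measurable
  then have "(LINT x|lebesgue_on S. \<bar>f x\<bar> powr p)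
      = enn2real (\<integral>\<^sup>+x. ennreal (\<bar>f x\<bar> powr p) \<partial>lebesgue_on S)"
    by (intro integral_eq_nn_integral) auto
  then show ?thesis
    unfolding Lp_norm_def pmass_def
    using nn_integral_lebesgue_on[of "\<lambda>x. ennreal (\<bar>f x\<bar> powr p)" S T] assms by simp
qed

lemma Lp_norm_unit_cube:
  "f \<in> borel_measurable borel \<Longrightarrow> Lp_norm p unit_cube f = enn2real (pmass p ucube f) powr (1 / p)"
  by (intro Lp_norm_eq ucube_subset unit_cube_diff_null) auto

lemma Lp_norm_shift_cube:
  "f \<in> borel_measurable borel \<Longrightarrow>
    Lp_norm p (shift_cube y) (diff_op y f) = enn2real (diffp p f y) powr (1 / p)"
  unfolding diffp_def by (intro Lp_norm_eq jcube_subset shift_cube_diff_null) auto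

lemma Lp_space_iff:
  fixes f :: "real ^ 'n \<Rightarrow> real"
  assumes [measurable]: "f \<in> borel_measurable borel"
  shows "f \<in> Lp_space p unit_cube \<longleftrightarrow> pmass p ucube f < \<infinity>"
proof -
  have "(\<lambda>x. \<bar>f x\<bar> powr p) \<in> borel_measurable (lebesgue_on unit_cube)"
    by (rule borel_imp_lebesgue_on) measurable
  then have "integrable (lebesgue_on unit_cube) (\<lambda>x. \<bar>f x\<bar> powr p) \<longleftrightarrow>
     (\<integral>\<^sup>+x. ennreal (\<bar>f x\<bar> powr p) \<partial>lebesgue_on unit_cube) < \<infinity>"
    by (simp add: integrable_iff_bounded)
  moreover have "(\<integral>\<^sup>+x. ennreal (\<bar>f x\<bar> powr p) \<partial>lebesgue_on unit_cube) = pmass p ucube f"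
    unfolding pmass_def
    by (rule nn_integral_lebesgue_on[OF _ _ _ ucube_subset unit_cube_diff_null]) auto
  ultimately show ?thesis
    unfolding Lp_space_def using borel_imp_lebesgue_on[OF assms] by auto
qed

lemma pmass_add_le:
  fixes f g :: "real ^ 'n \<Rightarrow> real"
  assumes [measurable]: "f \<in> borel_measurable borel" "g \<in> borel_measurable borel" "S \<in> sets borel"
    and p: "0 < p" "p \<le> 1"
  shows "pmass p S (\<lambda>x. f x + g x) \<le> pmass p S f + pmass p S g"
proof -
  have "pmass p S (\<lambda>x. f x + g x)
      \<le> (\<integral>\<^sup>+x. ennreal (\<bar>f x\<bar> powr p) * indicator S x + ennreal (\<bar>g x\<bar> powr p) * indicator S x \<partial>lborel)"
    unfolding pmass_def
  proof (intro nn_integral_mono)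
    fix x
    have "\<bar>f x + g x\<bar> powr p \<le> (\<bar>f x\<bar> + \<bar>g x\<bar>) powr p"
      using p by (intro powr_mono2) auto
    also have "\<dots> \<le> \<bar>f x\<bar> powr p + \<bar>g x\<bar> powr p"
      using p by (intro powr_add_le) auto
    finally show "ennreal (\<bar>f x + g x\<bar> powr p) * indicator S x
      \<le> ennreal (\<bar>f x\<bar> powr p) * indicator S x + ennreal (\<bar>g x\<bar> powr p) * indicator S x"
      by (auto simp: indicator_def simp flip: ennreal_plus intro: ennreal_leI)
  qed
  also have "\<dots> = pmass p S f + pmass p S g"
    unfolding pmass_def by (subst nn_integral_add) auto
  finally show ?thesis .
qed

lemma pmass_cmult:
  fixes f :: "real ^ 'n \<Rightarrow> real"
  assumes [measurable]: "f \<in> borel_measurable borel" "S \<in> sets borel"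
  shows "pmass p S (\<lambda>x. c * f x) = ennreal (\<bar>c\<bar> powr p) * pmass p S f"
  unfolding pmass_def
  by (subst nn_integral_cmult[symmetric])
     (auto intro!: nn_integral_cong simp: abs_mult powr_mult ennreal_mult mult.assoc)

lemma pmass_mono_set: "S \<subseteq> T \<Longrightarrow> pmass p S f \<le> pmass p T f"
  unfolding pmass_def by (intro nn_integral_mono mult_left_mono) (auto simp: indicator_def)

lemma diffp_add_le:
  fixes f g :: "real ^ 'n \<Rightarrow> real"
  assumes "f \<in> borel_measurable borel" "g \<in> borel_measurable borel" "0 < p" "p \<le> 1"
  shows "diffp p (\<lambda>x. f x + g x) y \<le> diffp p f y + diffp p g y"
proof -
  have "diff_op y (\<lambda>x. f x + g x) = (\<lambda>x. diff_op y f x + diff_op y g x)"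
    by (simp add: diff_op_def fun_eq_iff)
  then show ?thesis
    unfolding diffp_def using assms by (simp add: pmass_add_le)
qed

lemma diffp_cmult:
  fixes f :: "real ^ 'n \<Rightarrow> real"
  assumes "f \<in> borel_measurable borel"
  shows "diffp p (\<lambda>x. c * f x) y = ennreal (\<bar>c\<bar> powr p) * diffp p f y"
proof -
  have "diff_op y (\<lambda>x. c * f x) = (\<lambda>x. c * diff_op y f x)"
    by (simp add: diff_op_def fun_eq_iff algebra_simps)
  then show ?thesis
    unfolding diffp_def using assms by (simp add: pmass_cmult)
qed

lemma diffp_le_pmass:
  fixes f :: "real ^ 'n \<Rightarrow> real"
  assumes [measurable]: "f \<in> borel_measurable borel" and p: "0 < p" "p \<le> 1"
  shows "diffp p f y \<le> 2 * pmass p ucube f"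
proof -
  have "diffp p f y \<le> pmass p (jcube y) (\<lambda>x. f (x + y)) + pmass p (jcube y) (\<lambda>x. - 1 * f x)"
    unfolding diffp_def
    using pmass_add_le[of "\<lambda>x. f (x + y)" "\<lambda>x. - 1 * f x" "jcube y" p] p
    by (simp add: diff_op_def[abs_def])
  also have "pmass p (jcube y) (\<lambda>x. - 1 * f x) = pmass p (jcube y) f"
    by (subst pmass_cmult) auto
  also have "\<dots> \<le> pmass p ucube f"
    by (intro pmass_mono_set) (auto simp: jcube_def)
  also have "pmass p (jcube y) (\<lambda>x. f (x + y))
      \<le> (\<integral>\<^sup>+x. ennreal (\<bar>f (x + y)\<bar> powr p) * indicator ucube (x + y) \<partial>lborel)"
    unfolding pmass_def by (intro nn_integral_mono) (auto simp: jcube_def indicator_def)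
  also have "\<dots> = pmass p ucube f"
    unfolding pmass_def
    by (subst nn_integral_lborel_shift[of "\<lambda>x. ennreal (\<bar>f x\<bar> powr p) * indicator ucube x"]) auto
  finally show ?thesis by (simp add: mult_2 add_mono)
qed

lemma modulus_range_nonempty: "0 < t \<Longrightarrow> {y :: real ^ 'n. 0 < norm y \<and> norm y \<le> t} \<noteq> {}"
proof -
  assume "0 < t"
  have "norm (t *\<^sub>R axis undefined 1 :: real ^ 'n) = t"
    using \<open>0 < t\<close> by simp
  then show ?thesis using \<open>0 < t\<close> by (metis (mono_tags, lifting) empty_iff mem_Collect_eq order_refl)
qed

text \<open>This and \<open>diffp_le_modulus\<close> say that the \<open>p\<close>-th power of the modulus is the least bound of
  \<^const>\<open>diffp\<close> over the shifts of norm at most \<open>t\<close>; the supremum itself is not manipulated later.\<close>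

lemma Lp_modulus_le:
  fixes f :: "real ^ 'n \<Rightarrow> real"
  assumes "f \<in> borel_measurable borel" "0 < t" "0 \<le> A" "0 < p"
    and "\<And>y. 0 < norm y \<Longrightarrow> norm y \<le> t \<Longrightarrow> diffp p f y \<le> ennreal A"
  shows "Lp_modulus p t f \<le> A powr (1 / p)"
  unfolding Lp_modulus_def
proof (rule cSUP_least)
  fix y :: "real ^ 'n" assume y: "y \<in> {y. 0 < norm y \<and> norm y \<le> t}"
  have "enn2real (diffp p f y) \<le> A"
    using assms(5)[of y] y assms(3) by (simp add: enn2real_leI)
  then show "Lp_norm p (shift_cube y) (diff_op y f) \<le> A powr (1 / p)"
    unfolding Lp_norm_shift_cube[OF assms(1)]
    using assms by (intro powr_mono2) auto
qed (use modulus_range_nonempty assms in blast)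

lemma modulus_bdd_above:
  fixes f :: "real ^ 'n \<Rightarrow> real"
  assumes "f \<in> borel_measurable borel" "pmass p ucube f < \<infinity>" "0 < p" "p \<le> 1"
  shows "bdd_above ((\<lambda>y. Lp_norm p (shift_cube y) (diff_op y f)) ` Y)"
proof (rule bdd_aboveI2)
  fix y :: "real ^ 'n"
  have "diffp p f y \<le> 2 * pmass p ucube f" using assms by (intro diffp_le_pmass)
  then have "enn2real (diffp p f y) \<le> enn2real (2 * pmass p ucube f)"
    using assms(2) by (intro enn2real_mono) (auto simp: ennreal_mult_less_top)
  then show "Lp_norm p (shift_cube y) (diff_op y f) \<le> enn2real (2 * pmass p ucube f) powr (1 / p)"
    unfolding Lp_norm_shift_cube[OF assms(1)]
    using assms by (intro powr_mono2) auto
qed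

lemma Lp_modulus_nonneg:
  fixes f :: "real ^ 'n \<Rightarrow> real"
  assumes "f \<in> borel_measurable borel" "pmass p ucube f < \<infinity>" "0 < p" "p \<le> 1" "0 < t"
  shows "0 \<le> Lp_modulus p t f"
proof -
  obtain y :: "real ^ 'n" where y: "y \<in> {y. 0 < norm y \<and> norm y \<le> t}"
    using modulus_range_nonempty[OF assms(5)] by blast
  have "0 \<le> Lp_norm p (shift_cube y) (diff_op y f)"
    by (simp add: Lp_norm_def)
  also have "\<dots> \<le> Lp_modulus p t f"
    unfolding Lp_modulus_def by (rule cSUP_upper[OF y modulus_bdd_above]) (use assms in auto)
  finally show ?thesis .
qed

lemma diffp_le_modulus:
  fixes f :: "real ^ 'n \<Rightarrow> real"
  assumes f: "f \<in> borel_measurable borel" "pmass p ucube f < \<infinity>" and p: "0 < p" "p \<le> 1"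
    and y: "norm y \<le> t" "0 < t"
  shows "diffp p f y \<le> ennreal (Lp_modulus p t f powr p)"
proof (cases "y = 0")
  case True
  then have "diffp p f y = 0" by (simp add: diffp_def pmass_def diff_op_def)
  then show ?thesis by simp
next
  case False
  have "diffp p f y \<le> 2 * pmass p ucube f" using assms by (intro diffp_le_pmass)
  also have "\<dots> < \<infinity>" using f by (auto simp: ennreal_mult_less_top)
  finally have fin: "diffp p f y < \<infinity>" .
  have "enn2real (diffp p f y) powr (1 / p) \<le> Lp_modulus p t f"
    unfolding Lp_modulus_def Lp_norm_shift_cube[OF f(1), symmetric]
    by (rule cSUP_upper[OF _ modulus_bdd_above]) (use False assms in auto)
  then have "(enn2real (diffp p f y) powr (1 / p)) powr p \<le> Lp_modulus p t f powr p"
    using p by (intro powr_mono2) auto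
  then have "enn2real (diffp p f y) \<le> Lp_modulus p t f powr p"
    using p by (simp add: powr_powr)
  then show ?thesis
    using fin by (metis ennreal_enn2real ennreal_leI infinity_ennreal_def)
qed

lemma Lp_modulus_mono:
  fixes f :: "real ^ 'n \<Rightarrow> real"
  assumes f: "f \<in> borel_measurable borel" "pmass p ucube f < \<infinity>" and p: "0 < p" "p \<le> 1"
    and t: "0 < t" "t \<le> u"
  shows "Lp_modulus p t f \<le> Lp_modulus p u f"
  unfolding Lp_modulus_def
  by (rule cSUP_subset_mono[OF modulus_range_nonempty[OF t(1)] modulus_bdd_above[OF f p]])
     (use t in auto)

section \<open>Invariance under changes on null sets\<close>

lemma AE_lebesgue_on_iff_negligible:
  fixes S :: "(real ^ 'n) set"
  assumes "S \<in> sets borel"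
  shows "(AE x in lebesgue_on S. P x) \<longleftrightarrow> negligible {x \<in> S. \<not> P x}"
proof -
  have S: "S \<inter> space lebesgue \<in> sets lebesgue" using assms by simp
  have "(AE x in lebesgue_on S. P x) \<longleftrightarrow> (AE x in lebesgue. x \<in> S \<longrightarrow> P x)"
    by (rule AE_restrict_space_iff[OF S])
  also have "\<dots> \<longleftrightarrow> {x. \<not> (x \<in> S \<longrightarrow> P x)} \<in> null_sets lebesgue"
    by (subst completion.AE_iff_null_sets) simp
  finally show ?thesis
    by (simp add: negligible_iff_null_sets)
qed

text \<open>Since Lebesgue measure is complete, a function that agrees almost everywhere with a Borel
  function is measurable. Together with \<open>borel_version\<close> this reduces everything to Borel functions,
  to which Tonelli's theorem for the product of two Borel measures applies.\<close>

lemma lebesgue_on_measurable_AE: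
  fixes f g :: "real ^ 'n \<Rightarrow> real"
  assumes g: "g \<in> borel_measurable borel" and S: "S \<in> sets borel"
    and eq: "AE x in lebesgue_on S. f x = g x"
  shows "f \<in> borel_measurable (lebesgue_on S)"
proof -
  let ?F = "\<lambda>x. if x \<in> S then f x else 0" and ?G = "\<lambda>x. if x \<in> S then g x else 0"
  have Gb: "?G \<in> borel_measurable borel" using g S by measurable
  have G: "?G \<in> borel_measurable lebesgue" 
    using borel_imp_lebesgue_on[OF Gb, of UNIV] by (simp add: lebesgue_on_UNIV_eq)
  have ae: "AE x in lebesgue. ?F x = ?G x"
    using eq S by (subst (asm) AE_restrict_space_iff) (auto elim!: eventually_mono)
  have "?F \<in> borel_measurable lebesgue"
  proof (rule measurableI)
    fix A :: "real set" assume "A \<in> sets borel"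
    then have 1: "?G -` A \<inter> space lebesgue \<in> sets lebesgue"
      using G by (rule measurable_sets[rotated])
    have 2: "AE x in lebesgue. x \<in> ?G -` A \<inter> space lebesgue \<longleftrightarrow> x \<in> ?F -` A \<inter> space lebesgue"
      using ae by eventually_elim simp
    show "?F -` A \<inter> space lebesgue \<in> sets lebesgue"
      by (rule completion.in_sets_AE[OF 2 1]) simp
  qed simp
  then show ?thesis using S by (subst (asm) borel_measurable_if) auto
qed

lemma borel_version:
  fixes f :: "real ^ 'n \<Rightarrow> real"
  assumes "f \<in> borel_measurable (lebesgue_on S)" and S: "S \<in> sets borel"
  obtains g where "g \<in> borel_measurable borel" "AE x in lebesgue_on S. f x = g x"
proof -
  let ?F = "\<lambda>x. if x \<in> S then f x else 0"
  have "?F \<in> borel_measurable lebesgue"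
    using assms by (subst borel_measurable_if) auto
  then obtain g where g: "g \<in> borel_measurable lborel" "AE x in lborel. ?F x = g x"
    using completion_ex_borel_measurable_real by blast
  have "AE x in lebesgue. ?F x = g x" using g(2) by (rule AE_completion)
  then have "AE x in lebesgue_on S. f x = g x"
    using S by (subst AE_restrict_space_iff) (auto elim!: eventually_mono)
  then show ?thesis using g(1) that by simp
qed

lemma Lp_norm_cong_AE:
  fixes f g :: "real ^ 'n \<Rightarrow> real"
  assumes g: "g \<in> borel_measurable borel" and S: "S \<in> sets borel"
    and eq: "AE x in lebesgue_on S. f x = g x"
  shows "Lp_norm p S f = Lp_norm p S g"
proof -
  have [measurable]: "f \<in> borel_measurable (lebesgue_on S)" "g \<in> borel_measurable (lebesgue_on S)"
    using lebesgue_on_measurable_AE[OF assms] borel_imp_lebesgue_on[OF g] by auto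
  have "(LINT x|lebesgue_on S. \<bar>f x\<bar> powr p) = (LINT x|lebesgue_on S. \<bar>g x\<bar> powr p)"
    using eq by (intro integral_cong_AE) (auto elim!: eventually_mono)
  then show ?thesis by (simp add: Lp_norm_def)
qed

text \<open>The exceptional set of \<open>diff_op y f\<close> is covered by the exceptional set of \<open>f\<close> and its translate
  by \<open>- y\<close>.\<close>

lemma diff_op_AE:
  fixes f g :: "real ^ 'n \<Rightarrow> real"
  assumes "AE x in lebesgue_on unit_cube. f x = g x"
  shows "AE x in lebesgue_on (shift_cube y). diff_op y f x = diff_op y g x"
proof -
  let ?N = "{x \<in> unit_cube. f x \<noteq> g x}"
  have N: "negligible ?N" using assms by (simp add: AE_lebesgue_on_iff_negligible)
  have "negligible (?N \<union> (+) (- y) ` ?N)"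
    using N negligible_translation[OF N, of "-y"] by (intro negligible_Un)
  moreover have "{x \<in> shift_cube y. diff_op y f x \<noteq> diff_op y g x} \<subseteq> ?N \<union> (+) (- y) ` ?N"
  proof
    fix x assume x: "x \<in> {x \<in> shift_cube y. diff_op y f x \<noteq> diff_op y g x}"
    then have "x \<in> ?N \<or> x + y \<in> ?N" by (auto simp: shift_cube_def diff_op_def)
    moreover have "x = - y + (x + y)" by simp
    ultimately show "x \<in> ?N \<union> (+) (- y) ` ?N" by blast
  qed
  ultimately have "negligible {x \<in> shift_cube y. diff_op y f x \<noteq> diff_op y g x}"
    by (rule negligible_subset)
  then show ?thesis by (subst AE_lebesgue_on_iff_negligible) auto
qed

lemma besov_cong_AE:
  fixes f g :: "real ^ 'n \<Rightarrow> real"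
  assumes g: "g \<in> borel_measurable borel"
    and eq: "AE x in lebesgue_on unit_cube. f x = g x"
  shows "f \<in> besov p q s \<longleftrightarrow> g \<in> besov p q s" "besov_norm p q s f = besov_norm p q s g"
proof -
  have meas: "f \<in> borel_measurable (lebesgue_on unit_cube)"
      "g \<in> borel_measurable (lebesgue_on unit_cube)"
    using lebesgue_on_measurable_AE[OF g _ eq] borel_imp_lebesgue_on[OF g] by auto
  note [measurable] = meas
  have "integrable (lebesgue_on unit_cube) (\<lambda>x. \<bar>f x\<bar> powr p) \<longleftrightarrow>
      integrable (lebesgue_on unit_cube) (\<lambda>x. \<bar>g x\<bar> powr p)"
    using eq by (intro integrable_cong_AE) (auto elim!: eventually_mono)
  then have Lp: "f \<in> Lp_space p unit_cube \<longleftrightarrow> g \<in> Lp_space p unit_cube"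
    using meas by (simp add: Lp_space_def)
  have "Lp_norm p (shift_cube y) (diff_op y f) = Lp_norm p (shift_cube y) (diff_op y g)" for y
    using g by (intro Lp_norm_cong_AE diff_op_AE eq) auto
  then have "Lp_modulus p t f = Lp_modulus p t g" for t
    by (simp add: Lp_modulus_def)
  then have "besov_integrand p q s f = besov_integrand p q s g"
    by (simp add: fun_eq_iff besov_integrand_def)
  then show "f \<in> besov p q s \<longleftrightarrow> g \<in> besov p q s" "besov_norm p q s f = besov_norm p q s g"
    using Lp Lp_norm_cong_AE[OF g unit_cube_borel eq] by (simp_all add: besov_def besov_norm_def)
qed

lemma besov_borel_version:
  fixes f :: "real ^ 'n \<Rightarrow> real"
  assumes "f \<in> besov p q s"
  obtains g where "g \<in> borel_measurable borel" "AE x in lebesgue_on unit_cube. f x = g x"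
    "g \<in> besov p q s" "besov_norm p q s g = besov_norm p q s f"
proof -
  have "f \<in> borel_measurable (lebesgue_on unit_cube)"
    using assms by (simp add: besov_def Lp_space_def)
  then obtain g where "g \<in> borel_measurable borel" "AE x in lebesgue_on unit_cube. f x = g x"
    using borel_version unit_cube_borel by blast
  with besov_cong_AE[of g f p q s] that assms show ?thesis by auto
qed

section \<open>Membership in the Besov space\<close>

text \<open>The \<open>p\<close>-th power of the modulus of smoothness, extended by 0 so that it is monotone, hence Borel,
  on the whole line.\<close>

definition modp :: "real \<Rightarrow> (real ^ 'n \<Rightarrow> real) \<Rightarrow> real \<Rightarrow> real" where
  "modp p f t = (if 0 < t then Lp_modulus p t f powr p else 0)"

text \<open>For \<open>H = modp p f\<close> this is the integral in the Besov quasi-norm. Allowing an arbitrary majorant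
  \<open>H\<close> of the \<open>p\<close>-th power of the modulus turns norm estimates into explicit one-dimensional integrals.\<close>

definition besov_int :: "real \<Rightarrow> real \<Rightarrow> real \<Rightarrow> (real \<Rightarrow> real) \<Rightarrow> ennreal" where
  "besov_int p q s H =
    (\<integral>\<^sup>+t. ennreal (t powr (- s * q - 1) * H t powr (q / p)) * indicator {0<..1} t \<partial>lborel)"

lemma besov_int_mono:
  assumes "0 < p" "0 < q"
    and "\<And>t. 0 < t \<Longrightarrow> t \<le> 1 \<Longrightarrow> 0 \<le> H t \<and> H t \<le> K t"
  shows "besov_int p q s H \<le> besov_int p q s K"
  unfolding besov_int_def
proof (intro nn_integral_mono)
  fix t :: real
  show "ennreal (t powr (- s * q - 1) * H t powr (q / p)) * indicator {0<..1} t
      \<le> ennreal (t powr (- s * q - 1) * K t powr (q / p)) * indicator {0<..1} t"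
    using assms(1,2) assms(3)[of t]
    by (auto simp: indicator_def intro!: ennreal_leI mult_left_mono powr_mono2)
qed

lemma besov_int_add_le:
  assumes [measurable]: "H \<in> borel_measurable borel" "K \<in> borel_measurable borel"
    and pq: "0 < p" "0 < q" and nn: "\<And>t. 0 \<le> H t" "\<And>t. 0 \<le> K t"
  shows "besov_int p q s (\<lambda>t. H t + K t)
    \<le> ennreal (2 powr (q / p)) * (besov_int p q s H + besov_int p q s K)"
proof -
  let ?w = "\<lambda>t::real. t powr (- s * q - 1)"
  have "besov_int p q s (\<lambda>t. H t + K t) \<le>
      (\<integral>\<^sup>+t. ennreal (2 powr (q / p)) * (ennreal (?w t * H t powr (q / p)) * indicator {0<..1} t +
        ennreal (?w t * K t powr (q / p)) * indicator {0<..1} t) \<partial>lborel)"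
    unfolding besov_int_def
  proof (intro nn_integral_mono)
    fix t :: real
    have "(H t + K t) powr (q / p) \<le> 2 powr (q / p) * (H t powr (q / p) + K t powr (q / p))"
      using pq nn by (intro powr_add_le_two) auto
    then have "?w t * (H t + K t) powr (q / p) \<le>
        ?w t * (2 powr (q / p) * (H t powr (q / p) + K t powr (q / p)))"
      by (intro mult_left_mono) auto
    then show "ennreal (?w t * (H t + K t) powr (q / p)) * indicator {0<..1} t
      \<le> ennreal (2 powr (q / p)) * (ennreal (?w t * H t powr (q / p)) * indicator {0<..1} t +
        ennreal (?w t * K t powr (q / p)) * indicator {0<..1} t)"
      by (auto simp: indicator_def algebra_simps simp flip: ennreal_plus ennreal_mult intro!: ennreal_leI)
  qed
  also have "\<dots> = ennreal (2 powr (q / p)) * (besov_int p q s H + besov_int p q s K)"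
    unfolding besov_int_def by (subst nn_integral_cmult, simp, subst nn_integral_add) auto
  finally show ?thesis .
qed

lemma besov_int_cmult:
  assumes [measurable]: "H \<in> borel_measurable borel"
    and c: "0 \<le> c" and nn: "\<And>t. 0 \<le> H t"
  shows "besov_int p q s (\<lambda>t. c * H t) = ennreal (c powr (q / p)) * besov_int p q s H"
  unfolding besov_int_def
  by (subst nn_integral_cmult[symmetric])
     (auto intro!: nn_integral_cong simp: indicator_def powr_mult c nn mult_ac simp flip: ennreal_mult)

context
  fixes p q s :: real
  assumes p: "0 < p" "p \<le> 1" and q: "0 < q"
begin

lemma modp_nonneg: "0 \<le> modp p f t"
  by (simp add: modp_def)

lemma modp_mono:
  fixes f :: "real ^ 'n \<Rightarrow> real"
  assumes f: "f \<in> borel_measurable borel" "pmass p ucube f < \<infinity>"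
  shows "mono (modp p f)"
proof (rule monoI)
  fix t u :: real assume tu: "t \<le> u"
  show "modp p f t \<le> modp p f u"
    unfolding modp_def using Lp_modulus_mono[OF f p, of t u] Lp_modulus_nonneg[OF f p, of t] tu p
    by (auto intro!: powr_mono2)
qed

lemma modp_borel [measurable]:
  fixes f :: "real ^ 'n \<Rightarrow> real"
  assumes f: "f \<in> borel_measurable borel" "pmass p ucube f < \<infinity>"
  shows "modp p f \<in> borel_measurable borel"
  by (rule borel_measurable_mono[OF modp_mono[OF f]])

lemma diffp_le_modp:
  fixes f :: "real ^ 'n \<Rightarrow> real"
  assumes f: "f \<in> borel_measurable borel" "pmass p ucube f < \<infinity>"
    and "norm y \<le> t" "0 < t"
  shows "diffp p f y \<le> ennreal (modp p f t)"
  using diffp_le_modulus[OF f p, of y t] assms by (simp add: modp_def)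

lemma modp_le:
  fixes f :: "real ^ 'n \<Rightarrow> real"
  assumes f: "f \<in> borel_measurable borel" and A: "0 \<le> A"
    and "\<And>y. 0 < norm y \<Longrightarrow> norm y \<le> t \<Longrightarrow> diffp p f y \<le> ennreal A"
    and fin: "pmass p ucube f < \<infinity>"
  shows "modp p f t \<le> A"
proof (cases "0 < t")
  case True
  have "Lp_modulus p t f \<le> A powr (1 / p)"
    using Lp_modulus_le[OF f True A p(1)] assms(3) by blast
  then have "Lp_modulus p t f powr p \<le> (A powr (1 / p)) powr p"
    using Lp_modulus_nonneg[OF f fin p True] p by (intro powr_mono2) auto
  then show ?thesis using True A p by (simp add: modp_def powr_powr)
qed (use A in \<open>simp add: modp_def\<close>)

lemma modp_le_pmass:
  fixes f :: "real ^ 'n \<Rightarrow> real"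
  assumes f: "f \<in> borel_measurable borel" and fin: "pmass p ucube f < \<infinity>"
  shows "modp p f t \<le> 2 * enn2real (pmass p ucube f)"
proof (rule modp_le[OF f _ _ fin])
  fix y
  have "diffp p f y \<le> 2 * pmass p ucube f" by (rule diffp_le_pmass[OF f p])
  then show "diffp p f y \<le> ennreal (2 * enn2real (pmass p ucube f))"
    using fin by (simp add: ennreal_mult' ennreal_enn2real)
qed simp

lemma besov_integrand_eq:
  fixes f :: "real ^ 'n \<Rightarrow> real"
  assumes f: "f \<in> borel_measurable borel" "pmass p ucube f < \<infinity>" and t: "0 < t"
  shows "besov_integrand p q s f t = t powr (- s * q - 1) * modp p f t powr (q / p)"
proof -
  have "besov_integrand p q s f t = (t powr (- s)) powr q * Lp_modulus p t f powr q / t"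
    unfolding besov_integrand_def using Lp_modulus_nonneg[OF f p t] t by (simp add: powr_mult)
  also have "\<dots> = t powr (- s * q) / t powr 1 * Lp_modulus p t f powr q"
    using t by (simp add: powr_powr)
  also have "\<dots> = t powr (- s * q - 1) * (Lp_modulus p t f powr p) powr (q / p)"
    using p by (simp add: powr_powr powr_diff)
  finally show ?thesis using t by (simp add: modp_def)
qed

lemma besov_set_integral:
  fixes f :: "real ^ 'n \<Rightarrow> real"
  assumes f: "f \<in> borel_measurable borel" "pmass p ucube f < \<infinity>"
  shows "set_integrable lborel {0<..1} (besov_integrand p q s f) \<longleftrightarrow> besov_int p q s (modp p f) < \<infinity>"
    and "(LBINT t:{0<..1}. besov_integrand p q s f t) = enn2real (besov_int p q s (modp p f))"
proof -
  note [measurable] = modp_borel[OF f]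
  let ?h = "\<lambda>t. indicator {0<..1} t * (t powr (- s * q - 1) * modp p f t powr (q / p))"
  have eq: "(\<lambda>t. indicator {0<..1} t *\<^sub>R besov_integrand p q s f t) = ?h"
    using besov_integrand_eq[OF f] by (auto simp: fun_eq_iff indicator_def)
  have int: "(\<integral>\<^sup>+t. ennreal (?h t) \<partial>lborel) = besov_int p q s (modp p f)"
    unfolding besov_int_def by (intro nn_integral_cong) (auto simp: indicator_def)
  have h: "?h \<in> borel_measurable lborel" by measurable
  have nn: "0 \<le> ?h t" for t by (simp add: indicator_def)
  show "set_integrable lborel {0<..1} (besov_integrand p q s f) \<longleftrightarrow> besov_int p q s (modp p f) < \<infinity>"
    unfolding set_integrable_def eq using h
    unfolding integrable_iff_bounded real_norm_def abs_of_nonneg[OF nn] int by simp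
  show "(LBINT t:{0<..1}. besov_integrand p q s f t) = enn2real (besov_int p q s (modp p f))"
    unfolding set_lebesgue_integral_def eq using integral_eq_nn_integral[OF h] nn int by simp
qed

lemma besov_iff:
  fixes f :: "real ^ 'n \<Rightarrow> real"
  assumes f: "f \<in> borel_measurable borel"
  shows "f \<in> besov p q s \<longleftrightarrow> pmass p ucube f < \<infinity> \<and> besov_int p q s (modp p f) < \<infinity>"
  unfolding besov_def using Lp_space_iff[OF f] besov_set_integral(1)[OF f] by auto

lemma besov_norm_eq:
  fixes f :: "real ^ 'n \<Rightarrow> real"
  assumes f: "f \<in> borel_measurable borel" "f \<in> besov p q s"
  shows "besov_norm p q s f =
    (enn2real (pmass p ucube f) powr (q / p) + enn2real (besov_int p q s (modp p f))) powr (1 / q)"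
  unfolding besov_norm_def Lp_norm_unit_cube[OF f(1)]
  using besov_set_integral(2)[OF f(1)] f besov_iff[OF f(1)] by (simp add: powr_powr)

lemma besov_norm_bounds:
  fixes f :: "real ^ 'n \<Rightarrow> real"
  assumes f: "f \<in> borel_measurable borel" "f \<in> besov p q s"
  shows "0 \<le> besov_norm p q s f"
    and "pmass p ucube f \<le> ennreal (besov_norm p q s f powr p)"
    and "besov_int p q s (modp p f) \<le> ennreal (besov_norm p q s f powr q)"
proof -
  let ?a = "enn2real (pmass p ucube f)" and ?b = "enn2real (besov_int p q s (modp p f))"
  note N = besov_norm_eq[OF f]
  have fin: "pmass p ucube f < \<infinity>" "besov_int p q s (modp p f) < \<infinity>"
    using f besov_iff[OF f(1)] by auto
  show "0 \<le> besov_norm p q s f" by (simp add: N)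
  have Nq: "besov_norm p q s f powr q = ?a powr (q / p) + ?b"
    unfolding N using q by (simp add: powr_powr)
  have "(?a powr (q / p)) powr (p / q) \<le> (besov_norm p q s f powr q) powr (p / q)"
    unfolding Nq using p q by (intro powr_mono2) auto
  then have "?a \<le> besov_norm p q s f powr p" using p q by (simp add: powr_powr)
  then show "pmass p ucube f \<le> ennreal (besov_norm p q s f powr p)"
    using fin(1) by (metis ennreal_enn2real ennreal_leI infinity_ennreal_def)
  have "?b \<le> besov_norm p q s f powr q" by (simp add: Nq)
  then show "besov_int p q s (modp p f) \<le> ennreal (besov_norm p q s f powr q)"
    using fin(2) by (metis ennreal_enn2real ennreal_leI infinity_ennreal_def)
qed

text \<open>The criterion by which all Besov norms below are estimated: it suffices to bound the \<open>p\<close>-th power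
  of the differences by a function \<open>H\<close> of the size of the shift.\<close>

lemma besov_intro:
  fixes f :: "real ^ 'n \<Rightarrow> real"
  assumes f: "f \<in> borel_measurable borel" and A: "0 \<le> A" "pmass p ucube f \<le> ennreal A"
    and H: "\<And>t. 0 < t \<Longrightarrow> t \<le> 1 \<Longrightarrow> 0 \<le> H t"
      "\<And>t y. 0 < t \<Longrightarrow> t \<le> 1 \<Longrightarrow> 0 < norm y \<Longrightarrow> norm y \<le> t \<Longrightarrow> diffp p f y \<le> ennreal (H t)"
    and B: "0 \<le> B" "besov_int p q s H \<le> ennreal B"
  shows "f \<in> besov p q s" "besov_norm p q s f \<le> (A powr (q / p) + B) powr (1 / q)"
proof -
  have fin: "pmass p ucube f < \<infinity>" using A by (metis ennreal_less_top infinity_ennreal_def le_less_trans)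
  have "modp p f t \<le> H t" if "0 < t" "t \<le> 1" for t
    by (rule modp_le[OF f _ _ fin]) (use that H in auto)
  then have "besov_int p q s (modp p f) \<le> besov_int p q s H"
    using p q by (intro besov_int_mono) (auto simp: modp_nonneg)
  then have le: "besov_int p q s (modp p f) \<le> ennreal B" using B by simp
  then have fin2: "besov_int p q s (modp p f) < \<infinity>"
    by (metis ennreal_less_top infinity_ennreal_def le_less_trans)
  then show "f \<in> besov p q s" using fin besov_iff[OF f] by simp
  then have "besov_norm p q s f =
    (enn2real (pmass p ucube f) powr (q / p) + enn2real (besov_int p q s (modp p f))) powr (1 / q)"
    using f by (intro besov_norm_eq)
  also have "\<dots> \<le> (A powr (q / p) + B) powr (1 / q)"
    using p q A B le by (intro powr_mono2 add_mono) (auto intro!: enn2real_leI)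
  finally show "besov_norm p q s f \<le> (A powr (q / p) + B) powr (1 / q)" .
qed

text \<open>The sum of the two moduli majorizes the modulus of the sum, and \<open>besov_int\<close> at a sum is at most a
  constant times the sum of its values.\<close>

lemma besov_add_borel:
  fixes f g :: "real ^ 'n \<Rightarrow> real"
  assumes [measurable]: "f \<in> borel_measurable borel" "g \<in> borel_measurable borel"
    and fg: "f \<in> besov p q s" "g \<in> besov p q s"
  shows "(\<lambda>x. f x + g x) \<in> besov p q s"
proof -
  have fin: "pmass p ucube f < \<infinity>" "besov_int p q s (modp p f) < \<infinity>"
      "pmass p ucube g < \<infinity>" "besov_int p q s (modp p g) < \<infinity>"
    using fg besov_iff[OF assms(1)] besov_iff[OF assms(2)] by auto
  let ?B = "ennreal (2 powr (q / p)) * (besov_int p q s (modp p f) + besov_int p q s (modp p g))"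
  have B: "?B < \<infinity>" using fin by (simp add: ennreal_mult_less_top)
  have A: "pmass p ucube f + pmass p ucube g < \<infinity>" using fin by simp
  show ?thesis
  proof (rule besov_intro(1))
    show "pmass p ucube (\<lambda>x. f x + g x) \<le> ennreal (enn2real (pmass p ucube f + pmass p ucube g))"
      using A p by (subst ennreal_enn2real) (auto intro!: pmass_add_le)
    show "besov_int p q s (\<lambda>t. modp p f t + modp p g t) \<le> ennreal (enn2real ?B)"
      using besov_int_add_le[of "modp p f" "modp p g" p q s] B fin p q
      by (simp add: modp_borel modp_nonneg)
    fix t :: real and y :: "real ^ 'n" assume t: "0 < t" "t \<le> 1" "norm y \<le> t"
    have "diffp p (\<lambda>x. f x + g x) y \<le> diffp p f y + diffp p g y"
      using p by (intro diffp_add_le) auto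
    also have "\<dots> \<le> ennreal (modp p f t) + ennreal (modp p g t)"
      using t fin by (intro add_mono diffp_le_modp) auto
    finally show "diffp p (\<lambda>x. f x + g x) y \<le> ennreal (modp p f t + modp p g t)"
      by (simp add: modp_nonneg)
  qed (auto simp: modp_nonneg)
qed

lemma besov_cmult_borel:
  fixes f :: "real ^ 'n \<Rightarrow> real"
  assumes f[measurable]: "f \<in> borel_measurable borel"
    and fb: "f \<in> besov p q s"
  shows "(\<lambda>x. c * f x) \<in> besov p q s"
proof -
  have fin: "pmass p ucube f < \<infinity>" "besov_int p q s (modp p f) < \<infinity>"
    using fb besov_iff[OF f] by auto
  let ?c = "\<bar>c\<bar> powr p"
  have A: "ennreal ?c * pmass p ucube f < \<infinity>" 
    "ennreal (?c powr (q / p)) * besov_int p q s (modp p f) < \<infinity>"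
    using fin by (simp_all add: ennreal_mult_less_top)
  show ?thesis
  proof (rule besov_intro(1))
    show "pmass p ucube (\<lambda>x. c * f x) \<le> ennreal (enn2real (ennreal ?c * pmass p ucube f))"
      using A by (subst ennreal_enn2real) (auto simp: pmass_cmult)
    show "besov_int p q s (\<lambda>t. ?c * modp p f t)
        \<le> ennreal (enn2real (ennreal (?c powr (q / p)) * besov_int p q s (modp p f)))"
      using A fin by (subst ennreal_enn2real) (auto simp: besov_int_cmult modp_borel modp_nonneg)
    fix t :: real and y :: "real ^ 'n" assume t: "0 < t" "t \<le> 1" "norm y \<le> t"
    have "diffp p (\<lambda>x. c * f x) y = ennreal ?c * diffp p f y"
      by (intro diffp_cmult) auto
    also have "\<dots> \<le> ennreal ?c * ennreal (modp p f t)"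
      using t fin by (intro mult_left_mono diffp_le_modp) auto
    finally show "diffp p (\<lambda>x. c * f x) y \<le> ennreal (?c * modp p f t)"
      by (simp add: modp_nonneg ennreal_mult)
  qed (auto simp: modp_nonneg)
qed

lemma besov_add:
  fixes f g :: "real ^ 'n \<Rightarrow> real"
  assumes "f \<in> besov p q s" "g \<in> besov p q s"
  shows "(\<lambda>x. f x + g x) \<in> besov p q s"
proof -
  obtain f' where f': "f' \<in> borel_measurable borel" "AE x in lebesgue_on unit_cube. f x = f' x"
    "f' \<in> besov p q s" using besov_borel_version[OF assms(1)] by metis
  obtain g' where g': "g' \<in> borel_measurable borel" "AE x in lebesgue_on unit_cube. g x = g' x"
    "g' \<in> besov p q s" using besov_borel_version[OF assms(2)] by metis
  have "(\<lambda>x. f' x + g' x) \<in> besov p q s" by (intro besov_add_borel f' g')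
  moreover have "AE x in lebesgue_on unit_cube. f x + g x = f' x + g' x"
    using f'(2) g'(2) by eventually_elim simp
  ultimately show ?thesis
    using besov_cong_AE(1)[of "\<lambda>x. f' x + g' x" "\<lambda>x. f x + g x"] f'(1) g'(1) by simp
qed

lemma besov_cmult:
  fixes f :: "real ^ 'n \<Rightarrow> real"
  assumes "f \<in> besov p q s"
  shows "(\<lambda>x. c * f x) \<in> besov p q s"
proof -
  obtain f' where f': "f' \<in> borel_measurable borel" "AE x in lebesgue_on unit_cube. f x = f' x"
    "f' \<in> besov p q s" using besov_borel_version[OF assms(1)] by metis
  have "(\<lambda>x. c * f' x) \<in> besov p q s" by (intro besov_cmult_borel f')
  moreover have "AE x in lebesgue_on unit_cube. c * f x = c * f' x"
    using f'(2) by eventually_elim simp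
  ultimately show ?thesis
    using besov_cong_AE(1)[of "\<lambda>x. c * f' x" "\<lambda>x. c * f x"] f'(1) by simp
qed

end

section \<open>Smoothness of indicators of cubes\<close>

text \<open>The points of the cube that a shift by \<open>y\<close> pushes out in direction \<open>i\<close> lie in a slab of width
  \<open>\<bar>y $ i\<bar>\<close> along one of the two faces orthogonal to that direction.\<close>

lemma emeasure_edge_component:
  fixes c y :: "real ^ 'n"
  assumes r: "0 < r"
  shows "emeasure lborel {x \<in> hcube c r. \<not> (c $ i \<le> (x + y) $ i \<and> (x + y) $ i < c $ i + r)}
    \<le> ennreal (\<bar>y $ i\<bar> * r ^ (CARD('n) - 1))"
proof -
  define a where "a = (if 0 \<le> y $ i then c $ i + r - y $ i else c $ i)"
  define b where "b = (if 0 \<le> y $ i then c $ i + r else c $ i - y $ i)"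
  define B where "B = cbox (\<chi> j. if j = i then a else c $ j) (\<chi> j. if j = i then b else c $ j + r)"
  have ab: "b - a = \<bar>y $ i\<bar>" by (simp add: a_def b_def)
  have "{x \<in> hcube c r. \<not> (c $ i \<le> (x + y) $ i \<and> (x + y) $ i < c $ i + r)} \<subseteq> B"
  proof
    fix x assume x: "x \<in> {x \<in> hcube c r. \<not> (c $ i \<le> (x + y) $ i \<and> (x + y) $ i < c $ i + r)}"
    then have h: "c $ j \<le> x $ j" "x $ j < c $ j + r" for j by (auto simp: hcube_def)
    from x h[of i] have "a \<le> x $ i \<and> x $ i \<le> b" by (auto simp: a_def b_def)
    with h show "x \<in> B" by (auto simp: B_def mem_box_cart less_imp_le)
  qed
  then have "emeasure lborel {x \<in> hcube c r. \<not> (c $ i \<le> (x + y) $ i \<and> (x + y) $ i < c $ i + r)}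
      \<le> emeasure lborel B"
    by (rule emeasure_mono) (unfold B_def sets_lborel, rule borel_closed, rule closed_cbox)
  also have "\<dots> = ennreal (\<Prod>j\<in>UNIV. (if j = i then \<bar>y $ i\<bar> else r))"
    unfolding B_def
  proof (subst emeasure_lborel_cbox_cart)
    show "(\<chi> j. if j = i then a else c $ j) $ k \<le> (\<chi> j. if j = i then b else c $ j + r) $ k" for k
      using ab r by auto
  qed (auto intro!: arg_cong[where f = ennreal] prod.cong simp: ab)
  also have "(\<Prod>j\<in>UNIV. (if j = i then \<bar>y $ i\<bar> else r)) = \<bar>y $ i\<bar> * (\<Prod>j\<in>UNIV - {i}. r)"
    by (subst prod.remove[of _ i]) auto
  also have "\<dots> = \<bar>y $ i\<bar> * r ^ (CARD('n) - 1)"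
    by (simp add: card_Diff_singleton)
  finally show ?thesis .
qed

text \<open>This one measure estimate serves twice: it bounds the modulus of smoothness of the indicator of a
  cube, and the set where a shift changes the grid cell of a point.\<close>

lemma emeasure_hcube_exit:
  fixes c y :: "real ^ 'n"
  assumes r: "0 < r"
  shows "emeasure lborel {x \<in> hcube c r. x + y \<notin> hcube c r}
    \<le> ennreal (real CARD('n) * r ^ CARD('n) * (norm y / r))"
proof -
  let ?S = "\<lambda>i. {x \<in> hcube c r. \<not> (c $ i \<le> (x + y) $ i \<and> (x + y) $ i < c $ i + r)}"
  have S: "range ?S \<subseteq> sets lborel"
    by (auto, measurable)
  have "{x \<in> hcube c r. x + y \<notin> hcube c r} = (\<Union>i\<in>UNIV. ?S i)"
    by (auto simp: hcube_def)
  then have "emeasure lborel {x \<in> hcube c r. x + y \<notin> hcube c r} \<le> (\<Sum>i\<in>UNIV. emeasure lborel (?S i))"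
    using emeasure_subadditive_finite[OF _ S] by (simp only: finite_UNIV finite)
  also have "\<dots> \<le> (\<Sum>i\<in>(UNIV :: 'n set). ennreal (norm y * r ^ (CARD('n) - 1)))"
  proof (rule sum_mono)
    fix i
    have "emeasure lborel (?S i) \<le> ennreal (\<bar>y $ i\<bar> * r ^ (CARD('n) - 1))"
      by (rule emeasure_edge_component[OF r])
    also have "\<dots> \<le> ennreal (norm y * r ^ (CARD('n) - 1))"
      using r component_le_norm_cart[of y i] by (intro ennreal_leI mult_right_mono) auto
    finally show "emeasure lborel (?S i) \<le> ennreal (norm y * r ^ (CARD('n) - 1))" .
  qed
  also have "\<dots> = ennreal (real CARD('n) * (norm y * r ^ (CARD('n) - 1)))"
    using r by (simp add: ennreal_mult ennreal_of_nat_eq_real_of_nat)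
  also have "real CARD('n) * (norm y * r ^ (CARD('n) - 1)) = real CARD('n) * r ^ CARD('n) * (norm y / r)"
    using r power_minus_mult[of "CARD('n)" r] by (simp add: field_simps)
  finally show ?thesis .
qed

lemma diffp_hcube_le:
  fixes c y :: "real ^ 'n"
  assumes r: "0 < r" and p: "0 < p"
  shows "diffp p (indicat_real (hcube c r)) y
    \<le> ennreal (2 * real CARD('n) * r ^ CARD('n) * min 1 (norm y / r))"
proof -
  let ?Q = "hcube c r"
  let ?m = "real CARD('n) * r ^ CARD('n) * min 1 (norm y / r)"
  have d: "1 \<le> real CARD('n)" by (simp add: Suc_leI)
  have exit: "emeasure lborel {x \<in> ?Q. x + z \<notin> ?Q} \<le> ennreal ?m" if z: "norm z = norm y" for z
  proof -
    have "emeasure lborel {x \<in> ?Q. x + z \<notin> ?Q} \<le> emeasure lborel ?Q"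
      by (intro emeasure_mono) auto
    also have "\<dots> = ennreal (1 * r ^ CARD('n))" using r by (simp add: emeasure_hcube)
    also have "\<dots> \<le> ennreal (real CARD('n) * r ^ CARD('n))"
      using r d by (intro ennreal_leI mult_right_mono) auto
    finally show ?thesis
      using emeasure_hcube_exit[OF r, of c z] z by (auto simp: min_def)
  qed
  have [measurable]: "{x \<in> ?Q. x + y \<notin> ?Q} \<in> sets borel" "{x. x \<notin> ?Q \<and> x + y \<in> ?Q} \<in> sets borel"
    "{x \<in> ?Q. x + - y \<notin> ?Q} \<in> sets borel"
    by measurable
  have "diffp p (indicat_real ?Q) y \<le>
      (\<integral>\<^sup>+x. indicator {x \<in> ?Q. x + y \<notin> ?Q} x + indicator {x. x \<notin> ?Q \<and> x + y \<in> ?Q} x \<partial>lborel)"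
    unfolding diffp_def pmass_def diff_op_def
    by (intro nn_integral_mono) (auto simp: indicator_def)
  also have "\<dots> = emeasure lborel {x \<in> ?Q. x + y \<notin> ?Q} + emeasure lborel {x. x \<notin> ?Q \<and> x + y \<in> ?Q}"
    by (subst nn_integral_add) auto
  \<comment> \<open>the points that enter the cube are translates of those that leave it under the opposite shift\<close>
  also have "{x. x \<notin> ?Q \<and> x + y \<in> ?Q} = {x. x + y \<in> {x \<in> ?Q. x + - y \<notin> ?Q}}"
    by auto
  also have "emeasure lborel \<dots> = emeasure lborel {x \<in> ?Q. x + - y \<notin> ?Q}"
    by (rule emeasure_lborel_shift) measurable
  also have "emeasure lborel {x \<in> ?Q. x + y \<notin> ?Q} + emeasure lborel {x \<in> ?Q. x + - y \<notin> ?Q}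
      \<le> ennreal ?m + ennreal ?m"
    by (intro add_mono exit) auto
  also have "\<dots> = ennreal (2 * real CARD('n) * r ^ CARD('n) * min 1 (norm y / r))"
    using r by (simp flip: ennreal_plus)
  finally show ?thesis .
qed

lemma pmass_hcube_le:
  fixes c :: "real ^ 'n"
  assumes "0 \<le> r"
  shows "pmass p S (indicat_real (hcube c r)) \<le> ennreal (r ^ CARD('n))"
proof -
  have "pmass p S (indicat_real (hcube c r)) \<le> (\<integral>\<^sup>+x. indicator (hcube c r) x \<partial>lborel)"
    unfolding pmass_def by (intro nn_integral_mono) (auto simp: indicator_def)
  then show ?thesis using assms by (simp add: emeasure_hcube)
qed

lemma pmass_sum_le:
  fixes f :: "'k \<Rightarrow> real ^ 'n \<Rightarrow> real"
  assumes "finite A" "\<And>k. k \<in> A \<Longrightarrow> f k \<in> borel_measurable borel" "S \<in> sets borel" "0 < p" "p \<le> 1"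
  shows "pmass p S (\<lambda>x. \<Sum>k\<in>A. f k x) \<le> (\<Sum>k\<in>A. pmass p S (f k))"
  using assms(1,2)
proof (induction A rule: finite_induct)
  case empty
  then show ?case by (simp add: pmass_def)
next
  case (insert a A)
  have "pmass p S (\<lambda>x. \<Sum>k\<in>insert a A. f k x) = pmass p S (\<lambda>x. f a x + (\<Sum>k\<in>A. f k x))"
    using insert by simp
  also have "\<dots> \<le> pmass p S (f a) + pmass p S (\<lambda>x. \<Sum>k\<in>A. f k x)"
    using insert assms by (intro pmass_add_le borel_measurable_sum) auto
  also have "\<dots> \<le> pmass p S (f a) + (\<Sum>k\<in>A. pmass p S (f k))"
    using insert by (intro add_left_mono) auto
  finally show ?case using insert by simp
qed

lemma diffp_sum_le:
  fixes f :: "'k \<Rightarrow> real ^ 'n \<Rightarrow> real"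
  assumes "finite A" "\<And>k. k \<in> A \<Longrightarrow> f k \<in> borel_measurable borel" "0 < p" "p \<le> 1"
  shows "diffp p (\<lambda>x. \<Sum>k\<in>A. f k x) y \<le> (\<Sum>k\<in>A. diffp p (f k) y)"
proof -
  have "diff_op y (\<lambda>x. \<Sum>k\<in>A. f k x) = (\<lambda>x. \<Sum>k\<in>A. diff_op y (f k) x)"
    by (simp add: diff_op_def fun_eq_iff sum_subtractf)
  then show ?thesis
    unfolding diffp_def using assms by (simp add: pmass_sum_le)
qed

lemma nn_integral_powr_0:
  fixes c e :: real
  assumes "0 \<le> c" "0 < e"
  shows "(\<integral>\<^sup>+t. ennreal (t powr (e - 1)) * indicator {0<..c} t \<partial>lborel) = ennreal (c powr e / e)"
proof -
  have "((\<lambda>t. t powr (e - 1)) has_integral (c powr e / e)) {0..c}"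
    using has_integral_powr_from_0[of "e - 1" c] assms by simp
  then have *: "((\<lambda>t. if t \<in> {0..c} then t powr (e - 1) else 0) has_integral (c powr e / e)) UNIV"
    by (subst has_integral_restrict_UNIV)
  have "(\<integral>\<^sup>+t. ennreal (t powr (e - 1)) * indicator {0<..c} t \<partial>lborel)
      = (\<integral>\<^sup>+t. ennreal (if t \<in> {0..c} then t powr (e - 1) else 0) \<partial>lborel)"
    by (intro nn_integral_cong) (auto simp: indicator_def)
  also have "\<dots> = ennreal (c powr e / e)"
    by (rule nn_integral_has_integral_lborel[OF _ _ *]) auto
  finally show ?thesis .
qed

lemma nn_integral_powr_inf:
  fixes c e :: real
  assumes "0 < c" "0 < e"
  shows "(\<integral>\<^sup>+t. ennreal (t powr (- e - 1)) * indicator {c..} t \<partial>lborel) = ennreal (c powr (- e) / e)"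
proof -
  have "((\<lambda>t. t powr (- e - 1)) has_integral (c powr (- e) / e)) {c..}"
    using has_integral_powr_to_inf[of "- e - 1" c] assms by simp
  then have *: "((\<lambda>t. if t \<in> {c..} then t powr (- e - 1) else 0) has_integral (c powr (- e) / e)) UNIV"
    by (subst has_integral_restrict_UNIV)
  have "(\<integral>\<^sup>+t. ennreal (t powr (- e - 1)) * indicator {c..} t \<partial>lborel)
      = (\<integral>\<^sup>+t. ennreal (if t \<in> {c..} then t powr (- e - 1) else 0) \<partial>lborel)"
    by (intro nn_integral_cong) (auto simp: indicator_def)
  also have "\<dots> = ennreal (c powr (- e) / e)"
    by (rule nn_integral_has_integral_lborel[OF _ _ *]) auto
  finally show ?thesis .
qed

lemma besov_int_powr:
  assumes pq: "0 < p" "0 < q" and A: "0 \<le> A" and \<theta>: "s * p < \<theta>"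
  shows "besov_int p q s (\<lambda>t. A * t powr \<theta>) = ennreal (A powr (q / p) / (q * (\<theta> / p - s)))"
proof -
  define e where "e = q * (\<theta> / p - s)"
  have e: "0 < e" using pq \<theta> by (simp add: e_def field_simps)
  have "besov_int p q s (\<lambda>t. A * t powr \<theta>)
      = (\<integral>\<^sup>+t. ennreal (A powr (q / p)) * (ennreal (t powr (e - 1)) * indicator {0<..1} t) \<partial>lborel)"
    unfolding besov_int_def
  proof (intro nn_integral_cong)
    fix t :: real
    have "t powr (- s * q - 1) * (A * t powr \<theta>) powr (q / p) = A powr (q / p) * t powr (e - 1)" if "0 < t"
    proof -
      have "t powr (- s * q - 1) * (A * t powr \<theta>) powr (q / p)
          = A powr (q / p) * (t powr (- s * q - 1) * t powr (\<theta> * (q / p)))"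
        using A that by (simp add: powr_mult powr_powr)
      also have "\<dots> = A powr (q / p) * t powr (- s * q - 1 + \<theta> * (q / p))"
        using that by (simp only: powr_add)
      also have "- s * q - 1 + \<theta> * (q / p) = e - 1" by (simp add: e_def algebra_simps)
      finally show ?thesis .
    qed
    then have "ennreal (t powr (- s * q - 1) * (A * t powr \<theta>) powr (q / p))
      = ennreal (A powr (q / p)) * ennreal (t powr (e - 1))" if "0 < t"
      using that by (simp only: ennreal_mult powr_ge_zero)
    then show "ennreal (t powr (- s * q - 1) * (A * t powr \<theta>) powr (q / p)) * indicator {0<..1} t
      = ennreal (A powr (q / p)) * (ennreal (t powr (e - 1)) * indicator {0<..1} t)"
      by (simp add: indicator_def)
  qed
  also have "\<dots> = ennreal (A powr (q / p)) * ennreal (1 / e)"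
    using nn_integral_powr_0[of 1 e] e by (subst nn_integral_cmult) auto
  also have "\<dots> = ennreal (A powr (q / p) / e)"
    using e by (simp flip: ennreal_mult)
  finally show ?thesis by (simp add: e_def)
qed

text \<open>A Hoelder-type bound with exponent \<open>\<theta>\<close> is enough if \<open>\<theta> > s p\<close>. The factor
  \<open>1 / (q (\<theta> / p - s))\<close> blows up as \<open>\<theta>\<close> tends to \<open>s p\<close>; the critical case below depends on how fast.\<close>

lemma besov_intro_powr:
  fixes f :: "real ^ 'n \<Rightarrow> real"
  assumes p: "0 < p" "p \<le> 1" and q: "0 < q" and \<theta>: "s * p < \<theta>" "0 \<le> \<theta>"
    and f: "f \<in> borel_measurable borel" and A: "0 \<le> A" "pmass p ucube f \<le> ennreal A"
    and B: "0 \<le> B" "\<And>y. 0 < norm y \<Longrightarrow> norm y \<le> 1 \<Longrightarrow> diffp p f y \<le> ennreal (B * norm y powr \<theta>)"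
  shows "f \<in> besov p q s"
    "besov_norm p q s f \<le> (A powr (q / p) + B powr (q / p) / (q * (\<theta> / p - s))) powr (1 / q)"
proof -
  have E: "0 \<le> B powr (q / p) / (q * (\<theta> / p - s))"
    using p q \<theta> by (simp add: field_simps)
  have D: "diffp p f y \<le> ennreal (B * t powr \<theta>)" if "0 < t" "t \<le> 1" "0 < norm y" "norm y \<le> t" for t y
  proof -
    have "diffp p f y \<le> ennreal (B * norm y powr \<theta>)" using that B by auto
    also have "\<dots> \<le> ennreal (B * t powr \<theta>)"
      using that B \<theta> by (intro ennreal_leI mult_left_mono powr_mono2) auto
    finally show ?thesis .
  qed
  have I: "besov_int p q s (\<lambda>t. B * t powr \<theta>) \<le> ennreal (B powr (q / p) / (q * (\<theta> / p - s)))"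
    using besov_int_powr[OF p(1) q B(1) \<theta>(1)] by simp
  have nn: "0 \<le> B * t powr \<theta>" for t using B by simp
  show "f \<in> besov p q s"
    by (rule besov_intro(1)[OF p q f A nn D E I])
  show "besov_norm p q s f \<le> (A powr (q / p) + B powr (q / p) / (q * (\<theta> / p - s))) powr (1 / q)"
    by (rule besov_intro(2)[OF p q f A nn D E I])
qed

lemma min_one_le_powr:
  fixes u \<theta> :: real
  assumes "0 \<le> u" "0 \<le> \<theta>" "\<theta> \<le> 1"
  shows "min 1 u \<le> u powr \<theta>"
proof (cases "u \<le> 1")
  case True
  then show ?thesis using assms powr_mono'[of \<theta> 1 u] by (cases "u = 0") auto
next
  case False
  then show ?thesis using assms ge_one_powr_ge_zero[of u \<theta>] by simp
qed

lemma cmult_hcube_bounds: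
  fixes c y :: "real ^ 'n"
  assumes r: "0 < r" and p: "0 < p"
  shows "pmass p ucube (\<lambda>x. w * indicat_real (hcube c r) x) \<le> ennreal (\<bar>w\<bar> powr p * r ^ CARD('n))"
    and "diffp p (\<lambda>x. w * indicat_real (hcube c r) x) y
      \<le> ennreal (\<bar>w\<bar> powr p * (2 * real CARD('n) * r ^ CARD('n) * min 1 (norm y / r)))"
proof -
  have [measurable]: "indicat_real (hcube c r) \<in> borel_measurable borel" by measurable
  show "pmass p ucube (\<lambda>x. w * indicat_real (hcube c r) x) \<le> ennreal (\<bar>w\<bar> powr p * r ^ CARD('n))"
    using pmass_hcube_le[of r p ucube c] r
    by (simp add: pmass_cmult ennreal_mult mult_left_mono)
  have "diffp p (\<lambda>x. w * indicat_real (hcube c r) x) y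
      = ennreal (\<bar>w\<bar> powr p) * diffp p (indicat_real (hcube c r)) y"
    by (rule diffp_cmult) measurable
  also have "\<dots> \<le> ennreal (\<bar>w\<bar> powr p) * ennreal (2 * real CARD('n) * r ^ CARD('n) * min 1 (norm y / r))"
    by (intro mult_left_mono diffp_hcube_le r p) auto
  finally show "diffp p (\<lambda>x. w * indicat_real (hcube c r) x) y
      \<le> ennreal (\<bar>w\<bar> powr p * (2 * real CARD('n) * r ^ CARD('n) * min 1 (norm y / r)))"
    using r by (simp add: ennreal_mult)
qed

text \<open>Here \<open>s < 1 / p\<close> enters: the jump across the boundary of a cube has \<open>L\<^sub>p\<close> smoothness exactly
  \<open>1 / p\<close>, so step functions belong to the space.\<close>

lemma hcube_in_besov:
  fixes c :: "real ^ 'n"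
  assumes p: "0 < p" "p \<le> 1" and q: "0 < q" and s: "s < 1 / p" and r: "0 < r"
  shows "indicat_real (hcube c r) \<in> besov p q s"
proof (rule besov_intro_powr(1)[where \<theta> = 1])
  show "s * p < 1" using s p by (simp add: field_simps)
  show "pmass p ucube (indicat_real (hcube c r)) \<le> ennreal (r ^ CARD('n))"
    using r by (intro pmass_hcube_le) auto
  fix y :: "real ^ 'n"
  have "diffp p (indicat_real (hcube c r)) y
      \<le> ennreal (2 * real CARD('n) * r ^ CARD('n) * min 1 (norm y / r))"
    by (intro diffp_hcube_le r p)
  also have "\<dots> \<le> ennreal (2 * real CARD('n) * r ^ CARD('n) * (norm y / r))"
    using r by (intro ennreal_leI mult_left_mono) auto
  finally show "diffp p (indicat_real (hcube c r)) y
      \<le> ennreal (2 * real CARD('n) * r ^ CARD('n) / r * norm y powr 1)"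
    by simp
qed (use p q r in auto)

section \<open>Bounded functionals vanish on cubes\<close>

text \<open>The halves are indexed by the set \<open>S\<close> of coordinates in which the upper half is taken; a point of
  the cube lies in the half of exactly one \<open>S\<close>.\<close>

lemma hcube_halving:
  fixes c x :: "real ^ 'n"
  assumes r: "0 < r"
  shows "indicat_real (hcube c r) x =
    (\<Sum>S\<in>UNIV. indicat_real (hcube (\<chi> i. c $ i + (if i \<in> S then r / 2 else 0)) (r / 2)) x)"
proof -
  let ?S = "{i. c $ i + r / 2 \<le> x $ i}"
  have "indicat_real (hcube (\<chi> i. c $ i + (if i \<in> S then r / 2 else 0)) (r / 2)) x
      = (if S = ?S then indicat_real (hcube c r) x else 0)" for S
  proof -
    have "x \<in> hcube (\<chi> i. c $ i + (if i \<in> S then r / 2 else 0)) (r / 2) \<longleftrightarrow> S = ?S \<and> x \<in> hcube c r"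
    proof
      assume *: "x \<in> hcube (\<chi> i. c $ i + (if i \<in> S then r / 2 else 0)) (r / 2)"
      have **: "if i \<in> S then c $ i + r / 2 \<le> x $ i \<and> x $ i < c $ i + r
          else c $ i \<le> x $ i \<and> x $ i < c $ i + r / 2" for i
        using *[unfolded hcube_def, simplified, rule_format, of i] by (auto split: if_splits)
      have "S = ?S"
      proof (rule set_eqI)
        fix i show "i \<in> S \<longleftrightarrow> i \<in> ?S" using **[of i] by (auto split: if_splits)
      qed
      moreover have "x \<in> hcube c r"
        unfolding hcube_def
      proof safe
        fix i show "c $ i \<le> x $ i" "x $ i < c $ i + r" using **[of i] r by (auto split: if_splits)
      qed
      ultimately show "S = ?S \<and> x \<in> hcube c r" by simp
    next
      assume *: "S = ?S \<and> x \<in> hcube c r"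
      then show "x \<in> hcube (\<chi> i. c $ i + (if i \<in> S then r / 2 else 0)) (r / 2)"
        unfolding hcube_def by (simp add: not_le) (smt (verit))
    qed
    then show ?thesis by (auto simp: indicator_def)
  qed
  then show ?thesis by simp
qed

lemma geometric_sum_le:
  fixes x :: real
  assumes "0 \<le> x" "x < 1"
  shows "(\<Sum>k<K. x ^ k) \<le> 1 / (1 - x)"
proof -
  have "(\<Sum>k<K. x ^ k) = (1 - x ^ K) / (1 - x)"
    using assms by (simp add: sum_gp_strict)
  then show ?thesis using assms by (simp add: divide_right_mono)
qed

lemma geometric_sum_le':
  fixes x :: real
  assumes "1 < x"
  shows "(\<Sum>k<K. x ^ k) \<le> x ^ K / (x - 1)"
proof -
  have "(\<Sum>k<K. x ^ k) = (x ^ K - 1) / (x - 1)"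
    using assms by (simp add: geometric_sum)
  then show ?thesis using assms by (simp add: divide_right_mono)
qed

text \<open>Both bounds come from comparing the terms with geometric progressions: up to the index where
  \<open>\<tau> 2\<^sup>k\<close> passes 1 the terms are \<open>\<tau>\<close> times \<open>2\<close> to the power \<open>k (1 - \<theta>)\<close>, which grow, and after it
  they are \<open>2\<close> to the power \<open>- k \<theta>\<close>, which decay. The first bound, uniform in \<open>K\<close>, is the size of the
  terms near the turning index; the second is better when \<open>\<tau>\<close> is far below \<open>2\<close> to the power
  \<open>- K\<close>.\<close>

lemma dyadic_min_sum:
  fixes \<theta> \<tau> :: real
  assumes \<theta>: "0 < \<theta>" "\<theta> < 1" and \<tau>: "0 < \<tau>"
  defines "C \<equiv> 2 powr (1 - \<theta>) / (2 powr (1 - \<theta>) - 1) + 1 / (1 - 2 powr - \<theta>)"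
  shows "(\<Sum>k<K. (2 powr - \<theta>) ^ k * min 1 (\<tau> * 2 ^ k)) \<le> C * \<tau> powr \<theta>"
    and "(\<Sum>k<K. (2 powr - \<theta>) ^ k * min 1 (\<tau> * 2 ^ k)) \<le> C * \<tau> * (2 powr (1 - \<theta>)) ^ K"
proof -
  define \<rho> :: real where "\<rho> = 2 powr - \<theta>"
  define x :: real where "x = 2 powr (1 - \<theta>)"
  define t where "t k = \<rho> ^ k * min 1 (\<tau> * 2 ^ k)" for k
  have \<rho>: "0 < \<rho>" "\<rho> < 1" using \<theta> by (simp_all add: \<rho>_def powr_less_one)
  have x: "1 < x" using \<theta> by (simp add: x_def gr_one_powr)
  have \<rho>x: "\<rho> * 2 = x" by (simp add: \<rho>_def x_def powr_diff powr_minus field_simps)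
  have t1: "t k \<le> \<tau> * x ^ k" for k
  proof -
    have "t k \<le> \<rho> ^ k * (\<tau> * 2 ^ k)" unfolding t_def using \<rho> by (intro mult_left_mono) auto
    also have "\<dots> = \<tau> * x ^ k" by (simp flip: \<rho>x add: power_mult_distrib)
    finally show ?thesis .
  qed
  have t2: "t k \<le> \<rho> ^ k" for k
    unfolding t_def using \<rho> by (simp add: mult_left_le)
  have t0: "0 \<le> t k" for k unfolding t_def using \<rho> \<tau> by simp
  have C: "C = x / (x - 1) + 1 / (1 - \<rho>)" by (simp add: C_def x_def \<rho>_def)
  have low: "(\<Sum>k<m. t k) \<le> \<tau> * (x ^ m / (x - 1))" for m
  proof -
    have "(\<Sum>k<m. t k) \<le> (\<Sum>k<m. \<tau> * x ^ k)" by (intro sum_mono t1)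
    also have "\<dots> = \<tau> * (\<Sum>k<m. x ^ k)" by (simp add: sum_distrib_left)
    also have "\<dots> \<le> \<tau> * (x ^ m / (x - 1))"
      using \<tau> by (intro mult_left_mono geometric_sum_le' x) auto
    finally show ?thesis .
  qed
  have "(\<Sum>k<K. t k) \<le> C * \<tau> * x ^ K"
  proof -
    have "(\<Sum>k<K. t k) \<le> 1 / (x - 1) * (\<tau> * x ^ K)" using low[of K] by simp
    also have "\<dots> \<le> C * (\<tau> * x ^ K)"
      using x \<rho> \<tau> by (intro mult_right_mono) (auto simp: C intro!: add_increasing2 divide_right_mono)
    finally show ?thesis by (simp add: mult.assoc)
  qed
  then show "(\<Sum>k<K. (2 powr - \<theta>) ^ k * min 1 (\<tau> * 2 ^ k)) \<le> C * \<tau> * (2 powr (1 - \<theta>)) ^ K"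
    by (simp add: t_def \<rho>_def x_def)
  \<comment> \<open>the turning index, where the minimum changes from its second to its first argument\<close>
  define m where "m = (LEAST m. 1 \<le> \<tau> * 2 ^ m)"
  have ex: "\<exists>m. 1 \<le> \<tau> * 2 ^ m"
  proof -
    obtain m where "1 / \<tau> < 2 ^ m" using real_arch_pow[of 2 "1 / \<tau>"] by auto
    then have "1 \<le> \<tau> * 2 ^ m" using \<tau> by (simp add: field_simps)
    then show ?thesis ..
  qed
  have m1: "1 \<le> \<tau> * 2 ^ m" unfolding m_def by (rule LeastI_ex[OF ex])
  have pow: "(2 powr a) ^ k = (2 ^ k) powr a" for a :: real and k :: nat
    by (simp add: powr_powr powr_realpow[symmetric] powr_power mult.commute)
  have first: "(\<Sum>k<m. t k) \<le> x / (x - 1) * \<tau> powr \<theta>"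
  proof (cases m)
    case 0
    then show ?thesis using x by simp
  next
    case (Suc j)
    have "\<not> 1 \<le> \<tau> * 2 ^ j" using not_less_Least[of j "\<lambda>m. 1 \<le> \<tau> * 2 ^ m"] Suc by (simp add: m_def)
    then have "2 ^ m \<le> 2 / \<tau>" using \<tau> Suc by (simp add: field_simps)
    then have "(2 ^ m) powr (1 - \<theta>) \<le> (2 / \<tau>) powr (1 - \<theta>)"
      using \<theta> by (intro powr_mono2) auto
    then have "x ^ m \<le> x / \<tau> powr (1 - \<theta>)"
      using \<tau> by (simp add: x_def pow powr_divide)
    then have "\<tau> * (x ^ m / (x - 1)) \<le> \<tau> * (x / \<tau> powr (1 - \<theta>) / (x - 1))"
      using \<tau> x by (intro mult_left_mono divide_right_mono) auto
    also have "\<dots> = x / (x - 1) * (\<tau> powr 1 / \<tau> powr (1 - \<theta>))"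
      using \<tau> by (simp add: mult_ac)
    also have "\<tau> powr 1 / \<tau> powr (1 - \<theta>) = \<tau> powr (1 - (1 - \<theta>))"
      by (rule powr_diff[symmetric])
    also have "1 - (1 - \<theta>) = \<theta>" by simp
    finally show ?thesis using low[of m] by linarith
  qed
  have second: "(\<Sum>j<K. t (m + j)) \<le> 1 / (1 - \<rho>) * \<tau> powr \<theta>"
  proof -
    have "(\<Sum>j<K. t (m + j)) \<le> (\<Sum>j<K. \<rho> ^ m * \<rho> ^ j)"
      using t2 by (intro sum_mono) (simp flip: power_add)
    also have "\<dots> = \<rho> ^ m * (\<Sum>j<K. \<rho> ^ j)" by (simp add: sum_distrib_left)
    also have "\<dots> \<le> \<rho> ^ m * (1 / (1 - \<rho>))"
      using \<rho> by (intro mult_left_mono geometric_sum_le) auto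
    also have "\<dots> \<le> \<tau> powr \<theta> * (1 / (1 - \<rho>))"
    proof (intro mult_right_mono)
      have "1 / \<tau> \<le> 2 ^ m" using m1 \<tau> by (simp add: field_simps)
      then have "(2 ^ m) powr - \<theta> \<le> (1 / \<tau>) powr - \<theta>"
        using \<theta> \<tau> by (intro powr_mono2') auto
      moreover have "\<rho> ^ m = (2 ^ m) powr - \<theta>" unfolding \<rho>_def by (rule pow)
      moreover have "(1 / \<tau>) powr - \<theta> = \<tau> powr \<theta>"
        using \<tau> by (simp add: powr_divide powr_minus)
      ultimately show "\<rho> ^ m \<le> \<tau> powr \<theta>" by simp
    qed (use \<rho> in auto)
    finally show ?thesis by (simp add: mult.commute)
  qed
  have split: "(\<Sum>k<m + K. t k) = (\<Sum>k<m. t k) + (\<Sum>j<K. t (m + j))"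
    by (induction K) auto
  have "(\<Sum>k<K. t k) \<le> (\<Sum>k<m + K. t k)"
    by (intro sum_mono2) (auto simp: t0)
  also have "\<dots> \<le> C * \<tau> powr \<theta>"
    unfolding split C distrib_right using first second by (rule add_mono)
  finally show "(\<Sum>k<K. (2 powr - \<theta>) ^ k * min 1 (\<tau> * 2 ^ k)) \<le> C * \<tau> powr \<theta>"
    by (simp add: t_def \<rho>_def)
qed

lemma le_powr_interpolation:
  fixes T X Y \<mu> :: real
  assumes "T \<le> X" "T \<le> Y" "0 < X" "0 < Y" "0 \<le> \<mu>" "\<mu> \<le> 1"
  shows "T \<le> X powr (1 - \<mu>) * Y powr \<mu>"
proof (cases "0 < T")
  case True
  have "T = T powr (1 - \<mu>) * T powr \<mu>" using True by (simp flip: powr_add)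
  also have "\<dots> \<le> X powr (1 - \<mu>) * Y powr \<mu>"
    using assms True by (intro mult_mono powr_mono2) auto
  finally show ?thesis .
next
  case False
  have "0 \<le> X powr (1 - \<mu>) * Y powr \<mu>" by simp
  then show ?thesis using False by linarith
qed

text \<open>With the weight \<open>2\<^sup>k\<^sup>d\<close>, which keeps the integral of the indicator of a cube of side \<open>r / 2\<^sup>k\<close>
  constant, the \<open>p\<close>-th power of the \<open>L\<^sub>p\<close> norm decays like \<open>2\<close> to the power \<open>- k d (1 - p)\<close>. The
  divisor \<open>a\<close> allows for averaging.\<close>

lemma dyadic_cube_weight:
  fixes r p a :: real
  assumes r: "0 < r" and a: "0 < a"
  shows "\<bar>(2 ^ k) ^ d / a\<bar> powr p * (r / 2 ^ k) ^ d
    = a powr - p * r ^ d * (2 powr - (real d * (1 - p))) ^ k"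
proof -
  have pow: "(2 ^ k) ^ d = (2::real) powr (real k * real d)"
    by (simp add: powr_realpow[symmetric] powr_powr)
  have "\<bar>(2 ^ k) ^ d / a\<bar> powr p * (r / 2 ^ k) ^ d
      = ((2 ^ k) ^ d) powr p / a powr p * (r ^ d / (2 ^ k) ^ d)"
    using a by (simp add: powr_divide power_divide)
  also have "\<dots> = a powr - p * r ^ d * (2 powr (real k * real d * p) / 2 powr (real k * real d))"
    by (simp add: pow powr_powr powr_minus divide_inverse)
  also have "2 powr (real k * real d * p) / 2 powr (real k * real d)
      = (2::real) powr (real k * real d * p - real k * real d)"
    by (simp add: powr_diff)
  also have "\<dots> = (2 powr - (real d * (1 - p))) ^ k"
    by (simp add: powr_power algebra_simps)
  finally show ?thesis .
qed

context
  fixes p q s :: real and F :: "(real ^ 'n \<Rightarrow> real) \<Rightarrow> real"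
  assumes p: "0 < p" "p < 1" and q: "0 < q" and s: "0 < s" "s < 1 / p"
    and F: "F \<in> besov_dual p q s"
begin

lemma dual_add: "f \<in> besov p q s \<Longrightarrow> g \<in> besov p q s \<Longrightarrow> F (\<lambda>x. f x + g x) = F f + F g"
  using F unfolding besov_dual_def by blast

lemma dual_cmult: "f \<in> besov p q s \<Longrightarrow> F (\<lambda>x. c * f x) = c * F f"
  using F unfolding besov_dual_def by blast

lemma dual_cong: "f \<in> besov p q s \<Longrightarrow> g \<in> besov p q s \<Longrightarrow>
    AE x in lebesgue_on unit_cube. f x = g x \<Longrightarrow> F f = F g"
  using F unfolding besov_dual_def by blast

lemma cube_besov: "0 < r \<Longrightarrow> indicat_real (hcube c r) \<in> besov p q s"
  using p q s by (intro hcube_in_besov) auto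

lemma zero_besov: "(\<lambda>x. 0) \<in> besov p q s"
  using besov_cmult[OF p(1) _ q cube_besov[of 1], of 0] p by simp

lemma sum_besov:
  assumes "finite A" "\<And>k. k \<in> A \<Longrightarrow> f k \<in> besov p q s"
  shows "(\<lambda>x. \<Sum>k\<in>A. f k x) \<in> besov p q s"
  using assms
proof (induction A rule: finite_induct)
  case (insert a A)
  have "(\<lambda>x. f a x + (\<Sum>k\<in>A. f k x)) \<in> besov p q s"
    using insert p q by (intro besov_add) auto
  then show ?case using insert by simp
qed (simp add: zero_besov)

lemma dual_sum:
  assumes "finite A" "\<And>k. k \<in> A \<Longrightarrow> f k \<in> besov p q s"
  shows "F (\<lambda>x. \<Sum>k\<in>A. f k x) = (\<Sum>k\<in>A. F (f k))"
  using assms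
proof (induction A rule: finite_induct)
  case empty
  show ?case using dual_cmult[OF zero_besov, of 0] by simp
next
  case (insert a A)
  have "F (\<lambda>x. f a x + (\<Sum>k\<in>A. f k x)) = F (f a) + F (\<lambda>x. \<Sum>k\<in>A. f k x)"
    using insert by (intro dual_add sum_besov) auto
  then show ?case using insert by simp
qed

text \<open>Boundedness is used only in this form: a value of \<open>F\<close> vanishes if it is dominated by values of
  \<open>F\<close> at functions of arbitrarily small norm.\<close>

lemma dual_zero_limit:
  assumes a: "a \<longlonglongrightarrow> 0"
    and ex: "\<And>k. \<exists>f \<in> besov p q s. \<bar>v\<bar> \<le> \<bar>F f\<bar> \<and> besov_norm p q s f \<le> a k"
  shows "v = 0"
proof -
  obtain C where C: "\<And>f. f \<in> besov p q s \<Longrightarrow> \<bar>F f\<bar> \<le> C * besov_norm p q s f"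
    using F unfolding besov_dual_def by blast
  have "\<bar>v\<bar> \<le> \<bar>C\<bar> * a k" for k
  proof -
    obtain f where f: "f \<in> besov p q s" "\<bar>v\<bar> \<le> \<bar>F f\<bar>" "besov_norm p q s f \<le> a k"
      using ex by blast
    have "0 \<le> besov_norm p q s f"
      by (simp add: besov_norm_def)
    then have "C * besov_norm p q s f \<le> \<bar>C\<bar> * a k"
      using f(3) by (intro mult_mono) auto
    then show ?thesis using C[OF f(1)] f(2) by linarith
  qed
  moreover have "(\<lambda>k. \<bar>C\<bar> * a k) \<longlonglongrightarrow> 0" using tendsto_mult_right_zero[OF a] .
  ultimately have "\<bar>v\<bar> \<le> 0" by (intro LIMSEQ_le_const) auto
  then show ?thesis by simp
qed

text \<open>By additivity some half of a cube carries at least the average share of \<open>\<sigma> * F\<close>. The sign \<open>\<sigma>\<close> is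
  kept because the critical case adds up values at different scales, which must not cancel.\<close>

lemma dual_halving:
  assumes r: "0 < r"
  shows "\<exists>c'. \<sigma> * F (indicat_real (hcube c r)) \<le> 2 ^ CARD('n) * (\<sigma> * F (indicat_real (hcube c' (r / 2))))"
proof (rule ccontr)
  assume "\<not> ?thesis"
  then have *: "2 ^ CARD('n) * (\<sigma> * F (indicat_real (hcube c' (r / 2)))) < \<sigma> * F (indicat_real (hcube c r))" for c'
    by (auto simp: not_le)
  define ch where "ch S = (\<chi> i. c $ i + (if i \<in> S then r / 2 else 0))" for S :: "'n set"
  define X where "X = \<sigma> * F (indicat_real (hcube c r)) / 2 ^ CARD('n)"
  have card: "card (UNIV :: 'n set set) = 2 ^ CARD('n)"
    by (metis Pow_UNIV card_Pow finite)
  have "indicat_real (hcube c r) = (\<lambda>x. \<Sum>S\<in>UNIV. indicat_real (hcube (ch S) (r / 2)) x)"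
    unfolding ch_def using hcube_halving[OF r] by (rule ext)
  then have "\<sigma> * F (indicat_real (hcube c r)) = \<sigma> * (\<Sum>S\<in>UNIV. F (indicat_real (hcube (ch S) (r / 2))))"
    using dual_sum[of UNIV "\<lambda>S. indicat_real (hcube (ch S) (r / 2))"] r by (simp add: cube_besov)
  also have "\<dots> = (\<Sum>S\<in>UNIV. \<sigma> * F (indicat_real (hcube (ch S) (r / 2))))"
    by (simp add: sum_distrib_left)
  also have "\<dots> < of_nat (card (UNIV :: 'n set set)) * X"
    using * by (intro sum_bounded_above_strict) (auto simp: X_def field_simps)
  also have "\<dots> = \<sigma> * F (indicat_real (hcube c r))" unfolding card X_def by simp
  finally show False by simp
qed

lemma dual_concentrates:
  assumes r: "0 < r"
  shows "\<exists>c'. \<sigma> * F (indicat_real (hcube c r))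
    \<le> (2 ^ k) ^ CARD('n) * (\<sigma> * F (indicat_real (hcube c' (r / 2 ^ k))))"
proof (induction k)
  case 0
  show ?case by (intro exI[of _ c]) simp
next
  case (Suc k)
  then obtain c' where c': "\<sigma> * F (indicat_real (hcube c r))
    \<le> (2 ^ k) ^ CARD('n) * (\<sigma> * F (indicat_real (hcube c' (r / 2 ^ k))))" by blast
  obtain c'' where c'': "\<sigma> * F (indicat_real (hcube c' (r / 2 ^ k)))
      \<le> 2 ^ CARD('n) * (\<sigma> * F (indicat_real (hcube c'' (r / 2 ^ k / 2))))"
    using dual_halving[of "r / 2 ^ k" \<sigma> c'] r by auto
  have "(2 ^ k) ^ CARD('n) * (\<sigma> * F (indicat_real (hcube c' (r / 2 ^ k))))
      \<le> (2 ^ k) ^ CARD('n) * (2 ^ CARD('n) * (\<sigma> * F (indicat_real (hcube c'' (r / 2 ^ k / 2)))))"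
    by (intro mult_left_mono c'') auto
  also have "\<dots> = (2 ^ Suc k) ^ CARD('n) * (\<sigma> * F (indicat_real (hcube c'' (r / 2 ^ Suc k))))"
    by (simp add: power_mult_distrib mult_ac)
  finally show ?case using c' by (meson order_trans)
qed

text \<open>The concentrated functions \<open>2\<^sup>k\<^sup>d\<close> times the indicator of a cube of side \<open>r / 2\<^sup>k\<close> tend to 0 in
  norm. The indicator of a cube of side \<open>r\<close> has differences of \<open>p\<close>-th power mass at most a constant
  times \<open>r\<^sup>d min 1 (\<bar>y\<bar> / r)\<close>. Replacing the minimum by the power \<open>(\<bar>y\<bar> / r)\<close> to the \<open>\<theta>\<close> with \<open>s p < \<theta> < min 1 (d (1 - p))\<close> gives a factor
  \<open>2\<close> to the power \<open>k (\<theta> - d (1 - p))\<close>; such a \<open>\<theta>\<close> exists precisely in the subcritical range.\<close>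

lemma dual_vanishes_on_cubes_subcritical:
  assumes r: "0 < r" and sub: "s < real CARD('n) * (1 / p - 1)"
  shows "F (indicat_real (hcube c r)) = 0"
proof -
  let ?d = "CARD('n)"
  define v where "v = F (indicat_real (hcube c r))"
  define \<theta>0 where "\<theta>0 = real ?d * (1 - p)"
  have "s * p < \<theta>0" using sub p by (simp add: \<theta>0_def field_simps)
  moreover have "s * p < 1" using s p by (simp add: field_simps)
  ultimately obtain \<theta> where \<theta>: "s * p < \<theta>" "\<theta> < min 1 \<theta>0"
    using dense[of "s * p" "min 1 \<theta>0"] by auto
  have \<theta>pos: "0 < \<theta>" using \<theta> s p by (meson less_trans mult_pos_pos)
  \<comment> \<open>\<open>A k\<close> bounds the \<open>L\<^sub>p\<close> part and \<open>B k\<close> the modulus of the \<open>k\<close>-th concentrated function\<close>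
  define A where "A k = r ^ ?d * (2 powr - \<theta>0) ^ k" for k :: nat
  define B where "B k = 2 * real ?d * r ^ ?d / r powr \<theta> * (2 powr (\<theta> - \<theta>0)) ^ k" for k :: nat
  define E where "E = q * (\<theta> / p - s)"
  define a where "a k = (A k powr (q / p) + B k powr (q / p) / E) powr (1 / q)" for k
  have A0: "0 \<le> A k" and B0: "0 \<le> B k" for k using r by (simp_all add: A_def B_def)
  have E: "0 < E" using \<theta> p q by (simp add: E_def field_simps)
  have "A \<longlonglongrightarrow> r ^ ?d * 0" unfolding A_def
    using \<theta> \<theta>pos by (intro tendsto_mult tendsto_const LIMSEQ_realpow_zero) (auto simp: powr_less_one)
  then have A: "A \<longlonglongrightarrow> 0" by simp
  have "B \<longlonglongrightarrow> 2 * real ?d * r ^ ?d / r powr \<theta> * 0" unfolding B_def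
    using \<theta> \<theta>pos by (intro tendsto_mult tendsto_const LIMSEQ_realpow_zero) (auto simp: powr_less_one)
  then have B: "B \<longlonglongrightarrow> 0" by simp
  have "(\<lambda>k. A k powr (q / p)) \<longlonglongrightarrow> 0" "(\<lambda>k. B k powr (q / p)) \<longlonglongrightarrow> 0"
    using A B A0 B0 p q by (auto intro!: tendsto_zero_powrI[OF _ tendsto_const])
  then have "(\<lambda>k. A k powr (q / p) + B k powr (q / p) / E) \<longlonglongrightarrow> 0 + 0 / E"
    using E by (intro tendsto_add tendsto_divide tendsto_const) auto
  then have "(\<lambda>k. A k powr (q / p) + B k powr (q / p) / E) \<longlonglongrightarrow> 0" by simp
  then have lim: "a \<longlonglongrightarrow> 0" unfolding a_def
    using q E by (intro tendsto_zero_powrI[OF _ tendsto_const]) auto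
  have "v = 0"
  proof (rule dual_zero_limit[OF lim])
    fix k
    obtain c' where c': "sgn v * v \<le> (2 ^ k) ^ ?d * (sgn v * F (indicat_real (hcube c' (r / 2 ^ k))))"
      using dual_concentrates[OF r, of "sgn v" c k] by (auto simp: v_def)
    define Q where "Q = hcube c' (r / 2 ^ k)"
    define w :: real where "w = (2 ^ k) ^ ?d / 1"
    define f where "f = (\<lambda>x. w * indicat_real Q x)"
    have rk: "0 < r / 2 ^ k" using r by simp
    have Ff: "F f = w * F (indicat_real Q)" unfolding f_def Q_def using rk by (intro dual_cmult cube_besov)
    have "\<bar>v\<bar> \<le> sgn v * F f" using c' by (simp add: abs_sgn Ff w_def Q_def mult_ac)
    also have "\<dots> \<le> \<bar>F f\<bar>" by (auto simp: sgn_if)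
    finally have vF: "\<bar>v\<bar> \<le> \<bar>F f\<bar>" .
    have W: "\<bar>w\<bar> powr p * (r / 2 ^ k) ^ ?d = A k"
      unfolding w_def A_def \<theta>0_def using dyadic_cube_weight[OF r, of 1 k ?d p] by simp
    have fA: "pmass p ucube f \<le> ennreal (A k)"
      using cmult_hcube_bounds(1)[OF rk p(1), of w c'] by (simp add: f_def Q_def W)
    have fB: "diffp p f y \<le> ennreal (B k * norm y powr \<theta>)" if "0 < norm y" "norm y \<le> 1" for y
    proof -
      let ?u = "norm y / (r / 2 ^ k)"
      have "diffp p f y \<le> ennreal (\<bar>w\<bar> powr p * (2 * real ?d * (r / 2 ^ k) ^ ?d * min 1 ?u))"
        unfolding f_def Q_def by (rule cmult_hcube_bounds(2)[OF rk p(1)])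
      also have "\<bar>w\<bar> powr p * (2 * real ?d * (r / 2 ^ k) ^ ?d * min 1 ?u)
          = 2 * real ?d * A k * min 1 ?u" by (simp flip: W)
      also have "ennreal \<dots> \<le> ennreal (2 * real ?d * A k * ?u powr \<theta>)"
        using A0 \<theta> \<theta>pos r by (intro ennreal_leI mult_left_mono min_one_le_powr) auto
      also have "?u powr \<theta> = norm y powr \<theta> / r powr \<theta> * (2 powr \<theta>) ^ k"
        using r by (simp add: powr_divide powr_mult powr_power powr_realpow[symmetric] powr_powr mult.commute)
      also have "2 * real ?d * A k * (norm y powr \<theta> / r powr \<theta> * (2 powr \<theta>) ^ k)
          = 2 * real ?d * r ^ ?d / r powr \<theta> * ((2 powr - \<theta>0) * (2 powr \<theta>)) ^ k * norm y powr \<theta>"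
        by (simp add: A_def power_mult_distrib)
      also have "\<dots> = B k * norm y powr \<theta>"
        by (simp add: B_def flip: powr_add)
      finally show ?thesis .
    qed
    have fm: "f \<in> borel_measurable borel" unfolding f_def Q_def by measurable
    note I = besov_intro_powr[where A = "A k" and B = "B k" and \<theta> = \<theta> and q = q and s = s, OF p(1) less_imp_le[OF p(2)] q \<theta>(1) less_imp_le[OF \<theta>pos] fm A0 fA B0 fB]
    show "\<exists>f \<in> besov p q s. \<bar>v\<bar> \<le> \<bar>F f\<bar> \<and> besov_norm p q s f \<le> a k"
      using I vF by (auto simp: a_def E_def)
  qed
  then show ?thesis by (simp add: v_def)
qed

text \<open>At \<open>s = d (1 / p - 1)\<close> the concentrated functions are only bounded in norm, but they live at
  different scales. For the mean of the first \<open>K\<close> of them the \<open>p\<close>-th power of the modulus is at most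
  a constant times \<open>K\<close> to the power \<open>- p\<close> times \<open>t\<close> to the power \<open>s p\<close> at all scales, with a gain
  at scales below the smallest cube. Interpolating between the two bounds of \<open>dyadic_min_sum\<close> with
  weight \<open>1 / K\<close> raises the exponent by \<open>(1 - s p) / K\<close> at the price of a bounded factor. Hence the
  integral in the norm is of order \<open>K\<close> to the power \<open>- q\<close> times \<open>K\<close>, which tends to 0 for \<open>q > 1\<close>.\<close>

lemma dual_vanishes_on_cubes_critical:
  assumes r: "0 < r" "r \<le> 1" and crit: "s = real CARD('n) * (1 / p - 1)" and q1: "1 < q"
  shows "F (indicat_real (hcube c r)) = 0"
proof -
  let ?d = "CARD('n)"
  define v where "v = F (indicat_real (hcube c r))"
  define \<theta>0 where "\<theta>0 = real ?d * (1 - p)"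
  define \<alpha> where "\<alpha> = 1 - \<theta>0"
  have sp: "s * p = \<theta>0" using crit p by (simp add: \<theta>0_def field_simps)
  have \<theta>0: "0 < \<theta>0" "\<theta>0 < 1"
    using s p sp by (auto simp: \<theta>0_def) (metis mult.commute pos_less_divide_eq sp \<theta>0_def)
  have \<alpha>: "0 < \<alpha>" using \<theta>0 by (simp add: \<alpha>_def)
  define \<rho> :: real where "\<rho> = 2 powr - \<theta>0"
  have \<rho>: "0 < \<rho>" "\<rho> < 1" using \<theta>0 by (simp_all add: \<rho>_def powr_less_one)
  define C where "C = 2 powr (1 - \<theta>0) / (2 powr (1 - \<theta>0) - 1) + 1 / (1 - 2 powr - \<theta>0)"
  have C: "0 < C"
  proof -
    have "1 < 2 powr (1 - \<theta>0)" using \<theta>0 by (simp add: gr_one_powr)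
    then show ?thesis unfolding C_def using \<rho> by (intro add_pos_pos divide_pos_pos) (auto simp: \<rho>_def)
  qed
  define D where "D = 2 * real ?d * r ^ ?d * (C * 2 powr \<alpha> / r)"
  have D: "0 < D" using r C by (simp add: D_def)
  define K where "K k = real (Suc k)" for k
  have K: "0 < K k" "1 \<le> K k" for k by (simp_all add: K_def)
  define A where "A k = K k powr - p * r ^ ?d * (1 / (1 - \<rho>))" for k
  define B where "B k = D * K k powr - p" for k
  \<comment> \<open>the critical exponent, raised so little that the loss at the smallest scale stays bounded\<close>
  define \<theta> where "\<theta> k = \<theta>0 + \<alpha> / K k" for k
  define a where "a k = (A k powr (q / p) + B k powr (q / p) / (q * (\<theta> k / p - s))) powr (1 / q)" for k
  have A0: "0 \<le> A k" and B0: "0 \<le> B k" for k using r D \<rho> by (simp_all add: A_def B_def)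
  have \<theta>: "s * p < \<theta> k" "0 \<le> \<theta> k" "\<theta> k \<le> 1" for k
  proof -
    have "0 < \<alpha> / K k" using \<alpha> K[of k] by simp
    moreover have "\<alpha> / K k \<le> \<alpha>" using \<alpha> K[of k] by (simp add: pos_divide_le_eq)
    moreover have "\<alpha> + \<theta>0 = 1" by (simp add: \<alpha>_def)
    ultimately show "s * p < \<theta> k" "0 \<le> \<theta> k" "\<theta> k \<le> 1"
      unfolding sp \<theta>_def using \<theta>0 by linarith+
  qed
  have Klim: "filterlim K at_top sequentially"
    unfolding K_def by (intro filterlim_compose[OF filterlim_real_sequentially filterlim_Suc])
  have "(\<lambda>k. K k powr - p) \<longlonglongrightarrow> 0" using p by (intro tendsto_neg_powr Klim) auto
  then have "A \<longlonglongrightarrow> 0 * r ^ ?d * (1 / (1 - \<rho>))"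
    unfolding A_def by (intro tendsto_mult tendsto_const)
  then have "(\<lambda>k. A k powr (q / p)) \<longlonglongrightarrow> 0"
    using A0 p q by (auto intro!: tendsto_zero_powrI[OF _ tendsto_const])
  moreover have "(\<lambda>k. B k powr (q / p) / (q * (\<theta> k / p - s))) \<longlonglongrightarrow> 0"
  proof -
    \<comment> \<open>the averaging gains \<open>K\<close> to the power \<open>- q\<close>, the distance to the critical exponent costs \<open>K\<close>\<close>
    have "B k powr (q / p) / (q * (\<theta> k / p - s)) = D powr (q / p) * p / (q * \<alpha>) * K k powr (1 - q)" for k
    proof -
      have e1: "\<theta> k / p - s = \<alpha> / (K k * p)"
        using sp p K[of k] by (simp add: \<theta>_def field_simps)
      have e2: "B k powr (q / p) = D powr (q / p) * K k powr - q"
        using D p K[of k] by (simp add: B_def powr_mult powr_powr)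
      have e3: "K k powr (1 - q) = K k * K k powr - q"
        using K[of k] by (simp add: powr_diff powr_minus divide_inverse)
      show ?thesis unfolding e1 e2 e3 using p q \<alpha> K[of k] by (simp add: field_simps)
    qed
    moreover have "(\<lambda>k. K k powr (1 - q)) \<longlonglongrightarrow> 0" using q1 by (intro tendsto_neg_powr Klim) auto
    ultimately show ?thesis by (simp only: tendsto_mult_right_zero)
  qed
  ultimately have "(\<lambda>k. A k powr (q / p) + B k powr (q / p) / (q * (\<theta> k / p - s))) \<longlonglongrightarrow> 0 + 0"
    by (rule tendsto_add)
  then have "(\<lambda>k. A k powr (q / p) + B k powr (q / p) / (q * (\<theta> k / p - s))) \<longlonglongrightarrow> 0" by simp
  moreover have "0 \<le> A k powr (q / p) + B k powr (q / p) / (q * (\<theta> k / p - s))" for k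
    using \<theta>[of k] p q by (intro add_nonneg_nonneg divide_nonneg_nonneg) (auto simp: field_simps)
  ultimately have lim: "a \<longlonglongrightarrow> 0" unfolding a_def
    using q by (intro tendsto_zero_powrI[OF _ tendsto_const]) auto
  have "\<forall>j. \<exists>c'. sgn v * v \<le> (2 ^ j) ^ ?d * (sgn v * F (indicat_real (hcube c' (r / 2 ^ j))))"
    using dual_concentrates[OF r(1), of "sgn v" c] by (auto simp: v_def)
  then obtain cc where cc: "\<And>j. sgn v * v \<le> (2 ^ j) ^ ?d * (sgn v * F (indicat_real (hcube (cc j) (r / 2 ^ j))))"
    by metis
  have "v = 0"
  proof (rule dual_zero_limit[OF lim])
    fix k
    define Q where "Q j = hcube (cc j) (r / 2 ^ j)" for j
    define w :: "nat \<Rightarrow> real" where "w j = (2 ^ j) ^ ?d / K k" for j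
    define g where "g j = (\<lambda>x. w j * indicat_real (Q j) x)" for j
    define f where "f = (\<lambda>x. \<Sum>j<Suc k. g j x)"
    have rj: "0 < r / 2 ^ j" for j using r by simp
    have gb: "g j \<in> besov p q s" for j
      unfolding g_def Q_def using rj p q by (intro besov_cmult cube_besov) auto
    have gm[measurable]: "g j \<in> borel_measurable borel" for j unfolding g_def Q_def by measurable
    have Fg: "F (g j) = w j * F (indicat_real (Q j))" for j
      unfolding g_def Q_def using rj by (intro dual_cmult cube_besov)
    have "\<bar>v\<bar> = (\<Sum>j<Suc k. \<bar>v\<bar> / K k)" by (simp add: K_def)
    also have "\<dots> \<le> (\<Sum>j<Suc k. sgn v * F (g j))"
    proof (rule sum_mono)
      fix j
      have "\<bar>v\<bar> / K k \<le> ((2 ^ j) ^ ?d * (sgn v * F (indicat_real (hcube (cc j) (r / 2 ^ j))))) / K k"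
        using cc[of j] K[of k] by (intro divide_right_mono) (auto simp: abs_sgn mult.commute)
      then show "\<bar>v\<bar> / K k \<le> sgn v * F (g j)" by (simp add: Fg w_def Q_def mult_ac)
    qed
    also have "\<dots> = sgn v * F f"
      unfolding f_def using gb by (subst dual_sum) (auto simp only: sum_distrib_left finite_lessThan)
    also have "\<dots> \<le> \<bar>F f\<bar>" by (auto simp: sgn_if)
    finally have vF: "\<bar>v\<bar> \<le> \<bar>F f\<bar>" .
    have W: "\<bar>w j\<bar> powr p * (r / 2 ^ j) ^ ?d = K k powr - p * r ^ ?d * \<rho> ^ j" for j
      unfolding w_def \<rho>_def \<theta>0_def using dyadic_cube_weight[OF r(1) K(1)] by simp
    have fA: "pmass p ucube f \<le> ennreal (A k)"
    proof -
      have "pmass p ucube f \<le> (\<Sum>j<Suc k. pmass p ucube (g j))"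
        unfolding f_def using p by (intro pmass_sum_le) auto
      also have "\<dots> \<le> (\<Sum>j<Suc k. ennreal (K k powr - p * r ^ ?d * \<rho> ^ j))"
      proof (rule sum_mono)
        fix j show "pmass p ucube (g j) \<le> ennreal (K k powr - p * r ^ ?d * \<rho> ^ j)"
          using cmult_hcube_bounds(1)[OF rj[of j] p(1), of "w j" "cc j"] by (simp add: g_def Q_def W)
      qed
      also have "\<dots> = ennreal (K k powr - p * r ^ ?d * (\<Sum>j<Suc k. \<rho> ^ j))"
        using \<rho> r by (subst sum_ennreal) (auto simp: sum_distrib_left simp del: sum.lessThan_Suc)
      also have "\<dots> \<le> ennreal (A k)"
        unfolding A_def using \<rho> r by (intro ennreal_leI mult_left_mono geometric_sum_le) auto
      finally show ?thesis .
    qed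
    have fB: "diffp p f y \<le> ennreal (B k * norm y powr \<theta> k)" if y: "0 < norm y" "norm y \<le> 1" for y
    proof -
      define \<tau> where "\<tau> = norm y / r"
      have \<tau>: "0 < \<tau>" using y r by (simp add: \<tau>_def)
      define T where "T = (\<Sum>j<Suc k. \<rho> ^ j * min 1 (\<tau> * 2 ^ j))"
      define \<mu> where "\<mu> = 1 / K k"
      have "diffp p f y \<le> (\<Sum>j<Suc k. diffp p (g j) y)"
        unfolding f_def using p by (intro diffp_sum_le) auto
      also have "\<dots> \<le> (\<Sum>j<Suc k. ennreal (2 * real ?d * (K k powr - p * r ^ ?d) * (\<rho> ^ j * min 1 (\<tau> * 2 ^ j))))"
      proof (rule sum_mono)
        fix j
        have "diffp p (g j) y \<le> ennreal (\<bar>w j\<bar> powr p * (2 * real ?d * (r / 2 ^ j) ^ ?d * min 1 (norm y / (r / 2 ^ j))))"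
          unfolding g_def Q_def by (rule cmult_hcube_bounds(2)[OF rj p(1)])
        also have "\<bar>w j\<bar> powr p * (2 * real ?d * (r / 2 ^ j) ^ ?d * min 1 (norm y / (r / 2 ^ j)))
            = 2 * real ?d * (\<bar>w j\<bar> powr p * (r / 2 ^ j) ^ ?d) * min 1 (\<tau> * 2 ^ j)"
          by (simp add: \<tau>_def)
        finally show "diffp p (g j) y \<le> ennreal (2 * real ?d * (K k powr - p * r ^ ?d) * (\<rho> ^ j * min 1 (\<tau> * 2 ^ j)))"
          by (simp add: W mult.assoc)
      qed
      also have "\<dots> = ennreal (2 * real ?d * (K k powr - p * r ^ ?d) * T)"
        using \<rho> r \<tau> by (subst sum_ennreal) (auto simp: sum_distrib_left T_def simp del: sum.lessThan_Suc)
      also have "\<dots> \<le> ennreal (2 * real ?d * (K k powr - p * r ^ ?d) * (C * 2 powr \<alpha> / r * norm y powr \<theta> k))"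
      proof (intro ennreal_leI mult_left_mono)
        have "T \<le> C * \<tau> powr \<theta>0" "T \<le> C * \<tau> * (2 powr (1 - \<theta>0)) ^ Suc k"
          unfolding T_def \<rho>_def C_def by (rule dyadic_min_sum[OF \<theta>0 \<tau>])+
        then have "T \<le> (C * \<tau> powr \<theta>0) powr (1 - \<mu>) * (C * \<tau> * (2 powr (1 - \<theta>0)) ^ Suc k) powr \<mu>"
          using C \<tau> K[of k] by (intro le_powr_interpolation) (auto simp: \<mu>_def simp del: power_Suc)
        also have "\<dots> = (C powr (1 - \<mu>) * C powr \<mu>) * (\<tau> powr (\<theta>0 * (1 - \<mu>)) * \<tau> powr \<mu>)
            * ((2 powr (1 - \<theta>0)) ^ Suc k) powr \<mu>"
          using C \<tau> by (simp add: powr_mult powr_powr del: power_Suc)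
        also have "C powr (1 - \<mu>) * C powr \<mu> = C" using C by (simp flip: powr_add)
        also have "\<tau> powr (\<theta>0 * (1 - \<mu>)) * \<tau> powr \<mu> = \<tau> powr \<theta> k"
          unfolding powr_add[symmetric]
          by (simp add: \<theta>_def \<alpha>_def \<mu>_def algebra_simps diff_divide_distrib)
        also have "((2 powr (1 - \<theta>0)) ^ Suc k) powr \<mu> = 2 powr \<alpha>"
          using K[of k] by (simp add: powr_power powr_powr \<alpha>_def \<mu>_def K_def del: power_Suc)
        also have "\<tau> powr \<theta> k = norm y powr \<theta> k / r powr \<theta> k"
          using r by (simp add: \<tau>_def powr_divide)
        also have "\<dots> \<le> norm y powr \<theta> k / r"
          using r \<theta>[of k] powr_mono'[of "\<theta> k" 1 r] by (intro divide_left_mono) auto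
        finally show "T \<le> C * 2 powr \<alpha> / r * norm y powr \<theta> k"
          using C by (simp add: mult_ac)
      qed (use r in auto)
      also have "2 * real ?d * (K k powr - p * r ^ ?d) * (C * 2 powr \<alpha> / r * norm y powr \<theta> k)
          = B k * norm y powr \<theta> k"
        by (simp add: B_def D_def)
      finally show ?thesis .
    qed
    have fm: "f \<in> borel_measurable borel" unfolding f_def by measurable
    note I = besov_intro_powr[where A = "A k" and B = "B k" and \<theta> = "\<theta> k" and q = q and s = s,
        OF p(1) less_imp_le[OF p(2)] q \<theta>(1) \<theta>(2) fm A0 fA B0 fB]
    show "\<exists>f \<in> besov p q s. \<bar>v\<bar> \<le> \<bar>F f\<bar> \<and> besov_norm p q s f \<le> a k"
      using I vF by (auto simp: a_def)
  qed
  then show ?thesis by (simp add: v_def)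
qed

end

section \<open>Sampling on a grid\<close>

text \<open>The lower corner of the cell of the mesh of width \<open>1 / n\<close> that contains the point. The sampled
  function of the proof is \<open>f (a + grid n x)\<close>: it takes the value of \<open>f\<close> at the same relative position
  \<open>a\<close> in each cell.\<close>

definition grid :: "nat \<Rightarrow> real ^ 'n \<Rightarrow> real ^ 'n" where
  "grid n x = (\<chi> i. of_int \<lfloor>real n * x $ i\<rfloor> / real n)"

lemma grid_borel [measurable]: "grid n \<in> borel_measurable borel"
proof (rule borel_measurable_euclidean_space[THEN iffD2], rule ballI)
  fix b :: "real ^ 'n" assume "b \<in> Basis"
  then obtain i where b: "b = axis i 1" by (auto simp: Basis_vec_def)
  have "(\<lambda>x. grid n x \<bullet> b) = (\<lambda>x. of_int \<lfloor>real n * (x \<bullet> b)\<rfloor> / real n)"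
    by (simp add: b inner_axis grid_def fun_eq_iff)
  also have "\<dots> \<in> borel_measurable borel" by measurable
  finally show "(\<lambda>x. grid n x \<bullet> b) \<in> borel_measurable borel" .
qed

lemma grid_eq_iff:
  assumes "0 < n"
  shows "grid n x = grid n b \<longleftrightarrow> b \<in> hcube (grid n x) (1 / real n)"
proof -
  have "\<lfloor>real n * x $ i\<rfloor> = \<lfloor>real n * b $ i\<rfloor> \<longleftrightarrow>
      of_int \<lfloor>real n * x $ i\<rfloor> / real n \<le> b $ i \<and> b $ i < of_int \<lfloor>real n * x $ i\<rfloor> / real n + 1 / real n" for i
    using assms by (subst eq_commute, subst floor_eq_iff) (auto simp: field_simps)
  then show ?thesis using assms by (auto simp: vec_eq_iff grid_def hcube_def)
qed

lemma mem_grid_cell: "0 < n \<Longrightarrow> x \<in> hcube (grid n x) (1 / real n)"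
  using grid_eq_iff by blast

lemma grid_ucube_iff:
  assumes "0 < n"
  shows "grid n x \<in> ucube \<longleftrightarrow> x \<in> ucube"
proof -
  have "(0 \<le> real_of_int \<lfloor>real n * x $ i\<rfloor> / real n \<and> real_of_int \<lfloor>real n * x $ i\<rfloor> / real n < 1)
      \<longleftrightarrow> (0 \<le> x $ i \<and> x $ i < 1)" for i
  proof -
    have "0 \<le> real_of_int \<lfloor>real n * x $ i\<rfloor> / real n \<longleftrightarrow> 0 \<le> x $ i"
      using assms by (simp add: zero_le_divide_iff zero_le_mult_iff)
    moreover have "real_of_int \<lfloor>real n * x $ i\<rfloor> / real n < 1 \<longleftrightarrow> \<lfloor>real n * x $ i\<rfloor> < int n"
      using assms by (simp add: divide_less_eq) (metis of_int_less_iff of_int_of_nat_eq)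
    moreover have "\<dots> \<longleftrightarrow> x $ i < 1"
      using assms by (simp add: floor_less_iff)
    ultimately show ?thesis by simp
  qed
  then show ?thesis by (simp add: hcube_def grid_def)
qed

lemma grid_shift:
  assumes "0 < n" "\<And>i. real n * v $ i \<in> \<int>"
  shows "grid n (x + v) = grid n x + v"
proof -
  have "\<lfloor>real n * x $ i + real n * v $ i\<rfloor> = \<lfloor>real n * x $ i\<rfloor> + \<lfloor>real n * v $ i\<rfloor>" for i
    using assms(2)[of i] by (auto elim!: Ints_cases)
  then have *: "real_of_int \<lfloor>real n * (x + v) $ i\<rfloor> / real n
      = (of_int \<lfloor>real n * x $ i\<rfloor> + of_int \<lfloor>real n * v $ i\<rfloor>) / real n" for i
    by (simp add: distrib_left)
  have **: "of_int \<lfloor>real n * v $ i\<rfloor> = real n * v $ i" for i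
    using assms(2)[of i] by (auto elim!: Ints_cases)
  have "real_of_int \<lfloor>real n * (x + v) $ i\<rfloor> / real n
      = of_int \<lfloor>real n * x $ i\<rfloor> / real n + v $ i" for i
    unfolding * ** using assms(1) by (simp add: add_divide_distrib)
  then show ?thesis by (simp add: grid_def vec_eq_iff)
qed

text \<open>The vectors by which the cell of a point can move under a shift of norm at most \<open>1 / n\<close>.\<close>

definition jumps :: "nat \<Rightarrow> (real ^ 'n) set" where
  "jumps n = (\<lambda>g. \<chi> i. g i / real n) ` (UNIV \<rightarrow>\<^sub>E {-1, 0, 1})"

lemma finite_jumps: "finite (jumps n)"
  unfolding jumps_def by (intro finite_imageI finite_PiE) auto

lemma card_jumps: "card (jumps n :: (real ^ 'n) set) \<le> 3 ^ CARD('n)"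
proof -
  have "card (jumps n :: (real ^ 'n) set) \<le> card ((UNIV :: 'n set) \<rightarrow>\<^sub>E {-1, 0, 1 :: real})"
    unfolding jumps_def by (intro card_image_le finite_PiE) auto
  also have "\<dots> = 3 ^ CARD('n)" by (simp add: card_PiE numeral_3_eq_3)
  finally show ?thesis .
qed

lemma mem_jumps_iff:
  fixes v :: "real ^ 'n"
  shows "v \<in> jumps n \<longleftrightarrow> (\<forall>i. v $ i \<in> {- 1 / real n, 0, 1 / real n})"
proof
  assume "v \<in> jumps n"
  then obtain g where g: "g \<in> UNIV \<rightarrow>\<^sub>E {-1, 0, 1}" "v = (\<chi> i. g i / real n)"
    unfolding jumps_def by blast
  show "\<forall>i. v $ i \<in> {- 1 / real n, 0, 1 / real n}"
  proof
    fix i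
    have "g i \<in> {-1, 0, 1}" using g(1) by (rule PiE_mem) simp
    then show "v $ i \<in> {- 1 / real n, 0, 1 / real n}" using g(2) by auto
  qed
next
  assume *: "\<forall>i. v $ i \<in> {- 1 / real n, 0, 1 / real n}"
  define g :: "'n \<Rightarrow> real" where "g i = (if v $ i = 1 / real n then 1 else if v $ i = 0 then 0 else -1)" for i
  have "v = (\<chi> i. g i / real n)"
  proof (subst vec_eq_iff, rule allI)
    fix i show "v $ i = (\<chi> i. g i / real n) $ i" using spec[OF *, of i] by (auto simp: g_def)
  qed
  moreover have "g \<in> UNIV \<rightarrow>\<^sub>E {-1, 0, 1}" by (auto simp: g_def PiE_iff)
  ultimately show "v \<in> jumps n" unfolding jumps_def by blast
qed

lemma jumps_integral: "0 < n \<Longrightarrow> v \<in> jumps n \<Longrightarrow> real n * v $ i \<in> \<int>"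
proof -
  assume n: "0 < n" and "v \<in> jumps n"
  then have "v $ i \<in> {- 1 / real n, 0, 1 / real n}" using mem_jumps_iff by blast
  then have "real n * v $ i \<in> {-1, 0, 1}" using n by auto
  then show ?thesis by auto
qed

lemma norm_le_card_mult:
  fixes x :: "real ^ 'n"
  assumes "\<And>i. \<bar>x $ i\<bar> \<le> b"
  shows "norm x \<le> real CARD('n) * b"
proof -
  have "norm x \<le> (\<Sum>i\<in>UNIV. \<bar>x $ i\<bar>)" by (rule norm_le_l1_cart)
  also have "\<dots> \<le> (\<Sum>i\<in>(UNIV :: 'n set). b)" by (intro sum_mono assms)
  finally show ?thesis by simp
qed

lemma norm_jumps_le:
  fixes v :: "real ^ 'n"
  assumes "v \<in> jumps n"
  shows "norm v \<le> real CARD('n) / real n"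
proof -
  have "\<bar>v $ i\<bar> \<le> 1 / real n" for i
    using assms mem_jumps_iff[of v n] by (auto dest!: spec[of _ i])
  from norm_le_card_mult[OF this] show ?thesis by simp
qed

lemma grid_diff_in_jumps:
  fixes x y :: "real ^ 'n"
  assumes n: "0 < n" and y: "norm y \<le> 1 / real n"
  shows "grid n (x + y) - grid n x \<in> jumps n"
  unfolding mem_jumps_iff
proof
  fix i
  define u w where "u = real n * x $ i" and "w = real n * y $ i"
  have "\<bar>y $ i\<bar> \<le> 1 / real n" using component_le_norm_cart[of y i] y by linarith
  then have "\<bar>w\<bar> \<le> 1" using n by (simp add: w_def abs_mult field_simps)
  then have "\<lfloor>u + w\<rfloor> - \<lfloor>u\<rfloor> \<in> {-1, 0, 1}" by (auto simp: abs_le_iff) linarith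
  then have *: "of_int (\<lfloor>u + w\<rfloor> - \<lfloor>u\<rfloor>) \<in> {-1, 0, 1 :: real}" by auto
  have "(grid n (x + y) - grid n x) $ i = of_int (\<lfloor>u + w\<rfloor> - \<lfloor>u\<rfloor>) / real n"
    by (simp add: grid_def u_def w_def algebra_simps diff_divide_distrib)
  then show "(grid n (x + y) - grid n x) $ i \<in> {- 1 / real n, 0, 1 / real n}"
    using * by auto
qed

text \<open>Written as a function of a difference, so that measurability in both points jointly is automatic;
  it is symmetric, and its integral in one variable is the volume of a cell. With these two facts
  sums over cells become double integrals.\<close>

definition same_cell :: "nat \<Rightarrow> real ^ 'n \<Rightarrow> real ^ 'n \<Rightarrow> ennreal" where
  "same_cell n x b = indicator {0} (grid n x - grid n b)"

lemma same_cell_borel [measurable]: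
  fixes f g :: "'a \<Rightarrow> real ^ 'n"
  assumes [measurable]: "f \<in> borel_measurable M" "g \<in> borel_measurable M"
  shows "(\<lambda>x. same_cell n (f x) (g x)) \<in> borel_measurable M"
  unfolding same_cell_def by measurable

lemma same_cell_eq: "same_cell n x b = (if grid n x = grid n b then 1 else 0)"
  by (simp add: same_cell_def indicator_def)

lemma same_cell_indicator:
  "0 < n \<Longrightarrow> same_cell n x b = indicator (hcube (grid n x) (1 / real n)) b"
  using grid_eq_iff[of n x b] by (simp add: same_cell_eq indicator_def)

lemma nn_integral_same_cell:
  fixes x :: "real ^ 'n"
  assumes "0 < n"
  shows "(\<integral>\<^sup>+b. same_cell n x b \<partial>lborel) = ennreal ((1 / real n) ^ CARD('n))"
  using assms by (simp add: same_cell_indicator emeasure_hcube)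

text \<open>Integrating over the offset \<open>a\<close> turns the sampling point into a variable \<open>b\<close> that runs through the
  cell of \<open>x\<close>.\<close>

lemma offset_average:
  fixes \<Phi> :: "real ^ 'n \<Rightarrow> real ^ 'n \<Rightarrow> ennreal"
  assumes n: "0 < n" and [measurable]: "case_prod \<Phi> \<in> borel_measurable (borel \<Otimes>\<^sub>M borel)"
  shows "(\<integral>\<^sup>+a. (\<integral>\<^sup>+x. \<Phi> x (a + grid n x) \<partial>lborel) * indicator (hcube 0 (1 / real n)) a \<partial>lborel)
    = (\<integral>\<^sup>+x. (\<integral>\<^sup>+b. \<Phi> x b * same_cell n x b \<partial>lborel) \<partial>lborel)"
proof -
  have "(\<integral>\<^sup>+a. (\<integral>\<^sup>+x. \<Phi> x (a + grid n x) \<partial>lborel) * indicator (hcube 0 (1 / real n)) a \<partial>lborel)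
      = (\<integral>\<^sup>+a. (\<integral>\<^sup>+x. \<Phi> x (a + grid n x) * indicator (hcube 0 (1 / real n)) a \<partial>lborel) \<partial>lborel)"
    by (intro nn_integral_cong nn_integral_multc[symmetric]) measurable
  also have "\<dots> = (\<integral>\<^sup>+x. (\<integral>\<^sup>+a. \<Phi> x (a + grid n x) * indicator (hcube 0 (1 / real n)) a \<partial>lborel) \<partial>lborel)"
    by (rule lborel_pair.Fubini') measurable
  also have "\<dots> = (\<integral>\<^sup>+x. (\<integral>\<^sup>+b. \<Phi> x b * same_cell n x b \<partial>lborel) \<partial>lborel)"
  proof (rule nn_integral_cong)
    fix x :: "real ^ 'n"
    have "(\<integral>\<^sup>+a. \<Phi> x (a + grid n x) * indicator (hcube 0 (1 / real n)) a \<partial>lborel)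
        = (\<integral>\<^sup>+a. \<Phi> x (a + grid n x) * same_cell n x (a + grid n x) \<partial>lborel)"
      using n by (intro nn_integral_cong) (auto simp: same_cell_indicator indicator_def hcube_def)
    also have "\<dots> = (\<integral>\<^sup>+b. \<Phi> x b * same_cell n x b \<partial>lborel)"
      by (rule nn_integral_lborel_shift[of "\<lambda>b. \<Phi> x b * same_cell n x b"]) measurable
    finally show "(\<integral>\<^sup>+a. \<Phi> x (a + grid n x) * indicator (hcube 0 (1 / real n)) a \<partial>lborel)
        = (\<integral>\<^sup>+b. \<Phi> x b * same_cell n x b \<partial>lborel)" .
  qed
  finally show ?thesis .
qed

lemma exists_le_average:
  fixes T :: "'a \<Rightarrow> ennreal"
  assumes [measurable]: "T \<in> borel_measurable M" "A \<in> sets M"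
    and A: "0 < emeasure M A" "emeasure M A < \<infinity>" and c: "c < \<infinity>"
    and int: "(\<integral>\<^sup>+x. T x * indicator A x \<partial>M) \<le> c * emeasure M A"
  shows "\<exists>a\<in>A. T a \<le> c"
proof (rule ccontr)
  assume "\<not> ?thesis"
  then have gt: "c < T a" if "a \<in> A" for a using that by (auto simp: not_le)
  have "(\<integral>\<^sup>+x. c * indicator A x \<partial>M) < (\<integral>\<^sup>+x. T x * indicator A x \<partial>M)"
  proof (rule nn_integral_less)
    show "(\<integral>\<^sup>+x. c * indicator A x \<partial>M) \<noteq> \<infinity>"
      using A c by (auto simp: nn_integral_cmult_indicator ennreal_mult_eq_top_iff)
    show "AE x in M. c * indicator A x \<le> T x * indicator A x"
      using gt by (auto simp: indicator_def intro!: AE_I2 less_imp_le)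
    show "\<not> (AE x in M. T x * indicator A x \<le> c * indicator A x)"
    proof
      assume "AE x in M. T x * indicator A x \<le> c * indicator A x"
      then have "AE x in M. x \<notin> A"
        by eventually_elim (use gt in \<open>auto simp: indicator_def not_le[symmetric] split: if_splits\<close>)
      then have "emeasure M A = 0" using AE_iff_null_sets[OF assms(2)] by auto
      with A show False by simp
    qed
  qed measurable
  with int show False by (simp add: nn_integral_cmult_indicator)
qed

context
  fixes n :: nat and p :: real and f :: "real ^ 'n \<Rightarrow> real" and m :: real
  assumes n: "0 < n" and f [measurable]: "f \<in> borel_measurable borel" and m: "0 \<le> m"
    and D: "\<And>y. norm y \<le> real CARD('n) / real n \<Longrightarrow> diffp p f y \<le> ennreal m"
begin

text \<open>Two points of a cell differ by less than \<open>1 / n\<close> in each coordinate, so after the substitution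
  \<open>b = x + h\<close> the mean error is an integral of differences of \<open>f\<close> over a cube of shifts \<open>h\<close>.\<close>

lemma sampling_error_average:
  "(\<integral>\<^sup>+a. pmass p ucube (\<lambda>x. f x - f (a + grid n x)) * indicator (hcube 0 (1 / real n)) a \<partial>lborel)
    \<le> ennreal ((2 / real n) ^ CARD('n) * m)"
proof -
  let ?B = "hcube (\<chi> i. - 1 / real n) (2 / real n) :: (real ^ 'n) set"
  define \<Phi> where "\<Phi> x b = ennreal (\<bar>f x - f b\<bar> powr p) * indicator ucube x" for x b
  have [measurable]: "case_prod \<Phi> \<in> borel_measurable (borel \<Otimes>\<^sub>M borel)"
    unfolding \<Phi>_def by measurable
  have "(\<integral>\<^sup>+a. pmass p ucube (\<lambda>x. f x - f (a + grid n x)) * indicator (hcube 0 (1 / real n)) a \<partial>lborel)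
      = (\<integral>\<^sup>+x. (\<integral>\<^sup>+b. \<Phi> x b * same_cell n x b \<partial>lborel) \<partial>lborel)"
    using offset_average[OF n, of \<Phi>] by (simp add: \<Phi>_def pmass_def)
  also have "\<dots> = (\<integral>\<^sup>+x. (\<integral>\<^sup>+h. \<Phi> x (h + x) * same_cell n x (h + x) \<partial>lborel) \<partial>lborel)"
    by (intro nn_integral_cong nn_integral_lborel_shift[symmetric]) measurable
  also have "\<dots> \<le> (\<integral>\<^sup>+x. (\<integral>\<^sup>+h. ennreal (\<bar>diff_op h f x\<bar> powr p) * indicator {x \<in> ucube. x + h \<in> ucube} x * indicator ?B h \<partial>lborel) \<partial>lborel)"
  proof (intro nn_integral_mono)
    fix x h :: "real ^ 'n"
    show "\<Phi> x (h + x) * same_cell n x (h + x)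
      \<le> ennreal (\<bar>diff_op h f x\<bar> powr p) * indicator {x \<in> ucube. x + h \<in> ucube} x * indicator ?B h"
    proof (cases "x \<in> ucube \<and> grid n x = grid n (h + x)")
      case True
      then have xh: "x + h \<in> ucube"
        using grid_ucube_iff[OF n, of x] grid_ucube_iff[OF n, of "h + x"] by (simp add: add.commute)
      have 1: "h + x \<in> hcube (grid n x) (1 / real n)" using True grid_eq_iff[OF n] by blast
      have 2: "x \<in> hcube (grid n x) (1 / real n)" by (rule mem_grid_cell[OF n])
      have "h \<in> ?B"
        unfolding hcube_def
      proof safe
        fix i
        have "grid n x $ i \<le> h $ i + x $ i" "h $ i + x $ i < grid n x $ i + 1 / real n"
          "grid n x $ i \<le> x $ i" "x $ i < grid n x $ i + 1 / real n"
          using 1 2 by (auto simp: hcube_def)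
        then show "(\<chi> i. - 1 / real n) $ i \<le> h $ i" "h $ i < (\<chi> i. - 1 / real n) $ i + 2 / real n"
          by auto
      qed
      then show ?thesis using True xh
        by (simp add: \<Phi>_def same_cell_eq diff_op_def abs_minus_commute add.commute)
    next
      case False
      then have *: "\<Phi> x (h + x) * same_cell n x (h + x) = 0" by (auto simp: \<Phi>_def same_cell_eq)
      show ?thesis unfolding * by simp
    qed
  qed
  also have "\<dots> = (\<integral>\<^sup>+h. (\<integral>\<^sup>+x. ennreal (\<bar>diff_op h f x\<bar> powr p) * indicator {x \<in> ucube. x + h \<in> ucube} x * indicator ?B h \<partial>lborel) \<partial>lborel)"
    unfolding diff_op_def indicator_def by (rule lborel_pair.Fubini') measurable
  also have "\<dots> = (\<integral>\<^sup>+h. diffp p f h * indicator ?B h \<partial>lborel)"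
    unfolding diffp_def pmass_def jcube_def by (intro nn_integral_cong nn_integral_multc) measurable
  also have "\<dots> \<le> (\<integral>\<^sup>+h. ennreal m * indicator ?B h \<partial>lborel)"
  proof (intro nn_integral_mono)
    fix h :: "real ^ 'n"
    have "norm h \<le> real CARD('n) / real n" if h: "h \<in> ?B"
    proof -
      have "\<bar>h $ i\<bar> \<le> 1 / real n" for i
      proof -
        have "- 1 / real n \<le> h $ i \<and> h $ i < - 1 / real n + 2 / real n"
          using h by (simp add: hcube_def)
        then show ?thesis by (simp add: abs_le_iff)
      qed
      from norm_le_card_mult[OF this] show ?thesis by simp
    qed
    then show "diffp p f h * indicator ?B h \<le> ennreal m * indicator ?B h"
      using D[of h] by (auto simp: indicator_def)
  qed
  also have "\<dots> = ennreal ((2 / real n) ^ CARD('n) * m)"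
    using m by (simp add: nn_integral_cmult_indicator emeasure_hcube mult.commute flip: ennreal_mult)
  finally show ?thesis .
qed

text \<open>Shifting by \<open>v\<close> maps cells to cells, so \<open>jcube v\<close> is a union of cells. After exchanging the
  integrals each point \<open>b\<close> is therefore counted with the volume of one cell.\<close>

lemma sampling_jump_average:
  assumes v: "v \<in> jumps n"
  shows "(\<integral>\<^sup>+a. pmass p (jcube v) (\<lambda>x. f (a + grid n x + v) - f (a + grid n x)) * indicator (hcube 0 (1 / real n)) a \<partial>lborel)
    \<le> ennreal ((1 / real n) ^ CARD('n) * m)"
proof -
  define \<Phi> where "\<Phi> x b = ennreal (\<bar>f (b + v) - f b\<bar> powr p) * indicator (jcube v) x" for x b
  have [measurable]: "case_prod \<Phi> \<in> borel_measurable (borel \<Otimes>\<^sub>M borel)"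
    unfolding \<Phi>_def by measurable
  have gs: "grid n (x + v) = grid n x + v" for x
    using n v jumps_integral by (intro grid_shift) auto
  have "(\<integral>\<^sup>+a. pmass p (jcube v) (\<lambda>x. f (a + grid n x + v) - f (a + grid n x)) * indicator (hcube 0 (1 / real n)) a \<partial>lborel)
      = (\<integral>\<^sup>+x. (\<integral>\<^sup>+b. \<Phi> x b * same_cell n x b \<partial>lborel) \<partial>lborel)"
    using offset_average[OF n, of \<Phi>] by (simp add: \<Phi>_def pmass_def)
  also have "\<dots> = (\<integral>\<^sup>+b. (\<integral>\<^sup>+x. \<Phi> x b * same_cell n x b \<partial>lborel) \<partial>lborel)"
    by (rule lborel_pair.Fubini') measurable
  also have "\<dots> = (\<integral>\<^sup>+b. (\<integral>\<^sup>+x. ennreal (\<bar>diff_op v f b\<bar> powr p) * indicator (jcube v) b * same_cell n b x \<partial>lborel) \<partial>lborel)"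
  proof (intro nn_integral_cong)
    fix b x :: "real ^ 'n"
    have "x \<in> jcube v \<longleftrightarrow> b \<in> jcube v" if "grid n x = grid n b"
      using that grid_ucube_iff[OF n, of x] grid_ucube_iff[OF n, of b]
        grid_ucube_iff[OF n, of "x + v"] grid_ucube_iff[OF n, of "b + v"] by (simp add: jcube_def gs)
    then show "\<Phi> x b * same_cell n x b
      = ennreal (\<bar>diff_op v f b\<bar> powr p) * indicator (jcube v) b * same_cell n b x"
      by (auto simp: \<Phi>_def same_cell_eq diff_op_def indicator_def)
  qed
  also have "\<dots> = (\<integral>\<^sup>+b. ennreal (\<bar>diff_op v f b\<bar> powr p) * indicator (jcube v) b * ennreal ((1 / real n) ^ CARD('n)) \<partial>lborel)"
    by (intro nn_integral_cong) (subst nn_integral_cmult, measurable, simp only: nn_integral_same_cell[OF n])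
  also have "\<dots> = diffp p f v * ennreal ((1 / real n) ^ CARD('n))"
    unfolding diffp_def pmass_def by (rule nn_integral_multc) measurable
  also have "\<dots> \<le> ennreal m * ennreal ((1 / real n) ^ CARD('n))"
    by (intro mult_right_mono D norm_jumps_le v) auto
  also have "\<dots> = ennreal ((1 / real n) ^ CARD('n) * m)"
    using m by (simp add: mult.commute flip: ennreal_mult)
  finally show ?thesis .
qed

text \<open>Controlling the error and all jumps by one sum yields an offset that is good for all of them at
  once. The jumps do not depend on a shift \<open>y\<close>, so the same offset serves for every \<open>y\<close>, as the supremum
  in the modulus of smoothness requires.\<close>

lemma exists_good_offset:
  "\<exists>a. pmass p ucube (\<lambda>x. f x - f (a + grid n x))
      + (\<Sum>v\<in>jumps n. pmass p (jcube v) (\<lambda>x. f (a + grid n x + v) - f (a + grid n x)))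
    \<le> ennreal ((2 ^ CARD('n) + 3 ^ CARD('n)) * m)"
proof -
  let ?C = "hcube 0 (1 / real n) :: (real ^ 'n) set"
  define \<kappa> where "\<kappa> = (1 / real n) ^ CARD('n)"
  define E where "E a = pmass p ucube (\<lambda>x. f x - f (a + grid n x))" for a
  define S where "S v a = pmass p (jcube v) (\<lambda>x. f (a + grid n x + v) - f (a + grid n x))" for v a
  have \<kappa>: "0 < \<kappa>" using n by (simp add: \<kappa>_def)
  have em: "emeasure lborel ?C = ennreal \<kappa>" by (simp add: emeasure_hcube \<kappa>_def)
  have [measurable]: "E \<in> borel_measurable borel"
    unfolding E_def[abs_def] pmass_def by measurable
  have [measurable]: "S v \<in> borel_measurable borel" for v
    unfolding S_def[abs_def] pmass_def by measurable
  have "(\<integral>\<^sup>+a. (E a + (\<Sum>v\<in>jumps n. S v a)) * indicator ?C a \<partial>lborel)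
      = (\<integral>\<^sup>+a. E a * indicator ?C a + (\<Sum>v\<in>jumps n. S v a * indicator ?C a) \<partial>lborel)"
    by (simp add: distrib_right sum_distrib_right)
  also have "\<dots> = (\<integral>\<^sup>+a. E a * indicator ?C a \<partial>lborel) + (\<Sum>v\<in>jumps n. \<integral>\<^sup>+a. S v a * indicator ?C a \<partial>lborel)"
    by (subst nn_integral_add, measurable, subst nn_integral_sum) auto
  also have "\<dots> \<le> ennreal ((2 / real n) ^ CARD('n) * m) + (\<Sum>v\<in>(jumps n :: (real ^ 'n) set). ennreal (\<kappa> * m))"
    unfolding E_def S_def \<kappa>_def
    by (intro add_mono sum_mono sampling_error_average sampling_jump_average)
  also have "\<dots> = ennreal ((2 ^ CARD('n) + real (card (jumps n :: (real ^ 'n) set))) * m) * ennreal \<kappa>"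
    using m \<kappa> by (simp add: \<kappa>_def ennreal_of_nat_eq_real_of_nat power_divide algebra_simps flip: ennreal_plus ennreal_mult)
  also have "\<dots> \<le> ennreal ((2 ^ CARD('n) + 3 ^ CARD('n)) * m) * emeasure lborel ?C"
  proof -
    have "real (card (jumps n :: (real ^ 'n) set)) \<le> 3 ^ CARD('n)"
      using card_jumps[where 'n = 'n, of n] by (metis of_nat_le_iff of_nat_numeral of_nat_power)
    then show ?thesis unfolding em using m by (intro mult_right_mono ennreal_leI) auto
  qed
  finally have "\<exists>a\<in>?C. E a + (\<Sum>v\<in>jumps n. S v a) \<le> ennreal ((2 ^ CARD('n) + 3 ^ CARD('n)) * m)"
    using \<kappa> by (intro exists_le_average[where M = lborel]) (auto simp: em)
  then show ?thesis by (auto simp: E_def S_def)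
qed

end

text \<open>In each cell the points that leave it under the shift by \<open>y\<close> form at most the fraction
  \<open>d n \<bar>y\<bar>\<close>, and \<open>G\<close> is constant there.\<close>

lemma cell_constant_integral_le:
  fixes G :: "real ^ 'n \<Rightarrow> ennreal"
  assumes n: "0 < n" and [measurable]: "G \<in> borel_measurable borel"
    and G: "\<And>x b. grid n x = grid n b \<Longrightarrow> G x = G b"
  shows "(\<integral>\<^sup>+x. G x * indicator {x. grid n (x + y) \<noteq> grid n x} x \<partial>lborel)
    \<le> ennreal (real CARD('n) * real n * norm y) * (\<integral>\<^sup>+x. G x \<partial>lborel)"
proof -
  define \<kappa> where "\<kappa> = (1 / real n) ^ CARD('n)"
  define A where "A = {x. grid n (x + y) \<noteq> grid n x}"
  have "A = {x. same_cell n (x + y) x = 0}" by (auto simp: A_def same_cell_eq)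
  also have "\<dots> \<in> sets borel" by measurable
  finally have [measurable]: "A \<in> sets borel" .
  have \<kappa>: "0 < \<kappa>" using n by (simp add: \<kappa>_def)
  have cell: "(\<integral>\<^sup>+x. same_cell n b x * indicator A x \<partial>lborel) \<le> ennreal (real CARD('n) * real n * norm y * \<kappa>)" for b :: "real ^ 'n"
  proof -
    let ?Q = "hcube (grid n b) (1 / real n)"
    have "(\<integral>\<^sup>+x. same_cell n b x * indicator A x \<partial>lborel) = (\<integral>\<^sup>+x. indicator {x \<in> ?Q. x + y \<notin> ?Q} x \<partial>lborel)"
    proof (rule nn_integral_cong)
      fix x :: "real ^ 'n"
      have "x \<in> ?Q \<longleftrightarrow> grid n b = grid n x" "x + y \<in> ?Q \<longleftrightarrow> grid n b = grid n (x + y)"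
        by (simp_all only: grid_eq_iff[OF n])
      then show "same_cell n b x * indicator A x = indicator {x \<in> ?Q. x + y \<notin> ?Q} x"
        by (auto simp: A_def same_cell_eq indicator_def)
    qed
    also have "\<dots> = emeasure lborel {x \<in> ?Q. x + y \<notin> ?Q}"
      by (intro nn_integral_indicator) measurable
    also have "\<dots> \<le> ennreal (real CARD('n) * (1 / real n) ^ CARD('n) * (norm y / (1 / real n)))"
      using n by (intro emeasure_hcube_exit) auto
    also have "real CARD('n) * (1 / real n) ^ CARD('n) * (norm y / (1 / real n)) = real CARD('n) * real n * norm y * \<kappa>"
      by (simp add: \<kappa>_def)
    finally show ?thesis .
  qed
  \<comment> \<open>the factor \<open>\<kappa>\<close>, the volume of a cell, is written as an integral and cancelled at the end\<close>
  have "(\<integral>\<^sup>+x. G x * indicator A x \<partial>lborel) * ennreal \<kappa>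
      = (\<integral>\<^sup>+x. (\<integral>\<^sup>+b. G x * indicator A x * same_cell n x b \<partial>lborel) \<partial>lborel)"
  proof (subst nn_integral_multc[symmetric], measurable, rule nn_integral_cong)
    fix x :: "real ^ 'n"
    show "G x * indicator A x * ennreal \<kappa> = (\<integral>\<^sup>+b. G x * indicator A x * same_cell n x b \<partial>lborel)"
      by (subst nn_integral_cmult) (auto simp: nn_integral_same_cell[OF n] \<kappa>_def)
  qed
  also have "\<dots> = (\<integral>\<^sup>+b. (\<integral>\<^sup>+x. G x * indicator A x * same_cell n x b \<partial>lborel) \<partial>lborel)"
    by (rule lborel_pair.Fubini'[symmetric]) measurable
  also have "\<dots> = (\<integral>\<^sup>+b. (\<integral>\<^sup>+x. G b * (same_cell n b x * indicator A x) \<partial>lborel) \<partial>lborel)"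
  proof (intro nn_integral_cong)
    fix b x :: "real ^ 'n"
    show "G x * indicator A x * same_cell n x b = G b * (same_cell n b x * indicator A x)"
    proof (cases "grid n x = grid n b")
      case True
      then show ?thesis using G[OF True] by (simp add: same_cell_eq)
    next
      case False
      then show ?thesis by (simp add: same_cell_eq eq_commute[of "grid n b"])
    qed
  qed
  also have "\<dots> = (\<integral>\<^sup>+b. G b * (\<integral>\<^sup>+x. same_cell n b x * indicator A x \<partial>lborel) \<partial>lborel)"
    by (intro nn_integral_cong nn_integral_cmult) measurable
  also have "\<dots> \<le> (\<integral>\<^sup>+b. G b * ennreal (real CARD('n) * real n * norm y * \<kappa>) \<partial>lborel)"
    by (intro nn_integral_mono mult_left_mono cell) auto
  also have "\<dots> = ennreal (real CARD('n) * real n * norm y) * (\<integral>\<^sup>+x. G x \<partial>lborel) * ennreal \<kappa>"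
    using \<kappa> by (subst nn_integral_multc) (auto simp: ennreal_mult mult_ac)
  finally have "ennreal \<kappa> * (\<integral>\<^sup>+x. G x * indicator A x \<partial>lborel)
      \<le> ennreal \<kappa> * (ennreal (real CARD('n) * real n * norm y) * (\<integral>\<^sup>+x. G x \<partial>lborel))"
    by (simp add: mult_ac)
  then show ?thesis
    using \<kappa> by (simp add: ennreal_mult_le_mult_iff A_def)
qed

text \<open>A difference of the sampled function is nonzero only if the shift changes the cell; then it is one
  of the jumps.\<close>

lemma diffp_sampled_le:
  fixes f :: "real ^ 'n \<Rightarrow> real" and y a :: "real ^ 'n"
  assumes n: "0 < n" and [measurable]: "f \<in> borel_measurable borel" and y: "norm y \<le> 1 / real n"
  shows "diffp p (\<lambda>x. f (a + grid n x)) y \<le> ennreal (real CARD('n) * real n * norm y) *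
    (\<Sum>v\<in>jumps n. pmass p (jcube v) (\<lambda>x. f (a + grid n x + v) - f (a + grid n x)))"
proof -
  define A where "A = {x. grid n (x + y) \<noteq> grid n x}"
  have "A = {x. same_cell n (x + y) x = 0}" by (auto simp: A_def same_cell_eq)
  also have "\<dots> \<in> sets borel" by measurable
  finally have [measurable]: "A \<in> sets borel" .
  define G where "G v x = ennreal (\<bar>f (a + grid n x + v) - f (a + grid n x)\<bar> powr p) * indicator (jcube v) x" for v x
  have Gm [measurable]: "G v \<in> borel_measurable borel" for v unfolding G_def by measurable
  have "diffp p (\<lambda>x. f (a + grid n x)) y \<le> (\<integral>\<^sup>+x. (\<Sum>v\<in>jumps n. G v x * indicator A x) \<partial>lborel)"
    unfolding diffp_def pmass_def
  proof (intro nn_integral_mono)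
    fix x :: "real ^ 'n"
    define v where "v = grid n (x + y) - grid n x"
    have v: "v \<in> jumps n" unfolding v_def by (rule grid_diff_in_jumps[OF n y])
    show "ennreal (\<bar>diff_op y (\<lambda>x. f (a + grid n x)) x\<bar> powr p) * indicator (jcube y) x
      \<le> (\<Sum>v\<in>jumps n. G v x * indicator A x)"
    proof (cases "x \<in> jcube y \<and> x \<in> A")
      case True
      have "grid n (x + v) = grid n x + v"
        using n v jumps_integral by (intro grid_shift) auto
      also have "\<dots> = grid n (x + y)" by (simp add: v_def)
      finally have "x + v \<in> ucube"
        using True grid_ucube_iff[OF n, of "x + v"] grid_ucube_iff[OF n, of "x + y"] by (simp add: jcube_def)
      then have "x \<in> jcube v" using True by (simp add: jcube_def)
      then have "ennreal (\<bar>diff_op y (\<lambda>x. f (a + grid n x)) x\<bar> powr p) * indicator (jcube y) x = G v x * indicator A x"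
        using True by (simp add: G_def diff_op_def v_def add.assoc)
      also have "\<dots> \<le> (\<Sum>v\<in>jumps n. G v x * indicator A x)"
        using finite_jumps v by (intro member_le_sum) auto
      finally show ?thesis .
    next
      case False
      then have *: "ennreal (\<bar>diff_op y (\<lambda>x. f (a + grid n x)) x\<bar> powr p) * indicator (jcube y) x = 0"
        by (auto simp: A_def diff_op_def)
      show ?thesis unfolding * by simp
    qed
  qed
  also have "\<dots> = (\<Sum>v\<in>jumps n. \<integral>\<^sup>+x. G v x * indicator A x \<partial>lborel)"
    by (intro nn_integral_sum) measurable
  also have "\<dots> \<le> (\<Sum>v\<in>jumps n. ennreal (real CARD('n) * real n * norm y) * (\<integral>\<^sup>+x. G v x \<partial>lborel))"
    unfolding A_def
  proof (intro sum_mono cell_constant_integral_le n Gm)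
    fix v x b :: "real ^ 'n" assume v: "v \<in> jumps n" and eq: "grid n x = grid n b"
    have gs: "grid n (x + v) = grid n x + v" for x
      using n v jumps_integral by (intro grid_shift) auto
    have "x \<in> jcube v \<longleftrightarrow> b \<in> jcube v"
      using eq grid_ucube_iff[OF n, of x] grid_ucube_iff[OF n, of b]
        grid_ucube_iff[OF n, of "x + v"] grid_ucube_iff[OF n, of "b + v"] by (simp add: jcube_def gs)
    then show "G v x = G v b" using eq by (simp add: G_def indicator_def)
  qed
  finally show ?thesis by (simp add: sum_distrib_left G_def pmass_def)
qed

lemma sampling:
  fixes f :: "real ^ 'n \<Rightarrow> real"
  assumes n: "0 < n" and f: "f \<in> borel_measurable borel" and m: "0 \<le> m"
    and D: "\<And>y. norm y \<le> real CARD('n) / real n \<Longrightarrow> diffp p f y \<le> ennreal m"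
  defines "c \<equiv> 2 ^ CARD('n) + 3 ^ CARD('n) :: real"
  obtains a where "pmass p ucube (\<lambda>x. f x - f (a + grid n x)) \<le> ennreal (c * m)"
    and "\<And>y. norm y \<le> 1 / real n \<Longrightarrow>
      diffp p (\<lambda>x. f (a + grid n x)) y \<le> ennreal (real CARD('n) * real n * norm y * (c * m))"
proof -
  have c: "0 \<le> c" by (simp add: c_def)
  obtain a where a: "pmass p ucube (\<lambda>x. f x - f (a + grid n x))
      + (\<Sum>v\<in>jumps n. pmass p (jcube v) (\<lambda>x. f (a + grid n x + v) - f (a + grid n x))) \<le> ennreal (c * m)"
    using exists_good_offset[OF n f m D] by (auto simp: c_def)
  have 1: "pmass p ucube (\<lambda>x. f x - f (a + grid n x)) \<le> ennreal (c * m)"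
    using a by (meson add_increasing2 order_trans zero_le order_refl)
  have "(\<Sum>v\<in>jumps n. pmass p (jcube v) (\<lambda>x. f (a + grid n x + v) - f (a + grid n x))) \<le> ennreal (c * m)"
    using a by (meson add_increasing order_trans zero_le order_refl)
  then have 2: "diffp p (\<lambda>x. f (a + grid n x)) y \<le> ennreal (real CARD('n) * real n * norm y * (c * m))"
    if "norm y \<le> 1 / real n" for y
    using order_trans[OF diffp_sampled_le[OF n f that, of p a] mult_left_mono] m c
    by (simp add: ennreal_mult)
  show ?thesis using that 1 2 by blast
qed

section \<open>Density of step functions\<close>

lemma AE_unit_cubeI:
  fixes P :: "real ^ 'n \<Rightarrow> bool"
  assumes "\<And>x. x \<in> ucube \<Longrightarrow> P x"
  shows "AE x in lebesgue_on unit_cube. P x"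
proof -
  have "negligible (unit_cube - ucube :: (real ^ 'n) set)"
    using unit_cube_diff_null[where 'a = 'n] by (simp add: negligible_iff_null_sets null_sets_completionI)
  then have "negligible {x \<in> unit_cube. \<not> P x}"
    by (rule negligible_subset) (use assms in auto)
  then show ?thesis by (simp add: AE_lebesgue_on_iff_negligible)
qed

definition besov_tail :: "real \<Rightarrow> real \<Rightarrow> real \<Rightarrow> (real \<Rightarrow> real) \<Rightarrow> real \<Rightarrow> ennreal" where
  "besov_tail p q s H \<delta> =
    (\<integral>\<^sup>+t. ennreal (t powr (- s * q - 1) * H t powr (q / p)) * indicator {0<..\<delta>} t \<partial>lborel)"

lemma besov_tail_mono: "\<delta> \<le> \<epsilon> \<Longrightarrow> besov_tail p q s H \<delta> \<le> besov_tail p q s H \<epsilon>"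
  unfolding besov_tail_def
  by (intro nn_integral_mono mult_left_mono) (auto simp: indicator_def)

lemma besov_tail_le_int: "\<delta> \<le> 1 \<Longrightarrow> besov_tail p q s H \<delta> \<le> besov_int p q s H"
  using besov_tail_mono[of \<delta> 1 p q s H] by (simp add: besov_tail_def besov_int_def)

lemma besov_tail_tendsto_0:
  assumes [measurable]: "H \<in> borel_measurable borel" and fin: "besov_int p q s H < \<infinity>"
    and \<delta>: "\<delta> \<longlonglongrightarrow> 0" "\<And>k. \<delta> k \<le> 1"
  shows "(\<lambda>k. besov_tail p q s H (\<delta> k)) \<longlonglongrightarrow> 0"
proof -
  let ?g = "\<lambda>t. ennreal (t powr (- s * q - 1) * H t powr (q / p))"
  have "(\<lambda>k. \<integral>\<^sup>+t. ?g t * indicator {0<..\<delta> k} t \<partial>lborel) \<longlonglongrightarrow> (\<integral>\<^sup>+(t::real). 0 \<partial>lborel)"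
  proof (rule nn_integral_dominated_convergence[where w = "\<lambda>t. ?g t * indicator {0<..1} t"])
    show "AE t in lborel. ?g t * indicator {0<..\<delta> k} t \<le> ?g t * indicator {0<..1} t" for k
      using \<delta>(2)[of k] by (auto intro!: AE_I2 mult_left_mono simp: indicator_def)
    show "(\<integral>\<^sup>+t. ?g t * indicator {0<..1} t \<partial>lborel) < \<infinity>" using fin by (simp add: besov_int_def)
    show "AE t in lborel. (\<lambda>k. ?g t * indicator {0<..\<delta> k} t) \<longlonglongrightarrow> 0"
    proof (rule AE_I2)
      fix t :: real
      show "(\<lambda>k. ?g t * indicator {0<..\<delta> k} t) \<longlonglongrightarrow> 0"
      proof (cases "0 < t")
        case True
        have "eventually (\<lambda>k. \<delta> k < t) sequentially" using order_tendstoD(2)[OF \<delta>(1) True] .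
        then have "eventually (\<lambda>k. ?g t * indicator {0<..\<delta> k} t = 0) sequentially"
          by eventually_elim (auto simp: indicator_def)
        then show ?thesis by (rule tendsto_eventually)
      qed (simp add: indicator_def)
    qed
  qed measurable
  then show ?thesis by (simp add: besov_tail_def)
qed

text \<open>By monotonicity the modulus at \<open>\<delta>\<close> is bounded by its mean over \<open>{\<delta><..2 * \<delta>}\<close>. This converts
  the modulus at one scale into a piece of the integral in the Besov norm: a small one when \<open>\<delta>\<close> tends
  to 0, and pieces over disjoint intervals for \<open>\<delta> = \<delta>\<^sub>0 / 2\<^sup>j\<close>.\<close>

lemma modp_weight_le:
  fixes f :: "real ^ 'n \<Rightarrow> real"
  assumes p: "0 < p" "p \<le> 1" and q: "0 < q" and s: "0 < s"
    and f: "f \<in> borel_measurable borel" "pmass p ucube f < \<infinity>" and \<delta>: "0 < \<delta>"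
  shows "ennreal (modp p f \<delta> powr (q / p) * \<delta> powr (- s * q)) \<le> ennreal (2 powr (s * q + 1)) *
    (\<integral>\<^sup>+t. ennreal (t powr (- s * q - 1) * modp p f t powr (q / p)) * indicator {\<delta><..2 * \<delta>} t \<partial>lborel)"
proof -
  let ?m = "modp p f \<delta> powr (q / p)"
  have "modp p f \<delta> \<le> modp p f t" if "\<delta> \<le> t" for t
    using modp_mono[OF p q f] that by (auto dest: monoD)
  then have m: "?m \<le> modp p f t powr (q / p)" if "\<delta> \<le> t" for t
    using that p q modp_nonneg[OF p q, of f \<delta>] by (intro powr_mono2) auto
  have "(2 * \<delta>) powr (- s * q - 1) * ?m * \<delta> * 2 powr (s * q + 1) = ?m * \<delta> powr (- s * q)"
  proof -
    have "(2 * \<delta>) powr (- s * q - 1) * \<delta> = 2 powr (- s * q - 1) * (\<delta> powr (- s * q - 1) * \<delta> powr 1)"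
      using \<delta> by (simp add: powr_mult)
    also have "\<delta> powr (- s * q - 1) * \<delta> powr 1 = \<delta> powr (- s * q)"
      unfolding powr_add[symmetric] by simp
    finally have 1: "(2 * \<delta>) powr (- s * q - 1) * \<delta> = 2 powr (- s * q - 1) * \<delta> powr (- s * q)" .
    have 2: "2 powr (- s * q - 1) * 2 powr (s * q + 1) = (1 :: real)"
      by (simp flip: powr_add)
    have "(2 * \<delta>) powr (- s * q - 1) * ?m * \<delta> * 2 powr (s * q + 1)
        = ((2 * \<delta>) powr (- s * q - 1) * \<delta>) * ?m * 2 powr (s * q + 1)" by (simp only: mult_ac)
    also have "\<dots> = (2 powr (- s * q - 1) * 2 powr (s * q + 1)) * ?m * \<delta> powr (- s * q)"
      unfolding 1 by (simp only: mult_ac)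
    finally show ?thesis unfolding 2 by simp
  qed
  then have e1: "?m * \<delta> powr (- s * q) = 2 powr (s * q + 1) * ((2 * \<delta>) powr (- s * q - 1) * ?m * \<delta>)"
    by (simp only: mult_ac)
  have e2: "(\<integral>\<^sup>+t. ennreal ((2 * \<delta>) powr (- s * q - 1) * ?m) * indicator {\<delta><..2 * \<delta>} t \<partial>lborel)
      = ennreal ((2 * \<delta>) powr (- s * q - 1) * ?m) * ennreal \<delta>"
    using \<delta> by (subst nn_integral_cmult_indicator) auto
  define Y where "Y = (2 * \<delta>) powr (- s * q - 1) * ?m"
  have "0 \<le> Y" by (simp add: Y_def)
  then have "ennreal (?m * \<delta> powr (- s * q)) = ennreal (2 powr (s * q + 1)) * 
      (\<integral>\<^sup>+t. ennreal ((2 * \<delta>) powr (- s * q - 1) * ?m) * indicator {\<delta><..2 * \<delta>} t \<partial>lborel)"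
    unfolding e2 unfolding e1 Y_def[symmetric] using \<delta> by (simp add: ennreal_mult)
  also have "\<dots> \<le> ennreal (2 powr (s * q + 1)) *
    (\<integral>\<^sup>+t. ennreal (t powr (- s * q - 1) * modp p f t powr (q / p)) * indicator {\<delta><..2 * \<delta>} t \<partial>lborel)"
  proof (intro mult_left_mono nn_integral_mono)
    fix t :: real
    have "(2 * \<delta>) powr (- s * q - 1) * ?m \<le> t powr (- s * q - 1) * modp p f t powr (q / p)"
      if t: "\<delta> < t" "t \<le> 2 * \<delta>"
    proof (rule mult_mono)
      have "0 < s * q" using s q by simp
      then show "(2 * \<delta>) powr (- s * q - 1) \<le> t powr (- s * q - 1)"
        using t \<delta> by (intro powr_mono2') auto
    qed (use m t in auto)
    then show "ennreal ((2 * \<delta>) powr (- s * q - 1) * ?m) * indicator {\<delta><..2 * \<delta>} t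
      \<le> ennreal (t powr (- s * q - 1) * modp p f t powr (q / p)) * indicator {\<delta><..2 * \<delta>} t"
      by (auto simp: indicator_def intro!: ennreal_leI)
  qed auto
  finally show ?thesis .
qed

lemma besov_int_min_le:
  fixes n :: nat
  assumes p: "0 < p" and q: "0 < q" and s: "0 < s" "s < 1 / p" and n: "0 < n"
  shows "besov_int p q s (\<lambda>t. min 1 (real n * \<bar>t\<bar>))
    \<le> ennreal (real n powr (s * q) * (1 / (q / p - s * q) + 1 / (s * q)))"
proof -
  define e where "e = q / p - s * q"
  have e: "0 < e" using q s mult_strict_left_mono[OF s(2) q] by (simp add: e_def mult.commute)
  have sq: "0 < s * q" using s q by simp
  let ?N = "real n"
  have "besov_int p q s (\<lambda>t. min 1 (?N * \<bar>t\<bar>)) \<le>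
    (\<integral>\<^sup>+t. ennreal (?N powr (q / p)) * (ennreal (t powr (e - 1)) * indicator {0<..1 / ?N} t)
      + ennreal (t powr (- (s * q) - 1)) * indicator {1 / ?N..} t \<partial>lborel)"
    unfolding besov_int_def
  proof (intro nn_integral_mono)
    fix t :: real
    show "ennreal (t powr (- s * q - 1) * min 1 (?N * \<bar>t\<bar>) powr (q / p)) * indicator {0<..1} t
      \<le> ennreal (?N powr (q / p)) * (ennreal (t powr (e - 1)) * indicator {0<..1 / ?N} t)
      + ennreal (t powr (- (s * q) - 1)) * indicator {1 / ?N..} t"
    proof (cases "0 < t")
      case t: True
      show ?thesis
      proof (cases "t \<le> 1 / ?N")
        case True
        then have "min 1 (?N * \<bar>t\<bar>) = ?N * t" using t n by (simp add: field_simps)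
        then have "t powr (- s * q - 1) * min 1 (?N * \<bar>t\<bar>) powr (q / p)
            = ?N powr (q / p) * (t powr (- s * q - 1) * t powr (q / p))"
          using t by (simp add: powr_mult)
        also have "t powr (- s * q - 1) * t powr (q / p) = t powr (e - 1)"
          unfolding powr_add[symmetric] by (simp add: e_def algebra_simps)
        finally have "ennreal (t powr (- s * q - 1) * min 1 (?N * \<bar>t\<bar>) powr (q / p)) * indicator {0<..1} t
            \<le> ennreal (?N powr (q / p)) * (ennreal (t powr (e - 1)) * indicator {0<..1 / ?N} t)"
          using True t by (simp add: indicator_def ennreal_mult)
        then show ?thesis by (rule order_trans) simp
      next
        case False
        then have "min 1 (?N * \<bar>t\<bar>) = 1" using t n by (simp add: field_simps)
        then show ?thesis using False t by (simp add: indicator_def)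
      qed
    qed (simp add: indicator_def)
  qed
  also have "\<dots> = ennreal (?N powr (q / p)) * (\<integral>\<^sup>+t. ennreal (t powr (e - 1)) * indicator {0<..1 / ?N} t \<partial>lborel)
      + (\<integral>\<^sup>+t. ennreal (t powr (- (s * q) - 1)) * indicator {1 / ?N..} t \<partial>lborel)"
    by (subst nn_integral_add, measurable, subst nn_integral_cmult) auto
  also have "\<dots> = ennreal (?N powr (q / p)) * ennreal ((1 / ?N) powr e / e) + ennreal ((1 / ?N) powr (- (s * q)) / (s * q))"
    using n e sq by (subst nn_integral_powr_0, simp, simp, subst nn_integral_powr_inf) auto
  also have "\<dots> = ennreal (?N powr (q / p) * ((1 / ?N) powr e / e) + (1 / ?N) powr (- (s * q)) / (s * q))"
    using e sq by (simp flip: ennreal_mult ennreal_plus)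
  also have "?N powr (q / p) * ((1 / ?N) powr e / e) = ?N powr (q / p - e) / e"
    using n by (simp add: powr_divide powr_diff)
  also have "(1 / ?N) powr (- (s * q)) = ?N powr (s * q)"
    using n by (simp add: powr_divide powr_minus)
  also have "q / p - e = s * q" by (simp add: e_def)
  also have "?N powr (s * q) / e + ?N powr (s * q) / (s * q) = ?N powr (s * q) * (1 / e + 1 / (s * q))"
    by (simp add: distrib_left)
  finally show ?thesis by (simp add: e_def)
qed

text \<open>For shifts below \<open>1 / n\<close> the difference of the error is bounded by the modulus of \<open>f\<close> plus
  \<open>n t\<close> times the modulus of \<open>f\<close> at \<open>d / n\<close>; for larger shifts by a constant times the latter. The first
  part contributes the tail of the norm integral near 0. The second contributes the modulus at \<open>d / n\<close>
  with weight \<open>n\<close> to the power \<open>s q\<close>, because \<open>0 < s < 1 / p\<close> makes the integral of the profile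
  \<open>min 1 (n t)\<close> scale in this way, and by \<open>modp_weight_le\<close> this is again bounded by the tail.\<close>

lemma sampling_approximates:
  fixes p q s :: real
  assumes p: "0 < p" "p \<le> 1" and q: "0 < q" and s: "0 < s" "s < 1 / p"
  obtains C where "0 \<le> C" and "\<And>(f :: real ^ 'n \<Rightarrow> real) n. f \<in> borel_measurable borel \<Longrightarrow> f \<in> besov p q s \<Longrightarrow>
    2 * CARD('n) \<le> n \<Longrightarrow> \<exists>a. (\<lambda>x. f x - f (a + grid n x)) \<in> besov p q s \<and>
      besov_norm p q s (\<lambda>x. f x - f (a + grid n x))
        \<le> (C * enn2real (besov_tail p q s (modp p f) (2 * real CARD('n) / real n))) powr (1 / q)"
proof -
  define d where "d = real CARD('n)"
  define c where "c = (2 ^ CARD('n) + 3 ^ CARD('n) :: real)"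
  define c' where "c' = 2 * d * c"
  define K where "K = 1 / (q / p - s * q) + 1 / (s * q)"
  define L where "L = d powr (s * q) * 2 powr (s * q + 1)"
  define C where "C = c powr (q / p) * L + 2 powr (q / p) * (1 + c' powr (q / p) * K * L)"
  have d1: "1 \<le> d" by (simp add: d_def Suc_leI)
  have c: "0 \<le> c" "0 \<le> c'" using d1 by (simp_all add: c_def c'_def)
  have qe: "0 < q / p - s * q" using q s mult_strict_left_mono[OF s(2) q] by (simp add: mult.commute)
  have K: "0 \<le> K" using qe q s by (simp add: K_def)
  have L: "0 \<le> L" by (simp add: L_def)
  have C: "0 \<le> C" using K L by (simp add: C_def)
  show ?thesis
  proof (rule that[OF C])
    fix f :: "real ^ 'n \<Rightarrow> real" and n :: nat
    assume f [measurable]: "f \<in> borel_measurable borel" and fb: "f \<in> besov p q s" and n: "2 * CARD('n) \<le> n"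
    have n2: "2 * d \<le> real n" using n unfolding d_def by (metis of_nat_le_iff of_nat_mult of_nat_numeral)
    then have n0: "0 < n" and N1: "1 \<le> real n" using d1 by (auto simp: Suc_leI intro!: gr0I)
    have fin: "pmass p ucube f < \<infinity>" "besov_int p q s (modp p f) < \<infinity>"
      using besov_iff[OF p q f] fb by auto
    note M [measurable] = modp_borel[OF p q f fin(1)]
    define \<delta> where "\<delta> = d / real n"
    have \<delta>: "0 < \<delta>" "2 * \<delta> \<le> 1" using d1 n2 n0 by (simp_all add: \<delta>_def field_simps)
    define m where "m = modp p f \<delta>"
    have m: "0 \<le> m" unfolding m_def by (rule modp_nonneg[OF p q])
    define \<tau> where "\<tau> = enn2real (besov_tail p q s (modp p f) (2 * \<delta>))"
    have \<tau>fin: "besov_tail p q s (modp p f) (2 * \<delta>) < \<infinity>"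
      using besov_tail_le_int[OF \<delta>(2), of p q s "modp p f"] fin(2) by (rule order.strict_trans1)
    then have \<tau>: "besov_tail p q s (modp p f) (2 * \<delta>) = ennreal \<tau>" "0 \<le> \<tau>"
      by (simp_all add: \<tau>_def)
    have X: "m powr (q / p) * real n powr (s * q) \<le> L * \<tau>"
    proof -
      have "ennreal (m powr (q / p) * \<delta> powr (- s * q)) \<le> ennreal (2 powr (s * q + 1)) *
          (\<integral>\<^sup>+t. ennreal (t powr (- s * q - 1) * modp p f t powr (q / p)) * indicator {\<delta><..2 * \<delta>} t \<partial>lborel)"
        unfolding m_def by (rule modp_weight_le[OF p q s(1) f fin(1) \<delta>(1)])
      also have "\<dots> \<le> ennreal (2 powr (s * q + 1)) * besov_tail p q s (modp p f) (2 * \<delta>)"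
        unfolding besov_tail_def using \<delta>
        by (intro mult_left_mono nn_integral_mono) (auto simp: indicator_def)
      also have "\<dots> = ennreal (2 powr (s * q + 1) * \<tau>)" using \<tau> by (simp add: ennreal_mult)
      finally have "m powr (q / p) * \<delta> powr (- s * q) \<le> 2 powr (s * q + 1) * \<tau>"
        using \<tau> by (simp add: ennreal_le_iff)
      then have le: "d powr (s * q) * (m powr (q / p) * \<delta> powr (- s * q)) \<le> d powr (s * q) * (2 powr (s * q + 1) * \<tau>)"
        by (intro mult_left_mono) auto
      have "d powr (s * q) * \<delta> powr (- s * q) = real n powr (s * q)"
        using d1 N1 by (simp add: \<delta>_def powr_divide powr_minus field_simps)
      then have eq: "d powr (s * q) * (m powr (q / p) * \<delta> powr (- s * q)) = m powr (q / p) * real n powr (s * q)"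
        by (metis mult.left_commute)
      show ?thesis using le unfolding eq L_def by (simp only: mult.assoc)
    qed
    have D: "diffp p f y \<le> ennreal m" if "norm y \<le> real CARD('n) / real n" for y
      unfolding m_def using that \<delta> by (intro diffp_le_modp[OF p q f fin(1)]) (auto simp: \<delta>_def d_def)
    obtain a where a: "pmass p ucube (\<lambda>x. f x - f (a + grid n x)) \<le> ennreal (c * m)"
      "\<And>y. norm y \<le> 1 / real n \<Longrightarrow> diffp p (\<lambda>x. f (a + grid n x)) y \<le> ennreal (d * real n * norm y * (c * m))"
      unfolding c_def d_def using sampling[OF n0 f m D] by blast
    define g where "g = (\<lambda>x. f x - f (a + grid n x))"
    have gm [measurable]: "g \<in> borel_measurable borel" unfolding g_def by measurable
    \<comment> \<open>\<open>H1\<close> is the part due to \<open>f\<close>, \<open>H2\<close> the part due to the sampled function and, for large shifts, to the error\<close>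
    define H1 where "H1 t = modp p f t * indicator {0<..1 / real n} t" for t
    define H2 where "H2 t = c' * m * min 1 (real n * \<bar>t\<bar>)" for t
    have H1m [measurable]: "H1 \<in> borel_measurable borel" unfolding H1_def by measurable
    have H2m [measurable]: "H2 \<in> borel_measurable borel" unfolding H2_def by measurable
    have nn: "0 \<le> H1 t" "0 \<le> H2 t" for t
      using modp_nonneg[OF p q, of f t] c m by (simp_all add: H1_def H2_def)
    have H: "diffp p g y \<le> ennreal (H1 t + H2 t)" if t: "0 < t" "t \<le> 1" "norm y \<le> t" for t y
    proof (cases "t \<le> 1 / real n")
      case True
      have "g = (\<lambda>x. f x + (- 1) * f (a + grid n x))" by (simp add: g_def fun_eq_iff)
      then have "diffp p g y \<le> diffp p f y + diffp p (\<lambda>x. (- 1) * f (a + grid n x)) y"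
        using p by (simp only:) (intro diffp_add_le, measurable)
      also have "diffp p (\<lambda>x. (- 1) * f (a + grid n x)) y = diffp p (\<lambda>x. f (a + grid n x)) y"
        by (subst diffp_cmult) auto
      also have "\<dots> \<le> ennreal (d * real n * norm y * (c * m))" using True t by (intro a) auto
      also have "\<dots> \<le> ennreal (H2 t)"
      proof (rule ennreal_leI)
        have "min 1 (real n * \<bar>t\<bar>) = real n * t" using True t n0 by (simp add: field_simps)
        then have "H2 t = 2 * (d * real n * t * (c * m))" by (simp add: H2_def c'_def)
        moreover have "d * real n * norm y * (c * m) \<le> d * real n * t * (c * m)"
          using t d1 c m by (intro mult_right_mono mult_left_mono) auto
        moreover have "0 \<le> d * real n * t * (c * m)" using t d1 c m by simp
        ultimately show "d * real n * norm y * (c * m) \<le> H2 t" by linarith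
      qed
      also have "diffp p f y \<le> ennreal (H1 t)"
        using diffp_le_modp[OF p q f fin(1), of y t] True t by (simp add: H1_def)
      finally show ?thesis using nn by (simp add: add_mono)
    next
      case False
      have "diffp p g y \<le> 2 * pmass p ucube g" using p by (intro diffp_le_pmass gm)
      also have "\<dots> \<le> 2 * ennreal (c * m)" using a(1) by (intro mult_left_mono) (auto simp: g_def)
      also have "\<dots> = ennreal (2 * (c * m))" using c m by (simp add: ennreal_mult)
      also have "\<dots> \<le> ennreal (H1 t + H2 t)"
      proof (rule ennreal_leI)
        have "min 1 (real n * \<bar>t\<bar>) = 1" using False t n0 by (simp add: field_simps)
        then have "H2 t = d * (2 * (c * m))" by (simp add: H2_def c'_def)
        moreover have "1 * (2 * (c * m)) \<le> d * (2 * (c * m))" using d1 c m by (intro mult_right_mono) auto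
        ultimately show "2 * (c * m) \<le> H1 t + H2 t" using nn[of t] by linarith
      qed
      finally show ?thesis .
    qed
    define B where "B = 2 powr (q / p) * (\<tau> + (c' * m) powr (q / p) * (real n powr (s * q) * K))"
    have B: "besov_int p q s (\<lambda>t. H1 t + H2 t) \<le> ennreal B"
    proof -
      have "besov_int p q s (\<lambda>t. H1 t + H2 t)
          \<le> ennreal (2 powr (q / p)) * (besov_int p q s H1 + besov_int p q s H2)"
        using p q nn by (intro besov_int_add_le) auto
      also have "besov_int p q s H1 \<le> ennreal \<tau>"
      proof -
        have "besov_int p q s H1 \<le> besov_tail p q s (modp p f) (1 / real n)"
          unfolding besov_int_def besov_tail_def
          by (intro nn_integral_mono) (auto simp: H1_def indicator_def)
        also have "\<dots> \<le> besov_tail p q s (modp p f) (2 * \<delta>)"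
          using d1 n0 by (intro besov_tail_mono) (simp add: \<delta>_def field_simps)
        finally show ?thesis by (simp add: \<tau>)
      qed
      also have "besov_int p q s H2 = ennreal ((c' * m) powr (q / p)) * besov_int p q s (\<lambda>t. min 1 (real n * \<bar>t\<bar>))"
        unfolding H2_def using c m by (intro besov_int_cmult) auto
      also have "\<dots> \<le> ennreal ((c' * m) powr (q / p)) * ennreal (real n powr (s * q) * K)"
        unfolding K_def by (intro mult_left_mono besov_int_min_le p q s n0) auto
      also have "ennreal (2 powr (q / p)) * (ennreal \<tau> + ennreal ((c' * m) powr (q / p)) * ennreal (real n powr (s * q) * K)) = ennreal B"
        using K \<tau> by (simp add: B_def flip: ennreal_mult ennreal_plus)
      finally show ?thesis by (simp add: mult_left_mono add_mono)
    qed
    have B0: "0 \<le> B" using K \<tau> by (simp add: B_def)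
    have gA: "pmass p ucube g \<le> ennreal (c * m)" using a(1) by (simp add: g_def)
    have cm: "0 \<le> c * m" using c m by simp
    have nn12: "0 \<le> H1 t + H2 t" for t using nn[of t] by simp
    have "(c * m) powr (q / p) + B \<le> C * \<tau>"
    proof -
      have "m powr (q / p) * 1 \<le> m powr (q / p) * real n powr (s * q)"
        using N1 s q by (intro mult_left_mono ge_one_powr_ge_zero) auto
      then have "m powr (q / p) \<le> L * \<tau>" using X by simp
      then have 1: "(c * m) powr (q / p) \<le> c powr (q / p) * (L * \<tau>)"
        using c m by (simp add: powr_mult mult_left_mono)
      have "(c' * m) powr (q / p) * (real n powr (s * q) * K) = c' powr (q / p) * K * (m powr (q / p) * real n powr (s * q))"
        using c m by (simp add: powr_mult)
      also have "\<dots> \<le> c' powr (q / p) * K * (L * \<tau>)" using K by (intro mult_left_mono X) auto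
      finally have "B \<le> 2 powr (q / p) * (\<tau> + c' powr (q / p) * K * (L * \<tau>))"
        unfolding B_def by (intro mult_left_mono add_left_mono) auto
      with 1 show ?thesis by (simp add: C_def algebra_simps)
    qed
    then have "((c * m) powr (q / p) + B) powr (1 / q) \<le> (C * \<tau>) powr (1 / q)"
      using B0 q by (intro powr_mono2) auto
    moreover have "g \<in> besov p q s"
      by (rule besov_intro(1)[OF p q gm cm gA _ _ B0 B]) (blast intro: nn12 H)+
    moreover have "besov_norm p q s g \<le> ((c * m) powr (q / p) + B) powr (1 / q)"
      by (rule besov_intro(2)[OF p q gm cm gA _ _ B0 B]) (blast intro: nn12 H)+
    ultimately show "\<exists>a. (\<lambda>x. f x - f (a + grid n x)) \<in> besov p q s \<and>
      besov_norm p q s (\<lambda>x. f x - f (a + grid n x))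
        \<le> (C * enn2real (besov_tail p q s (modp p f) (2 * real CARD('n) / real n))) powr (1 / q)"
      by (intro exI[of _ a]) (auto simp: g_def \<tau>_def \<delta>_def d_def)
  qed
qed

lemma finite_grid_ucube: "finite (grid n ` (ucube :: (real ^ 'n) set))"
proof (rule finite_subset)
  show "finite ((\<lambda>g. (\<chi> i. of_int (g i) / real n) :: real ^ 'n) ` (UNIV \<rightarrow>\<^sub>E {0..int n}))"
    by (intro finite_imageI finite_PiE) auto
  show "grid n ` (ucube :: (real ^ 'n) set) \<subseteq> (\<lambda>g. \<chi> i. of_int (g i) / real n) ` (UNIV \<rightarrow>\<^sub>E {0..int n})"
  proof
    fix z :: "real ^ 'n" assume "z \<in> grid n ` ucube"
    then obtain x where x: "x \<in> ucube" "z = grid n x" by blast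
    have "\<lfloor>real n * x $ i\<rfloor> \<in> {0..int n}" for i
    proof -
      have "0 \<le> x $ i" "x $ i \<le> 1" using x(1) by (auto simp: hcube_def less_imp_le)
      then have "0 \<le> real n * x $ i" "real n * x $ i \<le> real n * 1"
        by (simp, intro mult_left_mono) auto
      then show ?thesis by (auto simp: floor_le_iff)
    qed
    then have "(\<lambda>i. \<lfloor>real n * x $ i\<rfloor>) \<in> UNIV \<rightarrow>\<^sub>E {0..int n}" by (auto simp: PiE_iff)
    then show "z \<in> (\<lambda>g. \<chi> i. of_int (g i) / real n) ` (UNIV \<rightarrow>\<^sub>E {0..int n})"
      by (intro image_eqI[where x = "\<lambda>i. \<lfloor>real n * x $ i\<rfloor>"]) (simp_all add: x(2) grid_def)
  qed
qed

lemma sampled_eq_sum: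
  assumes n: "0 < n" and x: "x \<in> ucube"
  shows "f (a + grid n x) = (\<Sum>z\<in>grid n ` ucube. f (a + z) * indicat_real (hcube z (1 / real n)) x)"
proof -
  have "f (a + z) * indicat_real (hcube z (1 / real n)) x = (if z = grid n x then f (a + z) else 0)"
    if z: "z \<in> grid n ` ucube" for z
  proof -
    obtain x0 where "z = grid n x0" using z by blast
    then show ?thesis using grid_eq_iff[OF n, of x0 x] by (simp add: indicator_def)
  qed
  then have "(\<Sum>z\<in>grid n ` ucube. f (a + z) * indicat_real (hcube z (1 / real n)) x)
      = (\<Sum>z\<in>grid n ` ucube. if z = grid n x then f (a + z) else 0)"
    by (rule sum.cong[OF refl])
  also have "\<dots> = f (a + grid n x)"
    using x by (subst sum.delta) (auto simp: finite_grid_ucube)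
  finally show ?thesis by simp
qed

text \<open>Sampled functions are finite linear combinations of indicators of cubes, and they are dense.\<close>

lemma dual_determined_by_cubes:
  fixes p q s :: real and F :: "(real ^ 'n \<Rightarrow> real) \<Rightarrow> real"
  assumes p: "0 < p" "p < 1" and q: "0 < q" and s: "0 < s" "s < 1 / p"
    and F: "F \<in> besov_dual p q s"
    and cubes: "\<And>c r. 0 < r \<Longrightarrow> r \<le> 1 \<Longrightarrow> F (indicat_real (hcube c r)) = 0"
  shows "F f = 0"
proof (cases "f \<in> besov p q s")
  case False
  then show ?thesis using F by (simp add: besov_dual_def)
next
  case True
  have p1: "p \<le> 1" using p by simp
  obtain g where g [measurable]: "g \<in> borel_measurable borel" and fg: "AE x in lebesgue_on unit_cube. f x = g x"
    and gb: "g \<in> besov p q s"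
    using besov_borel_version[OF True] by metis
  have fin: "pmass p ucube g < \<infinity>" "besov_int p q s (modp p g) < \<infinity>"
    using besov_iff[OF p(1) p1 q g] gb by auto
  obtain C where C: "0 \<le> C" "\<And>(f :: real ^ 'n \<Rightarrow> real) n. f \<in> borel_measurable borel \<Longrightarrow> f \<in> besov p q s \<Longrightarrow>
    2 * CARD('n) \<le> n \<Longrightarrow> \<exists>a. (\<lambda>x. f x - f (a + grid n x)) \<in> besov p q s \<and>
      besov_norm p q s (\<lambda>x. f x - f (a + grid n x))
        \<le> (C * enn2real (besov_tail p q s (modp p f) (2 * real CARD('n) / real n))) powr (1 / q)"
    using sampling_approximates[OF p(1) p1 q s, where 'n = 'n] by blast
  define N where "N k = 2 * CARD('n) + k" for k
  define \<delta> where "\<delta> k = 2 * real CARD('n) / real (N k)" for k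
  define a where "a k = (C * enn2real (besov_tail p q s (modp p g) (\<delta> k))) powr (1 / q)" for k
  have \<delta>: "\<delta> k \<le> 1" for k by (simp add: \<delta>_def N_def divide_le_eq)
  have "filterlim (\<lambda>k. real (N k)) at_top sequentially"
    unfolding N_def by (intro filterlim_compose[OF filterlim_real_sequentially] filterlim_tendsto_add_at_top[OF tendsto_const] filterlim_ident filterlim_add_const_nat_at_top[THEN filterlim_compose]) (simp add: add.commute filterlim_add_const_nat_at_top)
  then have "\<delta> \<longlonglongrightarrow> 0"
    unfolding \<delta>_def by (intro tendsto_divide_0[OF tendsto_const] filterlim_at_top_imp_at_infinity)
  then have "(\<lambda>k. besov_tail p q s (modp p g) (\<delta> k)) \<longlonglongrightarrow> 0"
    by (intro besov_tail_tendsto_0[OF modp_borel[OF p(1) p1 q g fin(1)] fin(2)] \<delta>)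
  then have "(\<lambda>k. enn2real (besov_tail p q s (modp p g) (\<delta> k))) \<longlonglongrightarrow> enn2real 0"
    by (intro tendsto_enn2real) auto
  then have "(\<lambda>k. C * enn2real (besov_tail p q s (modp p g) (\<delta> k))) \<longlonglongrightarrow> 0"
    by (intro tendsto_mult_right_zero) simp
  then have lim: "a \<longlonglongrightarrow> 0"
    unfolding a_def using q C by (intro tendsto_zero_powrI[OF _ tendsto_const]) auto
  have "F g = 0"
  proof (rule dual_zero_limit[OF p q s F lim])
    fix k
    have n: "0 < N k" "2 * CARD('n) \<le> N k" by (simp_all add: N_def)
    obtain b where b: "(\<lambda>x. g x - g (b + grid (N k) x)) \<in> besov p q s"
      "besov_norm p q s (\<lambda>x. g x - g (b + grid (N k) x)) \<le> a k"
      unfolding a_def \<delta>_def using C(2)[OF g gb n(2)] by blast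
    define u where "u = (\<lambda>x. \<Sum>z\<in>grid (N k) ` ucube. g (b + z) * indicat_real (hcube z (1 / real (N k))) x)"
    have r: "0 < 1 / real (N k)" "1 / real (N k) \<le> 1" using n by simp_all
    have cb: "indicat_real (hcube z (1 / real (N k))) \<in> besov p q s" for z :: "real ^ 'n"
      using p p1 q s r by (intro hcube_in_besov) auto
    have tb: "(\<lambda>x. g (b + z) * indicat_real (hcube z (1 / real (N k))) x) \<in> besov p q s" for z
      using p p1 q by (intro besov_cmult cb)
    have ub: "u \<in> besov p q s"
      unfolding u_def by (intro sum_besov[OF p q s F] finite_grid_ucube tb)
    have "F u = (\<Sum>z\<in>grid (N k) ` ucube. F (\<lambda>x. g (b + z) * indicat_real (hcube z (1 / real (N k))) x))"
      unfolding u_def by (intro dual_sum[OF p q s F] finite_grid_ucube tb)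
    also have "\<dots> = 0"
      using dual_cmult[OF p q s F cb] cubes[OF r] by (intro sum.neutral) auto
    finally have Fu: "F u = 0" .
    have um [measurable]: "u \<in> borel_measurable borel" unfolding u_def by measurable
    have ae: "AE x in lebesgue_on unit_cube. g x - g (b + grid (N k) x) = g x - u x"
      unfolding u_def by (intro AE_unit_cubeI) (simp add: sampled_eq_sum[OF n(1), of _ g b])
    have gum: "(\<lambda>x. g x - u x) \<in> borel_measurable borel" by measurable
    have gub: "(\<lambda>x. g x - u x) \<in> besov p q s" "besov_norm p q s (\<lambda>x. g x - u x) \<le> a k"
      using besov_cong_AE[OF gum ae, of p q s] b by auto
    have "F (\<lambda>x. u x + (g x - u x)) = F u + F (\<lambda>x. g x - u x)"
      by (rule dual_add[OF p q s F ub gub(1)])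
    then have "F g = F (\<lambda>x. g x - u x)" using Fu by simp
    then show "\<exists>h \<in> besov p q s. \<bar>F g\<bar> \<le> \<bar>F h\<bar> \<and> besov_norm p q s h \<le> a k"
      using gub by (intro bexI[of _ "\<lambda>x. g x - u x"]) auto
  qed
  then show ?thesis using dual_cong[OF p q s F True gb fg] by simp
qed

section \<open>Embedding into the integrable functions\<close>

lemma powr_sum_le:
  fixes y :: "'a \<Rightarrow> real"
  assumes "finite A" "\<And>j. j \<in> A \<Longrightarrow> 0 \<le> y j" "0 < q" "q \<le> 1"
  shows "(\<Sum>j\<in>A. y j) powr q \<le> (\<Sum>j\<in>A. y j powr q)"
  using assms(1,2)
proof (induction A rule: finite_induct)
  case (insert a A)
  have "(y a + (\<Sum>j\<in>A. y j)) powr q \<le> y a powr q + (\<Sum>j\<in>A. y j) powr q"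
    using insert assms by (intro powr_add_le sum_nonneg) auto
  also have "\<dots> \<le> y a powr q + (\<Sum>j\<in>A. y j powr q)" using insert by auto
  finally show ?case using insert by simp
qed simp

lemma dyadic_intervals_sum:
  fixes \<delta> t :: real
  assumes "0 < \<delta>"
  shows "(\<Sum>j<J. indicator {\<delta> / 2 ^ j<..2 * (\<delta> / 2 ^ j)} t) = (indicator {2 * (\<delta> / 2 ^ J)<..2 * \<delta>} t :: ennreal)"
proof (induction J)
  case (Suc J)
  have "2 * (\<delta> / 2 ^ J) \<le> 2 * \<delta>"
    using assms by (simp add: field_simps)
  moreover have "2 * (\<delta> / 2 ^ Suc J) = \<delta> / 2 ^ J" by simp
  moreover have "\<delta> / 2 ^ J \<le> 2 * (\<delta> / 2 ^ J)"
  proof -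
    have "0 < \<delta> / 2 ^ J" using assms by simp
    then show ?thesis by linarith
  qed
  ultimately show ?case
    using Suc unfolding sum.lessThan_Suc by (auto simp: indicator_def simp del: power_Suc)
qed simp

text \<open>The intervals \<open>{\<delta> / 2\<^sup>j<..2 \<delta> / 2\<^sup>j}\<close> are disjoint and contained in \<open>{0<..1}\<close>, so the bounds of
  \<open>modp_weight_le\<close> add up to at most the norm integral.\<close>

lemma dyadic_modulus_energy:
  fixes f :: "real ^ 'n \<Rightarrow> real"
  assumes p: "0 < p" "p \<le> 1" and q: "0 < q" and s: "0 < s"
    and f: "f \<in> borel_measurable borel" "f \<in> besov p q s" and \<delta>: "0 < \<delta>" "2 * \<delta> \<le> 1"
  shows "(\<Sum>j<J. (modp p f (\<delta> / 2 ^ j) powr (1 / p) * (\<delta> / 2 ^ j) powr - s) powr q)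
    \<le> 2 powr (s * q + 1) * besov_norm p q s f powr q"
proof -
  have fin: "pmass p ucube f < \<infinity>" using besov_iff[OF p q f(1)] f by auto
  note M [measurable] = modp_borel[OF p q f(1) fin]
  let ?w = "\<lambda>t. ennreal (t powr (- s * q - 1) * modp p f t powr (q / p))"
  let ?I = "\<lambda>j. {\<delta> / 2 ^ j<..2 * (\<delta> / 2 ^ j)}"
  have "ennreal (\<Sum>j<J. (modp p f (\<delta> / 2 ^ j) powr (1 / p) * (\<delta> / 2 ^ j) powr - s) powr q)
      = (\<Sum>j<J. ennreal (modp p f (\<delta> / 2 ^ j) powr (q / p) * (\<delta> / 2 ^ j) powr (- s * q)))"
    by (subst sum_ennreal[symmetric]) (auto simp: powr_mult powr_powr)
  also have "\<dots> \<le> (\<Sum>j<J. ennreal (2 powr (s * q + 1)) * (\<integral>\<^sup>+t. ?w t * indicator (?I j) t \<partial>lborel))"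
    using \<delta> by (intro sum_mono modp_weight_le[OF p q s f(1) fin]) auto
  also have "\<dots> = ennreal (2 powr (s * q + 1)) * (\<integral>\<^sup>+t. ?w t * (\<Sum>j<J. indicator (?I j) t) \<partial>lborel)"
    unfolding sum_distrib_left[symmetric]
    by (subst nn_integral_sum[symmetric]) (auto simp: sum_distrib_left)
  also have "\<dots> \<le> ennreal (2 powr (s * q + 1)) * besov_int p q s (modp p f)"
    unfolding besov_int_def dyadic_intervals_sum[OF \<delta>(1)]
  proof (intro mult_left_mono nn_integral_mono)
    fix t :: real
    have "0 < 2 * (\<delta> / 2 ^ J)" using \<delta> by simp
    then have "{2 * (\<delta> / 2 ^ J)<..2 * \<delta>} \<subseteq> {0<..1}"
      using \<delta>(2) by (intro subsetI) (unfold greaterThanAtMost_iff, linarith)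
    then show "indicator {2 * (\<delta> / 2 ^ J)<..2 * \<delta>} t \<le> (indicator {0<..1} t :: ennreal)"
      unfolding indicator_def by (auto dest: subsetD)
  qed auto
  also have "\<dots> \<le> ennreal (2 powr (s * q + 1)) * ennreal (besov_norm p q s f powr q)"
    by (intro mult_left_mono besov_norm_bounds[OF p q f]) auto
  also have "\<dots> = ennreal (2 powr (s * q + 1) * besov_norm p q s f powr q)"
    by (simp add: ennreal_mult)
  finally show ?thesis by (subst (asm) ennreal_le_iff) auto
qed

lemma dyadic_modulus_bound:
  fixes f :: "real ^ 'n \<Rightarrow> real"
  assumes p: "0 < p" "p \<le> 1" and q: "0 < q" and s: "0 < s"
    and f: "f \<in> borel_measurable borel" "f \<in> besov p q s" and \<delta>: "0 < \<delta>" "2 * \<delta> \<le> 1"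
  shows "modp p f (\<delta> / 2 ^ j) powr (1 / p) \<le>
    (2 powr (s * q + 1)) powr (1 / q) * besov_norm p q s f * (\<delta> / 2 ^ j) powr s"
proof -
  let ?y = "\<lambda>j. modp p f (\<delta> / 2 ^ j) powr (1 / p) * (\<delta> / 2 ^ j) powr - s"
  have "?y j powr q \<le> (\<Sum>i<Suc j. ?y i powr q)"
    by (intro member_le_sum) auto
  also have "\<dots> \<le> 2 powr (s * q + 1) * besov_norm p q s f powr q"
    by (rule dyadic_modulus_energy[OF p q s f \<delta>])
  finally have "(?y j powr q) powr (1 / q) \<le> (2 powr (s * q + 1) * besov_norm p q s f powr q) powr (1 / q)"
    using q by (intro powr_mono2) auto
  then have "?y j \<le> (2 powr (s * q + 1)) powr (1 / q) * besov_norm p q s f"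
    using q besov_norm_bounds(1)[OF p q f] by (simp add: powr_powr powr_mult)
  then have "?y j * (\<delta> / 2 ^ j) powr s \<le> (2 powr (s * q + 1)) powr (1 / q) * besov_norm p q s f * (\<delta> / 2 ^ j) powr s"
    by (intro mult_right_mono) auto
  moreover have "(\<delta> / 2 ^ j) powr - s * (\<delta> / 2 ^ j) powr s = 1"
    unfolding powr_add[symmetric] using \<delta> by simp
  ultimately show ?thesis by (simp add: mult.assoc)
qed

lemma inverse_two_power_powr: "(1 / 2 ^ j) powr \<epsilon> = (2 powr - \<epsilon>) ^ j" for \<epsilon> :: real
proof -
  have "(1 / 2 ^ j) powr \<epsilon> = (2 ^ j) powr - \<epsilon>" by (simp add: powr_divide powr_minus_divide)
  also have "\<dots> = (2 powr - \<epsilon>) ^ j"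
    by (simp add: powr_powr powr_realpow[symmetric] powr_power mult.commute del: powr_minus)
  finally show ?thesis .
qed

lemma dyadic_powr_sum_le:
  fixes \<delta> \<epsilon> :: real
  assumes "0 < \<delta>" "\<delta> \<le> 1" "0 < \<epsilon>"
  shows "(\<Sum>j<J. (\<delta> / 2 ^ j) powr \<epsilon>) \<le> 1 / (1 - 2 powr - \<epsilon>)"
proof -
  have "(\<delta> / 2 ^ j) powr \<epsilon> \<le> (2 powr - \<epsilon>) ^ j" for j
  proof -
    have "(\<delta> / 2 ^ j) powr \<epsilon> \<le> (1 / 2 ^ j) powr \<epsilon>"
      using assms by (intro powr_mono2 divide_right_mono) auto
    also have "\<dots> = (2 powr - \<epsilon>) ^ j" by (rule inverse_two_power_powr)
    finally show ?thesis .
  qed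
  then have "(\<Sum>j<J. (\<delta> / 2 ^ j) powr \<epsilon>) \<le> (\<Sum>j<J. (2 powr - \<epsilon>) ^ j)" by (intro sum_mono)
  also have "\<dots> \<le> 1 / (1 - 2 powr - \<epsilon>)"
    using assms by (intro geometric_sum_le) (auto simp: powr_less_one)
  finally show ?thesis .
qed

text \<open>For \<open>\<sigma> < s\<close> the terms are bounded by the norm times a geometric progression. For \<open>\<sigma> = s\<close> the
  \<open>q\<close>-th powers are summable, and \<open>q \<le> 1\<close> makes the \<open>l\<^sub>1\<close> norm at most the \<open>l\<^sub>q\<close> quasi-norm.\<close>

lemma dyadic_modulus_sum:
  fixes p q s \<sigma> :: real
  assumes p: "0 < p" "p \<le> 1" and q: "0 < q" and s: "0 < s"
    and \<sigma>: "\<sigma> < s \<or> (s = \<sigma> \<and> q \<le> 1)" and \<delta>: "0 < \<delta>" "2 * \<delta> \<le> 1"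
  obtains C where "0 \<le> C" and "\<And>(f :: real ^ 'n \<Rightarrow> real) J. f \<in> borel_measurable borel \<Longrightarrow> f \<in> besov p q s \<Longrightarrow>
    (\<Sum>j<J. (\<delta> / 2 ^ j) powr - \<sigma> * modp p f (\<delta> / 2 ^ j) powr (1 / p)) \<le> C * besov_norm p q s f"
proof (cases "\<sigma> < s")
  case True
  define C1 where "C1 = (2 powr (s * q + 1)) powr (1 / q)"
  define C where "C = C1 * (1 / (1 - 2 powr - (s - \<sigma>)))"
  have "2 powr - (s - \<sigma>) < (1::real)" using True by (simp add: powr_less_one)
  then have C: "0 \<le> C" by (simp add: C_def C1_def)
  show ?thesis
  proof (rule that[OF C])
    fix f :: "real ^ 'n \<Rightarrow> real" and J
    assume f: "f \<in> borel_measurable borel" "f \<in> besov p q s"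
    have N: "0 \<le> besov_norm p q s f" by (rule besov_norm_bounds(1)[OF p q f])
    have "(\<delta> / 2 ^ j) powr - \<sigma> * modp p f (\<delta> / 2 ^ j) powr (1 / p)
        \<le> C1 * besov_norm p q s f * (\<delta> / 2 ^ j) powr (s - \<sigma>)" for j
    proof -
      have "(\<delta> / 2 ^ j) powr - \<sigma> * modp p f (\<delta> / 2 ^ j) powr (1 / p)
          \<le> (\<delta> / 2 ^ j) powr - \<sigma> * (C1 * besov_norm p q s f * (\<delta> / 2 ^ j) powr s)"
        unfolding C1_def by (intro mult_left_mono dyadic_modulus_bound[OF p q s f \<delta>]) auto
      also have "\<dots> = C1 * besov_norm p q s f * ((\<delta> / 2 ^ j) powr - \<sigma> * (\<delta> / 2 ^ j) powr s)"
        by (simp only: mult_ac)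
      also have "(\<delta> / 2 ^ j) powr - \<sigma> * (\<delta> / 2 ^ j) powr s = (\<delta> / 2 ^ j) powr (s - \<sigma>)"
        unfolding powr_add[symmetric] by simp
      finally show ?thesis .
    qed
    then have "(\<Sum>j<J. (\<delta> / 2 ^ j) powr - \<sigma> * modp p f (\<delta> / 2 ^ j) powr (1 / p))
        \<le> (\<Sum>j<J. C1 * besov_norm p q s f * (\<delta> / 2 ^ j) powr (s - \<sigma>))" by (intro sum_mono)
    also have "\<dots> = C1 * besov_norm p q s f * (\<Sum>j<J. (\<delta> / 2 ^ j) powr (s - \<sigma>))"
      by (simp only: sum_distrib_left)
    also have "\<dots> \<le> C1 * besov_norm p q s f * (1 / (1 - 2 powr - (s - \<sigma>)))"
      using True \<delta> N by (intro mult_left_mono dyadic_powr_sum_le) (auto simp: C1_def)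
    finally show "(\<Sum>j<J. (\<delta> / 2 ^ j) powr - \<sigma> * modp p f (\<delta> / 2 ^ j) powr (1 / p)) \<le> C * besov_norm p q s f"
      by (simp only: C_def mult_ac)
  qed
next
  case False
  then have s\<sigma>: "s = \<sigma>" and q1: "q \<le> 1" using \<sigma> by auto
  define C where "C = (2 powr (s * q + 1)) powr (1 / q)"
  have C: "0 \<le> C" by (simp add: C_def)
  show ?thesis
  proof (rule that[OF C])
    fix f :: "real ^ 'n \<Rightarrow> real" and J
    assume f: "f \<in> borel_measurable borel" "f \<in> besov p q s"
    have N: "0 \<le> besov_norm p q s f" by (rule besov_norm_bounds(1)[OF p q f])
    let ?y = "\<lambda>j. modp p f (\<delta> / 2 ^ j) powr (1 / p) * (\<delta> / 2 ^ j) powr - s"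
    have "(\<Sum>j<J. ?y j) powr q \<le> (\<Sum>j<J. ?y j powr q)"
      using q q1 by (intro powr_sum_le) auto
    also have "\<dots> \<le> 2 powr (s * q + 1) * besov_norm p q s f powr q"
      by (rule dyadic_modulus_energy[OF p q s f \<delta>])
    finally have "((\<Sum>j<J. ?y j) powr q) powr (1 / q) \<le> (2 powr (s * q + 1) * besov_norm p q s f powr q) powr (1 / q)"
      using q by (intro powr_mono2) auto
    moreover have "0 \<le> (\<Sum>j<J. ?y j)" by (intro sum_nonneg) auto
    ultimately have "(\<Sum>j<J. ?y j) \<le> C * besov_norm p q s f"
      using q N by (simp add: powr_powr powr_mult C_def)
    then show "(\<Sum>j<J. (\<delta> / 2 ^ j) powr - \<sigma> * modp p f (\<delta> / 2 ^ j) powr (1 / p)) \<le> C * besov_norm p q s f"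
      unfolding s\<sigma> by (simp only: mult.commute)
  qed
qed

lemma grid_refine:
  assumes "grid (2 * n) x = grid (2 * n) b" "0 < n"
  shows "grid n x = grid n b"
proof -
  have half: "\<lfloor>u\<rfloor> = \<lfloor>2 * u\<rfloor> div 2" for u :: real
    by linarith
  have "\<lfloor>2 * (real n * x $ i)\<rfloor> = \<lfloor>2 * (real n * b $ i)\<rfloor>" for i
    using assms by (simp add: grid_def vec_eq_iff mult.assoc)
  then have "\<lfloor>real n * x $ i\<rfloor> = \<lfloor>real n * b $ i\<rfloor>" for i
    by (subst (1 2) half) simp
  then show ?thesis by (simp add: grid_def vec_eq_iff)
qed

text \<open>The value of \<open>g\<close> on a cell is bounded by its \<open>L\<^sub>p\<close> mass, because the cell has volume
  \<open>n\<close> to the power \<open>- d\<close>; this bounds \<open>g\<close> uniformly, and \<open>\<bar>g\<bar>\<close> is the product of \<open>\<bar>g\<bar>\<close> to the power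
  \<open>p\<close> and \<open>\<bar>g\<bar>\<close> to the power \<open>1 - p\<close>.\<close>

lemma cell_constant_pmass_1_le:
  fixes g :: "real ^ 'n \<Rightarrow> real"
  assumes p: "0 < p" "p < 1" and n: "0 < n" and g [measurable]: "g \<in> borel_measurable borel"
    and const: "\<And>x b. grid n x = grid n b \<Longrightarrow> g x = g b"
    and A: "0 \<le> A" "pmass p ucube g \<le> ennreal A"
  shows "pmass 1 ucube g \<le> ennreal (real n powr (real CARD('n) * (1 / p - 1)) * A powr (1 / p))"
proof -
  define X where "X = (A * real n ^ CARD('n)) powr (1 / p)"
  have sup: "\<bar>g x\<bar> \<le> X" if x: "x \<in> ucube" for x
  proof -
    have "ennreal (\<bar>g x\<bar> powr p) * ennreal ((1 / real n) ^ CARD('n)) = (\<integral>\<^sup>+b. ennreal (\<bar>g x\<bar> powr p) * same_cell n x b \<partial>lborel)"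
      by (subst nn_integral_cmult, measurable, simp only: nn_integral_same_cell[OF n])
    also have "\<dots> \<le> pmass p ucube g"
      unfolding pmass_def
    proof (intro nn_integral_mono)
      fix b
      show "ennreal (\<bar>g x\<bar> powr p) * same_cell n x b \<le> ennreal (\<bar>g b\<bar> powr p) * indicator ucube b"
      proof (cases "grid n x = grid n b")
        case True
        then have "b \<in> ucube" using x grid_ucube_iff[OF n, of x] grid_ucube_iff[OF n, of b] by simp
        then show ?thesis using const[OF True] by (simp add: same_cell_eq)
      qed (simp add: same_cell_eq)
    qed
    also have "\<dots> \<le> ennreal A" by (rule A)
    finally have "ennreal (\<bar>g x\<bar> powr p * (1 / real n) ^ CARD('n)) \<le> ennreal A"
      by (simp add: ennreal_mult)
    then have "\<bar>g x\<bar> powr p * (1 / real n) ^ CARD('n) \<le> A" using A by (simp add: ennreal_le_iff)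
    then have "\<bar>g x\<bar> powr p \<le> A * real n ^ CARD('n)"
      using n by (simp add: power_divide field_simps)
    then have "(\<bar>g x\<bar> powr p) powr (1 / p) \<le> X"
      unfolding X_def using p by (intro powr_mono2) auto
    then show ?thesis using p by (simp add: powr_powr)
  qed
  have "pmass 1 ucube g \<le> (\<integral>\<^sup>+x. ennreal (X powr (1 - p)) * (ennreal (\<bar>g x\<bar> powr p) * indicator ucube x) \<partial>lborel)"
    unfolding pmass_def
  proof (intro nn_integral_mono)
    fix x
    have "\<bar>g x\<bar> powr 1 \<le> X powr (1 - p) * \<bar>g x\<bar> powr p" if x: "x \<in> ucube"
    proof -
      have "\<bar>g x\<bar> powr 1 = \<bar>g x\<bar> powr (1 - p) * \<bar>g x\<bar> powr p"
        unfolding powr_add[symmetric] by simp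
      also have "\<dots> \<le> X powr (1 - p) * \<bar>g x\<bar> powr p"
        using sup[OF x] p by (intro mult_right_mono powr_mono2) auto
      finally show ?thesis .
    qed
    then show "ennreal (\<bar>g x\<bar> powr 1) * indicator ucube x
      \<le> ennreal (X powr (1 - p)) * (ennreal (\<bar>g x\<bar> powr p) * indicator ucube x)"
      by (simp add: indicator_def ennreal_leI flip: ennreal_mult)
  qed
  also have "\<dots> = ennreal (X powr (1 - p)) * pmass p ucube g"
    unfolding pmass_def by (rule nn_integral_cmult) measurable
  also have "\<dots> \<le> ennreal (X powr (1 - p)) * ennreal A" by (intro mult_left_mono A) auto
  also have "\<dots> = ennreal (X powr (1 - p) * A)" using A by (simp add: ennreal_mult)
  also have "X powr (1 - p) * A = real n powr (real CARD('n) * (1 / p - 1)) * A powr (1 / p)"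
  proof -
    have "X powr (1 - p) = (A * real n powr real CARD('n)) powr (1 / p * (1 - p))"
      using n by (simp add: X_def powr_powr powr_realpow)
    also have "1 / p * (1 - p) = 1 / p - 1" using p by (simp add: field_simps)
    also have "(A * real n powr real CARD('n)) powr (1 / p - 1) = A powr (1 / p - 1) * real n powr (real CARD('n) * (1 / p - 1))"
      using A by (simp add: powr_mult powr_powr)
    finally have "X powr (1 - p) * A = real n powr (real CARD('n) * (1 / p - 1)) * (A powr (1 / p - 1) * A powr 1)"
      using A by simp
    also have "A powr (1 / p - 1) * A powr 1 = A powr (1 / p)"
      unfolding powr_add[symmetric] by simp
    finally show ?thesis .
  qed
  finally show ?thesis .
qed

text \<open>Summability of the errors gives convergence almost everywhere of the whole sequence, so Fatou's
  lemma transfers the \<open>L\<^sub>1\<close> bound to the limit.\<close>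

lemma pmass_1_liminf_le:
  fixes f :: "real ^ 'n \<Rightarrow> real" and P :: "nat \<Rightarrow> real ^ 'n \<Rightarrow> real"
  assumes p: "0 < p" and [measurable]: "f \<in> borel_measurable borel" "\<And>j. P j \<in> borel_measurable borel"
    and err: "\<And>j. pmass p ucube (\<lambda>x. f x - P j x) \<le> ennreal (e j)" "\<And>j. 0 \<le> e j" "summable e"
    and bound: "\<And>j. pmass 1 ucube (P j) \<le> B"
  shows "pmass 1 ucube f \<le> B"
proof -
  have "(\<integral>\<^sup>+x. (\<Sum>j. ennreal (\<bar>f x - P j x\<bar> powr p) * indicator ucube x) \<partial>lborel)
      = (\<Sum>j. pmass p ucube (\<lambda>x. f x - P j x))"
    unfolding pmass_def by (intro nn_integral_suminf) measurable
  also have "\<dots> \<le> (\<Sum>j. ennreal (e j))" by (intro suminf_le err) auto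
  also have "\<dots> < \<infinity>" using err(2,3) by (simp add: suminf_ennreal2)
  finally have "AE x in lborel. (\<Sum>j. ennreal (\<bar>f x - P j x\<bar> powr p) * indicator ucube x) \<noteq> \<infinity>"
    by (intro nn_integral_PInf_AE) auto
  then have "AE x in lborel. ennreal (\<bar>f x\<bar> powr 1) * indicator ucube x
      = liminf (\<lambda>j. ennreal (\<bar>P j x\<bar> powr 1) * indicator ucube x)"
  proof eventually_elim
    case (elim x)
    show ?case
    proof (cases "x \<in> ucube")
      case True
      then have "(\<Sum>j. ennreal (\<bar>f x - P j x\<bar> powr p)) \<noteq> top" using elim by simp
      then have "summable (\<lambda>j. \<bar>f x - P j x\<bar> powr p)"
        by (intro summable_suminf_not_top) auto
      then have "(\<lambda>j. \<bar>f x - P j x\<bar> powr p) \<longlonglongrightarrow> 0" by (rule summable_LIMSEQ_zero)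
      then have "(\<lambda>j. (\<bar>f x - P j x\<bar> powr p) powr (1 / p)) \<longlonglongrightarrow> 0"
        by (rule tendsto_zero_powrI[OF _ tendsto_const]) (use p in auto)
      then have "(\<lambda>j. \<bar>f x - P j x\<bar>) \<longlonglongrightarrow> 0" using p by (simp add: powr_powr)
      then have "(\<lambda>j. f x - P j x) \<longlonglongrightarrow> 0" by (simp add: tendsto_rabs_zero_iff)
      then have "(\<lambda>j. f x - (f x - P j x)) \<longlonglongrightarrow> f x - 0" by (intro tendsto_diff tendsto_const)
      then have "(\<lambda>j. ennreal \<bar>P j x\<bar>) \<longlonglongrightarrow> ennreal \<bar>f x\<bar>"
        by (intro tendsto_ennrealI tendsto_rabs) simp
      then have "liminf (\<lambda>j. ennreal \<bar>P j x\<bar>) = ennreal \<bar>f x\<bar>"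
        by (intro lim_imp_Liminf) auto
      then show ?thesis using True by simp
    next
      case False
      then show ?thesis by (simp add: Liminf_const)
    qed
  qed
  then have "pmass 1 ucube f = (\<integral>\<^sup>+x. liminf (\<lambda>j. ennreal (\<bar>P j x\<bar> powr 1) * indicator ucube x) \<partial>lborel)"
    unfolding pmass_def by (rule nn_integral_cong_AE)
  also have "\<dots> \<le> liminf (\<lambda>j. pmass 1 ucube (P j))"
    unfolding pmass_def by (rule nn_integral_liminf) measurable
  also have "\<dots> \<le> limsup (\<lambda>j. pmass 1 ucube (P j))" by (intro Liminf_le_Limsup) simp
  also have "\<dots> \<le> B" using bound by (intro Limsup_bounded) auto
  finally show ?thesis .
qed

text \<open>The function is the limit of its samplings \<open>P j\<close> on meshes of width \<open>1 / 2\<close> to the power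
  \<open>k\<^sub>0 + j\<close>. Two consecutive ones differ by a function that is constant on the cells of the finer mesh,
  so \<open>cell_constant_pmass_1_le\<close> bounds the \<open>L\<^sub>1\<close> norm of the difference by a power of
  \<open>\<delta>\<^sub>j\<close>, which is \<open>d\<close> times the width of mesh \<open>j\<close>, with exponent \<open>- d (1 / p - 1)\<close>, times the modulus of smoothness at \<open>\<delta>\<^sub>j\<close>, up to a constant; these bounds are
  summable by \<open>dyadic_modulus_sum\<close>.\<close>

lemma besov_embeds_L1:
  fixes p q s :: real
  assumes p: "0 < p" "p < 1" and q: "0 < q" and s: "0 < s"
    and cond: "real CARD('n) * (1 / p - 1) < s \<or> (s = real CARD('n) * (1 / p - 1) \<and> q \<le> 1)"
  obtains C where "0 \<le> C" and "\<And>f :: real ^ 'n \<Rightarrow> real. f \<in> borel_measurable borel \<Longrightarrow> f \<in> besov p q s \<Longrightarrow>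
    pmass 1 ucube f \<le> ennreal (C * besov_norm p q s f)"
proof -
  have p1: "p \<le> 1" using p by simp
  define d where "d = real CARD('n)"
  define \<sigma> where "\<sigma> = d * (1 / p - 1)"
  define c where "c = (2 ^ CARD('n) + 3 ^ CARD('n) :: real)"
  have d1: "1 \<le> d" by (simp add: d_def Suc_leI)
  have c0: "0 \<le> c" by (simp add: c_def)
  \<comment> \<open>the coarsest mesh is chosen so fine that the dyadic intervals of scales lie in \<open>{0<..1}\<close>\<close>
  obtain k0 where k0: "2 * d < 2 ^ k0" using real_arch_pow[of 2 "2 * d"] by auto
  define n where "n j = (2 ^ (k0 + j) :: nat)" for j
  define \<delta> where "\<delta> = d / 2 ^ k0"
  have \<delta>: "0 < \<delta>" "2 * \<delta> \<le> 1" using d1 k0 by (simp_all add: \<delta>_def field_simps)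
  have n0: "0 < n j" for j by (simp add: n_def)
  have n\<delta>: "d / real (n j) = \<delta> / 2 ^ j" for j by (simp add: n_def \<delta>_def power_add)
  have cond': "\<sigma> < s \<or> (s = \<sigma> \<and> q \<le> 1)" using cond by (simp add: \<sigma>_def d_def)
  obtain C2 where C2: "0 \<le> C2" "\<And>(f :: real ^ 'n \<Rightarrow> real) J. f \<in> borel_measurable borel \<Longrightarrow> f \<in> besov p q s \<Longrightarrow>
    (\<Sum>j<J. (\<delta> / 2 ^ j) powr - \<sigma> * modp p f (\<delta> / 2 ^ j) powr (1 / p)) \<le> C2 * besov_norm p q s f"
    using dyadic_modulus_sum[OF p(1) p1 q s cond' \<delta>, where 'n = 'n] by blast
  define C0 where "C0 = real (n 0) powr \<sigma> * (1 + 2 * c) powr (1 / p)"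
  define C1 where "C1 = (2 * d) powr \<sigma> * (2 * c) powr (1 / p)"
  have C: "0 \<le> C0 + C1 * C2" using C2(1) by (simp add: C0_def C1_def)
  show ?thesis
  proof (rule that[OF C])
    fix f :: "real ^ 'n \<Rightarrow> real"
    assume f [measurable]: "f \<in> borel_measurable borel" and fb: "f \<in> besov p q s"
    have fin: "pmass p ucube f < \<infinity>" using besov_iff[OF p(1) p1 q f] fb by auto
    define N where "N = besov_norm p q s f"
    have N: "0 \<le> N" "pmass p ucube f \<le> ennreal (N powr p)"
      unfolding N_def using besov_norm_bounds[OF p(1) p1 q f fb] by auto
    define m where "m j = modp p f (\<delta> / 2 ^ j)" for j
    have m: "0 \<le> m j" for j unfolding m_def by (rule modp_nonneg[OF p(1) p1 q])
    have mono: "m (Suc j) \<le> m j" for j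
      unfolding m_def using \<delta> by (intro monoD[OF modp_mono[OF p(1) p1 q f fin]]) (simp add: field_simps)
    have D: "diffp p f y \<le> ennreal (m j)" if "norm y \<le> real CARD('n) / real (n j)" for y j
      unfolding m_def using that \<delta> n\<delta>[of j]
      by (intro diffp_le_modp[OF p(1) p1 q f fin]) (auto simp: d_def)
    have "\<exists>a. pmass p ucube (\<lambda>x. f x - f (a + grid (n j) x)) \<le> ennreal (c * m j)" for j
      unfolding c_def using sampling[OF n0 f m D] by blast
    then obtain a where a: "\<And>j. pmass p ucube (\<lambda>x. f x - f (a j + grid (n j) x)) \<le> ennreal (c * m j)"
      by metis
    define P where "P j x = f (a j + grid (n j) x)" for j x
    have Pm [measurable]: "P j \<in> borel_measurable borel" for j unfolding P_def by measurable
    have err: "pmass p ucube (\<lambda>x. f x - P j x) \<le> ennreal (c * m j)" for j using a by (simp add: P_def)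
    have err': "pmass p ucube (\<lambda>x. - 1 * (f x - P j x)) \<le> ennreal (c * m j)" for j
      using err[of j] by (subst pmass_cmult) auto
    have first: "pmass 1 ucube (P 0) \<le> ennreal (C0 * N)"
    proof -
      have eq: "(\<lambda>x. f x + - 1 * (f x - P 0 x)) = P 0" by (simp add: fun_eq_iff)
      have "pmass p ucube (P 0) \<le> pmass p ucube f + pmass p ucube (\<lambda>x. - 1 * (f x - P 0 x))"
        using pmass_add_le[of f "\<lambda>x. - 1 * (f x - P 0 x)" ucube p, unfolded eq] p p1 by simp
      also have "\<dots> \<le> ennreal (N powr p) + ennreal (c * (2 * N powr p))"
      proof (intro add_mono N(2) order_trans[OF err'] ennreal_leI mult_left_mono c0)
        have "m 0 \<le> 2 * enn2real (pmass p ucube f)"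
          unfolding m_def by (rule modp_le_pmass[OF p(1) p1 q f fin])
        also have "\<dots> \<le> 2 * N powr p" using N by (simp add: enn2real_leI)
        finally show "m 0 \<le> 2 * N powr p" .
      qed
      also have "\<dots> = ennreal ((1 + 2 * c) * N powr p)"
        using c0 by (simp add: algebra_simps flip: ennreal_plus)
      finally have "pmass 1 ucube (P 0) \<le> ennreal (real (n 0) powr (real CARD('n) * (1 / p - 1)) * ((1 + 2 * c) * N powr p) powr (1 / p))"
        using c0 by (intro cell_constant_pmass_1_le[OF p n0 Pm]) (auto simp: P_def)
      also have "((1 + 2 * c) * N powr p) powr (1 / p) = (1 + 2 * c) powr (1 / p) * N"
        using c0 p N by (simp add: powr_mult powr_powr)
      finally show ?thesis by (simp add: C0_def \<sigma>_def d_def mult.assoc)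
    qed
    have step: "pmass 1 ucube (\<lambda>x. P (Suc j) x - P j x) \<le> ennreal (C1 * ((\<delta> / 2 ^ j) powr - \<sigma> * m j powr (1 / p)))" for j
    proof -
      have eq: "(\<lambda>x. (f x - P j x) + - 1 * (f x - P (Suc j) x)) = (\<lambda>x. P (Suc j) x - P j x)"
        by (simp add: fun_eq_iff)
      have "pmass p ucube (\<lambda>x. P (Suc j) x - P j x)
          \<le> pmass p ucube (\<lambda>x. f x - P j x) + pmass p ucube (\<lambda>x. - 1 * (f x - P (Suc j) x))"
        using pmass_add_le[of "\<lambda>x. f x - P j x" "\<lambda>x. - 1 * (f x - P (Suc j) x)" ucube p, unfolded eq] p p1 by simp
      also have "\<dots> \<le> ennreal (c * m j) + ennreal (c * m j)"
        using mono[of j] c0 by (intro add_mono err order_trans[OF err'] ennreal_leI mult_left_mono)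
      also have "\<dots> = ennreal (2 * c * m j)" using c0 m by (simp flip: ennreal_plus)
      finally have le: "pmass p ucube (\<lambda>x. P (Suc j) x - P j x) \<le> ennreal (2 * c * m j)" .
      have nS: "n (Suc j) = 2 * n j" by (simp add: n_def)
      have "pmass 1 ucube (\<lambda>x. P (Suc j) x - P j x)
          \<le> ennreal (real (n (Suc j)) powr (real CARD('n) * (1 / p - 1)) * (2 * c * m j) powr (1 / p))"
      proof (rule cell_constant_pmass_1_le[OF p n0 _ _ _ le])
        fix x b :: "real ^ 'n" assume eq: "grid (n (Suc j)) x = grid (n (Suc j)) b"
        then have "grid (n j) x = grid (n j) b" unfolding nS using n0 by (rule grid_refine)
        with eq show "P (Suc j) x - P j x = P (Suc j) b - P j b" by (simp add: P_def)
      qed (use c0 m in auto)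
      also have "real (n (Suc j)) powr (real CARD('n) * (1 / p - 1)) = (2 * d) powr \<sigma> * (\<delta> / 2 ^ j) powr - \<sigma>"
      proof -
        have "real (n (Suc j)) = 2 * d / (\<delta> / 2 ^ j)"
          using d1 n0[of j] by (simp add: nS n\<delta>[symmetric])
        then have "real (n (Suc j)) powr \<sigma> = (2 * d / (\<delta> / 2 ^ j)) powr \<sigma>"
          by (simp only:)
        also have "\<dots> = (2 * d) powr \<sigma> / (\<delta> / 2 ^ j) powr \<sigma>"
          by (rule powr_divide)
        also have "\<dots> = (2 * d) powr \<sigma> * (\<delta> / 2 ^ j) powr - \<sigma>"
          by (simp only: powr_minus divide_inverse)
        finally show ?thesis by (simp add: \<sigma>_def d_def)
      qed
      also have "(2 * c * m j) powr (1 / p) = (2 * c) powr (1 / p) * m j powr (1 / p)"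
        using c0 m by (simp add: powr_mult)
      finally show ?thesis by (simp only: C1_def mult_ac)
    qed
    have "pmass 1 ucube (P J) \<le> ennreal (C0 * N + C1 * (\<Sum>j<J. (\<delta> / 2 ^ j) powr - \<sigma> * m j powr (1 / p)))" for J
    proof (induction J)
      case 0
      show ?case using first by simp
    next
      case (Suc J)
      let ?t = "\<lambda>j. (\<delta> / 2 ^ j) powr - \<sigma> * m j powr (1 / p)"
      have nn: "0 \<le> C0 * N + C1 * (\<Sum>j<J. ?t j)" "0 \<le> C1 * ?t J"
        using N by (auto simp: C0_def C1_def intro!: add_nonneg_nonneg mult_nonneg_nonneg sum_nonneg)
      have eq: "(\<lambda>x. P J x + (P (Suc J) x - P J x)) = P (Suc J)" by (simp add: fun_eq_iff)
      have "pmass 1 ucube (P (Suc J)) \<le> pmass 1 ucube (P J) + pmass 1 ucube (\<lambda>x. P (Suc J) x - P J x)"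
        using pmass_add_le[of "P J" "\<lambda>x. P (Suc J) x - P J x" ucube 1, unfolded eq] by simp
      also have "\<dots> \<le> ennreal (C0 * N + C1 * (\<Sum>j<J. ?t j)) + ennreal (C1 * ?t J)"
        by (intro add_mono Suc step)
      also have "\<dots> = ennreal (C0 * N + C1 * (\<Sum>j<Suc J. ?t j))"
        using nn by (subst ennreal_plus[symmetric]) (simp_all add: distrib_left add.assoc)
      finally show ?case .
    qed
    moreover have "C0 * N + C1 * (\<Sum>j<J. (\<delta> / 2 ^ j) powr - \<sigma> * m j powr (1 / p)) \<le> (C0 + C1 * C2) * N" for J
    proof -
      have "C1 * (\<Sum>j<J. (\<delta> / 2 ^ j) powr - \<sigma> * m j powr (1 / p)) \<le> C1 * (C2 * N)"
        unfolding m_def N_def by (intro mult_left_mono C2(2) f fb) (simp add: C1_def)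
      then show ?thesis by (simp add: algebra_simps)
    qed
    ultimately have bound: "pmass 1 ucube (P J) \<le> ennreal ((C0 + C1 * C2) * N)" for J
      by (meson ennreal_leI order_trans)
    define K where "K = (2 powr (s * q + 1)) powr (1 / q) * N"
    have geo: "m j \<le> K powr p * (2 powr - (s * p)) ^ j" for j
    proof -
      have K0: "0 \<le> K" using N by (simp add: K_def)
      have "m j powr (1 / p) \<le> K * (\<delta> / 2 ^ j) powr s"
        unfolding m_def K_def N_def by (rule dyadic_modulus_bound[OF p(1) p1 q s f fb \<delta>])
      also have "\<dots> \<le> K * (1 / 2 ^ j) powr s"
        using K0 \<delta> s by (intro mult_left_mono powr_mono2 divide_right_mono) auto
      finally have "(m j powr (1 / p)) powr p \<le> (K * (1 / 2 ^ j) powr s) powr p"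
        using p by (intro powr_mono2) auto
      then have "m j \<le> K powr p * (1 / 2 ^ j) powr (s * p)"
        using K0 m[of j] p by (simp add: powr_mult powr_powr)
      also have "(1 / 2 ^ j) powr (s * p) = (2 powr - (s * p)) ^ j"
        by (rule inverse_two_power_powr)
      finally show ?thesis .
    qed
    have "summable (\<lambda>j. K powr p * (2 powr - (s * p)) ^ j)"
      using s p by (intro summable_mult summable_geometric) (auto simp: powr_less_one)
    then have "summable m"
    proof (rule summable_comparison_test')
      fix j :: nat assume "0 \<le> j"
      show "norm (m j) \<le> K powr p * (2 powr - (s * p)) ^ j"
        using geo[of j] m[of j] by (simp only: real_norm_def abs_of_nonneg)
    qed
    then have sum: "summable (\<lambda>j. c * m j)" by (rule summable_mult)
    have nn: "0 \<le> c * m j" for j using c0 m by simp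
    show "pmass 1 ucube f \<le> ennreal ((C0 + C1 * C2) * besov_norm p q s f)"
      unfolding N_def[symmetric] by (rule pmass_1_liminf_le[OF p(1) f Pm err nn sum bound])
  qed
qed

text \<open>By the embedding into \<open>L\<^sub>1\<close> the integral over the cube is a bounded functional.\<close>

lemma nontrivial_dual:
  fixes p q s :: real
  assumes p: "0 < p" "p < 1" and q: "0 < q" and s: "0 < s" "s < 1 / p"
    and cond: "real CARD('n) * (1 / p - 1) < s \<or> (s = real CARD('n) * (1 / p - 1) \<and> q \<le> 1)"
  shows "besov_dual p q s \<noteq> {\<lambda>_ :: real ^ 'n \<Rightarrow> real. 0}"
proof -
  have p1: "p \<le> 1" using p by simp
  let ?M = "lebesgue_on unit_cube :: (real ^ 'n) measure"
  obtain C where C: "0 \<le> C" "\<And>f :: real ^ 'n \<Rightarrow> real. f \<in> borel_measurable borel \<Longrightarrow> f \<in> besov p q s \<Longrightarrow>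
    pmass 1 ucube f \<le> ennreal (C * besov_norm p q s f)"
    using besov_embeds_L1[OF p q s(1) cond] by blast
  define L where "L f = (if f \<in> besov p q s then LINT x|?M. f x else 0)" for f :: "real ^ 'n \<Rightarrow> real"
  have meas: "f \<in> borel_measurable ?M" if "f \<in> besov p q s" for f
    using that by (simp add: besov_def Lp_space_def)
  have L1: "integrable ?M f \<and> (LINT x|?M. \<bar>f x\<bar>) \<le> C * besov_norm p q s f" if fb: "f \<in> besov p q s" for f
  proof -
    obtain g where g: "g \<in> borel_measurable borel" "AE x in ?M. f x = g x" "g \<in> besov p q s"
      "besov_norm p q s g = besov_norm p q s f"
      using besov_borel_version[OF fb] by metis
    note mf = meas[OF fb] and mg = borel_imp_lebesgue_on[OF g(1), of unit_cube]
    have G: "pmass 1 ucube g \<le> ennreal (C * besov_norm p q s f)" using C(2)[OF g(1,3)] g(4) by simp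
    then have "g \<in> Lp_space 1 unit_cube"
      unfolding Lp_space_iff[OF g(1)] by (rule order.strict_trans1) simp
    then have "integrable ?M (\<lambda>x. \<bar>g x\<bar>)" by (simp add: Lp_space_def)
    then have "integrable ?M g" using mg by (subst (asm) integrable_abs_iff) auto
    then have i: "integrable ?M f"
      using integrable_cong_AE[OF mf mg g(2)] by simp
    have "(LINT x|?M. \<bar>f x\<bar>) = (LINT x|?M. \<bar>g x\<bar>)"
      using mf mg g(2) by (intro integral_cong_AE) (auto elim!: eventually_mono)
    also have "\<dots> = Lp_norm 1 unit_cube g" by (simp add: Lp_norm_def)
    also have "\<dots> = enn2real (pmass 1 ucube g)" by (simp add: Lp_norm_unit_cube[OF g(1)])
    also have "\<dots> \<le> C * besov_norm p q s f"
      using G C(1) by (intro enn2real_leI) (auto simp: besov_norm_def)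
    finally show ?thesis using i by simp
  qed
  have "L \<in> besov_dual p q s"
    unfolding besov_dual_def
  proof (intro CollectI conjI allI ballI impI)
    fix f g :: "real ^ 'n \<Rightarrow> real" assume f: "f \<in> besov p q s" and g: "g \<in> besov p q s"
    show "L f = L g" if "AE x in ?M. f x = g x"
      using f g that by (simp add: L_def) (intro integral_cong_AE meas)
    show "L (\<lambda>x. f x + g x) = L f + L g"
      using f g L1 besov_add[OF p(1) p1 q f g] by (simp add: L_def)
  next
    fix c and f :: "real ^ 'n \<Rightarrow> real" assume f: "f \<in> besov p q s"
    show "L (\<lambda>x. c * f x) = c * L f"
      using f besov_cmult[OF p(1) p1 q f, of c] by (simp add: L_def)
  next
    have "\<bar>L f\<bar> \<le> C * besov_norm p q s f" if f: "f \<in> besov p q s" for f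
    proof -
      have "\<bar>L f\<bar> \<le> (LINT x|?M. \<bar>f x\<bar>)" using f by (simp add: L_def)
      then show ?thesis using L1[OF f] by simp
    qed
    then show "\<exists>C. \<forall>f\<in>besov p q s. \<bar>L f\<bar> \<le> C * besov_norm p q s f" by blast
  qed (simp add: L_def)
  moreover have "L (indicat_real ucube) = 1"
  proof -
    have b: "indicat_real (ucube :: (real ^ 'n) set) \<in> besov p q s"
      using p p1 q s by (intro hcube_in_besov) auto
    have "L (indicat_real ucube) = (LINT x|?M. indicat_real ucube x)"
      using b by (simp only: L_def if_True)
    also have "\<dots> = (LINT x|?M. 1)"
      by (intro integral_cong_AE meas[OF b] AE_unit_cubeI) auto
    also have "\<dots> = measure ?M unit_cube" by simp
    also have "\<dots> = measure lebesgue (unit_cube :: (real ^ 'n) set)"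
      by (subst measure_restrict_space) auto
    also have "\<dots> = measure lborel (cbox 0 1 :: (real ^ 'n) set)" by (simp add: unit_cube_def)
    also have "\<dots> = 1" by (subst content_cbox_cart) (auto simp: interval_ne_empty_cart)
    finally show ?thesis .
  qed
  ultimately show ?thesis by force
qed

section \<open>Triviality of the dual\<close>

theorem theorem2:
  fixes p q s :: real
  assumes "0 < p" and "p < 1" and "0 < q" and "0 < s" and "s < 1 / p"
  shows "besov_dual p q s = {\<lambda>_ :: real ^ 'n \<Rightarrow> real. 0} \<longleftrightarrow>
    s < real CARD('n) * (1 / p - 1) \<or> (s = real CARD('n) * (1 / p - 1) \<and> 1 < q)"
proof
  assume trivial: "besov_dual p q s = {\<lambda>_ :: real ^ 'n \<Rightarrow> real. 0}"
  show "s < real CARD('n) * (1 / p - 1) \<or> (s = real CARD('n) * (1 / p - 1) \<and> 1 < q)"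
  proof (rule ccontr)
    assume "\<not> ?thesis"
    then have "real CARD('n) * (1 / p - 1) < s \<or> (s = real CARD('n) * (1 / p - 1) \<and> q \<le> 1)"
      by linarith
    from nontrivial_dual[OF assms this] trivial show False by contradiction
  qed
next
  assume cond: "s < real CARD('n) * (1 / p - 1) \<or> (s = real CARD('n) * (1 / p - 1) \<and> 1 < q)"
  have "F f = 0" if F: "F \<in> besov_dual p q s" for F :: "(real ^ 'n \<Rightarrow> real) \<Rightarrow> real" and f
    using cond
  proof
    assume sub: "s < real CARD('n) * (1 / p - 1)"
    show ?thesis
      by (rule dual_determined_by_cubes[OF assms F])
         (rule dual_vanishes_on_cubes_subcritical[OF assms F _ sub])
  next
    assume crit: "s = real CARD('n) * (1 / p - 1) \<and> 1 < q"
    show ?thesis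
      by (rule dual_determined_by_cubes[OF assms F])
         (rule dual_vanishes_on_cubes_critical[OF assms F _ _ conjunct1[OF crit] conjunct2[OF crit]])
  qed
  then have "F = (\<lambda>_. 0)" if "F \<in> besov_dual p q s" for F :: "(real ^ 'n \<Rightarrow> real) \<Rightarrow> real"
    using that by (intro ext)
  moreover have "(\<lambda>_ :: real ^ 'n \<Rightarrow> real. 0) \<in> besov_dual p q s"
    unfolding besov_dual_def by (auto intro!: exI[of _ 0])
  ultimately show "besov_dual p q s = {\<lambda>_ :: real ^ 'n \<Rightarrow> real. 0}"
    by blast
qed

end
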